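(* Let $T:E\to F$ be a generalised triple homomorphism from a JB$^*$-triple $E$ to a Jordan Banach triple $F$, and let $J=T^{-1}(\mathrm{Ann}_F(\sigma_F(T)))$. The following statements are equivalent: (a) $J$ is a norm-closed triple ideal of $E$ and $\{\mathrm{Ann}_F(\sigma_F(T)),\mathrm{Ann}_F(\sigma_F(T)),\sigma_F(T)\}=0$. (b) $T$ is continuous.
   Context: A complex (resp. real) Jordan Banach triple is a complex (resp. real) Banach space $E$ with a continuous triple product $\{\cdot,\cdot,\cdot\}:E^3\to E$ that is bilinear and symmetric in the outer variables and conjugate linear (resp. linear) in the middle one, satisfying the Jordan identity $L(a,b)L(x,y)-L(x,y)L(a,b)=L(L(a,b)x,y)-L(x,L(b,a)y)$, where $L(x,y)z=\{x,y,z\}$. A JB$^*$-triple is a complex Jordan Banach triple $E$ such that, for every $a\in E$, $L(a,a)$ is a hermitian operator with non-negative spectrum, and $\|\{a,a,a\}\|=\|a\|^3$. A (not necessarily continuous) linear mapping $T:E\to F$ between Jordan Banach triples is a generalised triple homomorphism if there is $C>0$ with $\|T(\{a,b,c\})-\{T(a),T(b),T(c)\}\|\le C\|a\|\|b\|\|c\|$ for all $a,b,c\in E$. The separating space $\sigma_F(T)$ is the set of all $z\in F$ for which there is a sequence $(x_n)$ in $E$ with $x_n\to 0$ and $T(x_n)\to z$. For a subset $B\subseteq F$, the quadratic annihilator is $\mathrm{Ann}_F(B)=\{a\in F:\{a,b,a\}=0\ \text{for all } b\in B\}$. A triple ideal of $E$ is a linear subspace $I$ with $\{E,E,I\}+\{E,I,E\}\subseteq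 I$. The condition $\{A,A,S\}=0$ for sets $A,S$ means $\{a,b,s\}=0$ for all $a,b\in A$, $s\in S$. *)

theory Defs
  imports "HOL-Analysis.Analysis"
begin

text \<open>
  The real scalar multiplication, norm and completeness come from class \<open>banach\<close>; the complex
  structure is an explicit scalar multiplication extending the real one.
\<close>

locale complex_banach_space = vector_space scale
  for scale :: "complex \<Rightarrow> 'a::banach \<Rightarrow> 'a" +
  assumes scale_of_real: "scale (of_real r) x = r *\<^sub>R x"
    and norm_scale: "norm (scale c x) = cmod c * norm x"

definition bounded_clinear ::
    "(complex \<Rightarrow> 'a::banach \<Rightarrow> 'a) \<Rightarrow> (complex \<Rightarrow> 'b::banach \<Rightarrow> 'b) \<Rightarrow> ('a \<Rightarrow> 'b) \<Rightarrow> bool" where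
  "bounded_clinear s s' H \<longleftrightarrow>
     Vector_Spaces.linear s s' H \<and> (\<exists>K. \<forall>x. norm (H x) \<le> K * norm x)"

definition op_spectrum ::
    "(complex \<Rightarrow> 'a::banach \<Rightarrow> 'a) \<Rightarrow> ('a \<Rightarrow> 'a) \<Rightarrow> complex set" where
  "op_spectrum s H = {l. \<not> (\<exists>S. bounded_clinear s s S \<and>
     (\<forall>x. S (H x - s l x) = x) \<and> (\<forall>x. H (S x) - s l (S x) = x))}"

definition op_exp ::
    "(complex \<Rightarrow> 'a::banach \<Rightarrow> 'a) \<Rightarrow> complex \<Rightarrow> ('a \<Rightarrow> 'a) \<Rightarrow> 'a \<Rightarrow> 'a" where
  "op_exp s c H x = (\<Sum>n. s (c ^ n / fact n) ((H ^^ n) x))"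

text \<open>
  An operator \<open>H\<close> is hermitian when \<open>exp (i t H)\<close> is an isometry for all real \<open>t\<close>. As these
  exponentials form a one-parameter group, on a nonzero space this is the same as
  requiring every \<open>exp (i t H)\<close> to have operator norm \<open>1\<close>.
\<close>

definition hermitian_op ::
    "(complex \<Rightarrow> 'a::banach \<Rightarrow> 'a) \<Rightarrow> ('a \<Rightarrow> 'a) \<Rightarrow> bool" where
  "hermitian_op s H \<longleftrightarrow> bounded_clinear s s H \<and>
     (\<forall>(t::real) x. norm (op_exp s (\<i> * of_real t) H x) = norm x)"

text \<open>Linearity of \<open>tp\<close> in the third variable follows from \<open>tp_linear\<close> and \<open>tp_commute\<close>.\<close>

locale jordan_banach_triple = complex_banach_space scale
  for scale :: "complex \<Rightarrow> 'a::banach \<Rightarrow> 'a" +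
  fixes tp :: "'a \<Rightarrow> 'a \<Rightarrow> 'a \<Rightarrow> 'a"
  assumes tp_continuous: "continuous_on UNIV (\<lambda>(x, y, z). tp x y z)"
    and tp_linear: "Vector_Spaces.linear scale scale (\<lambda>x. tp x y z)"
    and tp_commute: "tp x y z = tp z y x"
    and tp_add_middle: "tp x (y + y') z = tp x y z + tp x y' z"
    and tp_scale_middle: "tp x (scale c y) z = scale (cnj c) (tp x y z)"
    and jordan_identity:
      "tp a b (tp x y z) - tp x y (tp a b z) = tp (tp a b x) y z - tp x (tp b a y) z"

locale jb_star_triple = jordan_banach_triple scale tp
  for scale :: "complex \<Rightarrow> 'a::banach \<Rightarrow> 'a" and tp :: "'a \<Rightarrow> 'a \<Rightarrow> 'a \<Rightarrow> 'a" +
  assumes hermitian_L: "hermitian_op scale (\<lambda>x. tp a a x)"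
    and spectrum_L: "op_spectrum scale (\<lambda>x. tp a a x) \<subseteq> \<real>\<^sub>\<ge>\<^sub>0"
    and norm_cube: "norm (tp a a a) = norm a ^ 3"

definition generalised_triple_hom ::
    "(complex \<Rightarrow> 'a::banach \<Rightarrow> 'a) \<Rightarrow> ('a \<Rightarrow> 'a \<Rightarrow> 'a \<Rightarrow> 'a) \<Rightarrow>
     (complex \<Rightarrow> 'b::banach \<Rightarrow> 'b) \<Rightarrow> ('b \<Rightarrow> 'b \<Rightarrow> 'b \<Rightarrow> 'b) \<Rightarrow> ('a \<Rightarrow> 'b) \<Rightarrow> bool" where
  "generalised_triple_hom s tp s' tp' T \<longleftrightarrow> Vector_Spaces.linear s s' T \<and>
     (\<exists>C>0. \<forall>a b c. norm (T (tp a b c) - tp' (T a) (T b) (T c)) \<le> C * norm a * norm b * norm c)"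

definition separating_space :: "('a::banach \<Rightarrow> 'b::banach) \<Rightarrow> 'b set" where
  "separating_space T = {z. \<exists>x. x \<longlonglongrightarrow> 0 \<and> (\<lambda>n. T (x n)) \<longlonglongrightarrow> z}"

definition quadratic_annihilator :: "('b \<Rightarrow> 'b \<Rightarrow> 'b \<Rightarrow> 'b::banach) \<Rightarrow> 'b set \<Rightarrow> 'b set" where
  "quadratic_annihilator tp B = {a. \<forall>b\<in>B. tp a b a = 0}"

definition triple_ideal ::
    "(complex \<Rightarrow> 'a::banach \<Rightarrow> 'a) \<Rightarrow> ('a \<Rightarrow> 'a \<Rightarrow> 'a \<Rightarrow> 'a) \<Rightarrow> 'a set \<Rightarrow> bool" where
  "triple_ideal s tp I \<longleftrightarrow> module.subspace s I \<and>
     (\<forall>x y. \<forall>z\<in>I. tp x y z \<in> I \<and> tp x z y \<in> I)"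

end

theory Submission
  imports Defs
begin

text \<open>
  Write \<open>Q(a)x = {a,x,a}\<close> and \<open>S\<close> for the separating space; then \<open>a \<in> J\<close> if and only if \<open>T \<circ> Q(a)\<close> is
  bounded. Assume (a). By the closed graph argument and two applications of uniform boundedness
  \<open>(a,b,c) \<mapsto> {Ta,Tb,Tc}\<close> is bounded on \<open>J \<times> J \<times> J\<close>; as every \<open>x \<in> J\<close> factors as \<open>{u,y,y}\<close> with \<open>u, y \<in> J\<close> of
  controlled norm, \<open>T\<close> is bounded on \<open>J\<close>.

  It remains to see that \<open>J = E\<close>. A gliding hump shows that \<open>E\<close> contains no infinite sequence of pairwise
  orthogonal elements outside \<open>J\<close>. So if \<open>J \<noteq> E\<close>, some inner ideal \<open>M \<not>\<subseteq> J\<close> contains no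
  orthogonal pair outside \<open>J\<close>. Functional calculus then makes each \<open>h \<in> M\<close> an eigenvector modulo \<open>J\<close>,
  \<open>{h,h,h} \<in> \<complex>h + J\<close>, which forces \<open>Q(e)E \<subseteq> \<complex>e + J\<close> for \<open>e \<in> M\<close>. On \<open>\<complex>e + J\<close> the map \<open>T\<close> is
  bounded, so \<open>T \<circ> Q(e)\<close> is bounded and \<open>e \<in> J\<close>, a contradiction.

  The functional calculus avoids spectral theory. For hermitian \<open>A = L(h,h)\<close> of norm at most \<open>1/2\<close> put
  \<open>B = sin A\<close>. A polynomial in \<open>B\<close> of degree \<open>d\<close> is a Laurent polynomial in the isometry \<open>exp(iA)\<close>, so
  \<open>\<parallel>p(B)\<parallel> \<le> (2d + 1) sup |p|\<close> over \<open>[-1,1]\<close>, and the identity \<open>\<parallel>{a,a,a}\<parallel> = \<parallel>a\<parallel>\<^sup>3\<close> removes the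
  degree factor from the bound for \<open>\<parallel>p(B)h\<parallel>\<close>.
\<close>

text \<open>At the start \<open>A = L(h,h)\<close> is only known to generate isometries. The sine is
  used because it is a Laurent polynomial in exp(iA), which \<open>A\<close> itself is not. The
  obstacle is that triple products of vectors \<open>X h\<close> produce factors \<open>A\<close>,
  not \<open>B\<close>. The bound 1/2 makes \<open>V = sinc A\<close> invertible, and
  \<open>B = V A\<close> exchanges each \<open>A\<close> for a \<open>B\<close> at the cost of a
  factor 2. The bound is no restriction: \<open>h\<close> can be scaled, and as the scale tends to
  0, \<open>V\<close> tends to the unit, so results about sin A pass to \<open>A\<close>.

  The calculus lives on vectors p(B)h, not on operators. There even the unbounded function s^(-1/3)
  is admissible, which yields cube roots. They serve twice: for the factorisation in
  \<open>J\<close>, and to conclude that \<open>a\<close> lies in \<open>J\<close> when {a,a,a}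
  does. The gliding hump needs the second use. Its n-th summand must lie in the range of Q(b_n) to
  be invisible to the other Q(b_m), so T o Q(b_n)^2 has to be unbounded; this follows from Q(b)^3 =
  Q({b,b,b}).

  Boundedness of \<open>T\<close> on \<open>J\<close> alone says nothing about the rest of
  \<open>E\<close>, hence the separate proof that \<open>J\<close> is everything.\<close>

section \<open>A closed graph lemma for closed subspaces\<close>

text \<open>Zabreiko's lemma: countable subadditivity replaces continuity. The closed graph and
  uniform boundedness arguments below both reduce to it. By Baire a sublevel set of \<open>p\<close>
  is dense in some relative ball, and successive approximation turns density into a bound. A closed
  subspace instead of a whole type lets it apply to an ideal.\<close>

lemma zabreiko:
  fixes J :: "'a::banach set" and p :: "'a \<Rightarrow> real"
  assumes "closed J" "subspace J"
    and nonneg: "\<And>x. x \<in> J \<Longrightarrow> 0 \<le> p x"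
    and scale: "\<And>c x. x \<in> J \<Longrightarrow> p (c *\<^sub>R x) = \<bar>c\<bar> * p x"
    and add: "\<And>x y. x \<in> J \<Longrightarrow> y \<in> J \<Longrightarrow> p (x + y) \<le> p x + p y"
    and series: "\<And>a x. (\<And>n::nat. a n \<in> J) \<Longrightarrow> a sums x \<Longrightarrow> summable (\<lambda>n. p (a n)) \<Longrightarrow> p x \<le> (\<Sum>n. p (a n))"
  shows "\<exists>K. \<forall>x\<in>J. p x \<le> K * norm x"
proof -
  define C where "C n = closure {x \<in> J. p x \<le> real n}" for n :: nat
  have CJ: "C n \<subseteq> J" for n
    unfolding C_def by (rule closure_minimal) (use assms(1) in auto)
  have 0: "0 \<in> J" using assms(2) subspace_0 by blast
  have U: "(\<Union>n. C n) = J"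
  proof
    show "J \<subseteq> (\<Union>n. C n)"
    proof
      fix x assume "x \<in> J"
      moreover obtain n where "p x \<le> real n" using real_arch_simple by blast
      ultimately show "x \<in> (\<Union>n. C n)"
        unfolding C_def using closure_subset by fastforce
    qed
  qed (use CJ in auto)
  have "\<exists>n. top_of_set J interior_of C n \<noteq> {}"
  proof (rule ccontr)
    assume "\<not> ?thesis"
    then have "top_of_set J interior_of \<Union>(range C) = {}"
      using \<open>closed J\<close> CJ
      by (intro Baire_category_alt disjI1 completely_metrizable_space_closedin
          completely_metrizable_space_euclidean)
        (auto simp: C_def closedin_closed_eq)
    then show False using 0 U by (metis empty_iff interior_of_topspace topspace_euclidean_subtopology)
  qed
  then obtain n x0 where "x0 \<in> top_of_set J interior_of C n" by blast
  then obtain V where V: "openin (top_of_set J) V" "x0 \<in> V" "V \<subseteq> C n"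
    by (auto simp: interior_of_def)
  then obtain r where "r > 0" and r: "ball x0 r \<inter> J \<subseteq> C n"
    unfolding openin_contains_ball by blast
  have "x0 \<in> J" using V CJ by blast
  \<comment> \<open>Differences of points near \<open>x0\<close> move the centre of the ball to 0,
    which doubles the bound \<open>n\<close>.\<close>
  have apx: "\<exists>a\<in>J. p a \<le> 2 * real n \<and> norm (x - a) < e" if "x \<in> J" "norm x < r" "e > 0" for x e
  proof -
    have "x0 + x \<in> ball x0 r \<inter> J" "x0 \<in> ball x0 r \<inter> J"
      using that \<open>x0 \<in> J\<close> \<open>r > 0\<close> subspace_add[OF \<open>subspace J\<close>] by (auto simp: dist_norm)
    then have "x0 + x \<in> C n" "x0 \<in> C n" using r by auto
    then obtain a b where ab: "a \<in> J" "p a \<le> real n" "dist a (x0 + x) < e/2"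
        "b \<in> J" "p b \<le> real n" "dist b x0 < e/2"
      unfolding C_def closure_approachable using \<open>e > 0\<close> by (metis (no_types, lifting) half_gt_zero mem_Collect_eq)
    have "p (a - b) \<le> p a + p b"
      using add[of a "-1 *\<^sub>R b"] scale[of b "-1"] ab \<open>subspace J\<close> by (simp add: subspace_neg)
    moreover have "norm (x - (a - b)) < e"
      using ab(3,6) unfolding dist_norm
      using norm_triangle_ineq4[of "b - x0" "a - (x0 + x)"] by (simp add: algebra_simps)
    ultimately show ?thesis using ab subspace_diff[OF \<open>subspace J\<close>] by (intro bexI[of _ "a - b"]) auto
  qed
  have apx': "\<exists>a\<in>J. p a \<le> 2 * real n / 2^k \<and> norm (x - a) < r / 2^Suc k"
    if x: "x \<in> J" "norm x < r / 2^k" for x k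
  proof -
    obtain a where a: "a \<in> J" "p a \<le> 2 * real n" "norm (2^k *\<^sub>R x - a) < r / 2"
      using apx[of "2^k *\<^sub>R x" "r/2"] x \<open>r > 0\<close> subspace_scale[OF \<open>subspace J\<close>]
      by (auto simp: field_simps)
    have "x - (1/2^k) *\<^sub>R a = (1/2^k) *\<^sub>R (2^k *\<^sub>R x - a)"
      by (simp add: algebra_simps)
    then have "norm (x - (1/2^k) *\<^sub>R a) = norm (2^k *\<^sub>R x - a) / 2^k"
      by simp
    then show ?thesis using a subspace_scale[OF \<open>subspace J\<close>] scale[of a "1/2^k"]
      by (intro bexI[of _ "(1/2^k) *\<^sub>R a"]) (auto simp: field_simps)
  qed
  \<comment> \<open>\<open>R k\<close> is the remainder after \<open>k\<close> approximations, so
    the corrections telescope to \<open>x\<close>; their values under \<open>p\<close> add up to at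
    most 2n(1 + 1/2 + 1/4 + ...) = 4n.\<close>
  have bound: "p x \<le> 4 * real n" if x: "x \<in> J" "norm x < r" for x
  proof -
    have "\<exists>R. \<forall>k. (R k \<in> J \<and> norm (R k) < r / 2^k \<and> (k = 0 \<longrightarrow> R k = x)) \<and>
        (R k - R (Suc k) \<in> J \<and> p (R k - R (Suc k)) \<le> 2 * real n / 2^k)"
    proof (rule dependent_nat_choice)
      show "\<exists>y. y \<in> J \<and> norm y < r / 2^0 \<and> (0 = (0::nat) \<longrightarrow> y = x)" using x by simp
    next
      fix y and k :: nat
      assume y: "y \<in> J \<and> norm y < r / 2^k \<and> (k = 0 \<longrightarrow> y = x)"
      then obtain a where "a \<in> J" "p a \<le> 2 * real n / 2^k" "norm (y - a) < r / 2^Suc k"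
        using apx' by blast
      then show "\<exists>z. (z \<in> J \<and> norm z < r / 2^Suc k \<and> (Suc k = 0 \<longrightarrow> z = x)) \<and>
          (y - z \<in> J \<and> p (y - z) \<le> 2 * real n / 2^k)"
        using y subspace_diff[OF \<open>subspace J\<close>] by (intro exI[of _ "y - a"]) auto
    qed
    then obtain R where R: "\<And>k. R k \<in> J" "\<And>k. norm (R k) < r / 2^k" "R 0 = x"
      "\<And>k. R k - R (Suc k) \<in> J" "\<And>k. p (R k - R (Suc k)) \<le> 2 * real n / 2^k" by blast
    have "(\<lambda>k. r * (1/2)^k) \<longlonglongrightarrow> r * 0" by (intro tendsto_intros) auto
    then have "(\<lambda>k. r * (1/2)^k) \<longlonglongrightarrow> 0" by simp
    then have "R \<longlonglongrightarrow> 0"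
      by (rule Lim_null_comparison[rotated])
        (use R(2) less_imp_le in \<open>auto simp: power_divide intro!: always_eventually\<close>)
    then have sums: "(\<lambda>k. R k - R (Suc k)) sums x" using telescope_sums'[of R 0] R(3) by simp
    have g: "(\<lambda>k. 2 * real n * (1/2)^k) sums (2 * real n * (1 / (1 - 1/2)))"
      by (intro sums_mult geometric_sums) simp
    have sm: "summable (\<lambda>k. p (R k - R (Suc k)))"
      by (rule summable_comparison_test'[OF sums_summable[OF g], of 0])
        (use R nonneg in \<open>auto simp: power_divide\<close>)
    have "p x \<le> (\<Sum>k. p (R k - R (Suc k)))" by (rule series[OF R(4) sums sm])
    also have "\<dots> \<le> 2 * real n * (1 / (1 - 1/2))"
      unfolding sums_unique[OF g]
      by (rule suminf_le[OF _ sm sums_summable[OF g]]) (use R in \<open>auto simp: power_divide\<close>)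
    finally show ?thesis by simp
  qed
  show ?thesis
  proof (intro exI ballI)
    fix x assume x: "x \<in> J"
    show "p x \<le> (8 * real n / r) * norm x"
    proof (cases "x = 0")
      case True
      then show ?thesis using scale[OF 0, of 0] by simp
    next
      case False
      then have "p ((r / (2 * norm x)) *\<^sub>R x) \<le> 4 * real n"
        using \<open>r > 0\<close> x by (intro bound subspace_scale[OF \<open>subspace J\<close>]) auto
      then have "r / (2 * norm x) * p x \<le> 4 * real n"
        using scale[OF x, of "r / (2 * norm x)"] \<open>r > 0\<close> by simp
      then show ?thesis using False \<open>r > 0\<close> by (simp add: field_simps)
    qed
  qed
qed

section \<open>The Banach algebra of operators\<close>

text \<open>The scalar component makes the unit have norm 1 even if the underlying space is trivial.\<close>

typedef (overloaded) 'a oper = "UNIV :: (('a::real_normed_vector \<Rightarrow>\<^sub>L 'a) \<times> complex) set"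
  morphisms oper_rep oper_of by simp

setup_lifting type_definition_oper

instantiation oper :: (real_normed_vector) "{real_normed_vector, ring_1}"
begin

lift_definition zero_oper :: "'a oper" is "0" .
lift_definition one_oper :: "'a oper" is "(id_blinfun, 1)" .
lift_definition plus_oper :: "'a oper \<Rightarrow> 'a oper \<Rightarrow> 'a oper" is "(+)" .
lift_definition minus_oper :: "'a oper \<Rightarrow> 'a oper \<Rightarrow> 'a oper" is "(-)" .
lift_definition uminus_oper :: "'a oper \<Rightarrow> 'a oper" is "uminus" .
lift_definition scaleR_oper :: "real \<Rightarrow> 'a oper \<Rightarrow> 'a oper" is "scaleR" .
lift_definition times_oper :: "'a oper \<Rightarrow> 'a oper \<Rightarrow> 'a oper"
  is "\<lambda>(f, c) (g, d). (f o\<^sub>L g, c * d)" .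
lift_definition norm_oper :: "'a oper \<Rightarrow> real" is "\<lambda>(f, c). max (norm f) (norm c)" .
definition sgn_oper :: "'a oper \<Rightarrow> 'a oper" where "sgn_oper x = inverse (norm x) *\<^sub>R x"
definition dist_oper :: "'a oper \<Rightarrow> 'a oper \<Rightarrow> real" where "dist_oper x y = norm (x - y)"
definition [code del]:
  "(uniformity :: ('a oper \<times> 'a oper) filter) = (INF e\<in>{0 <..}. principal {(x, y). dist x y < e})"
definition open_oper :: "'a oper set \<Rightarrow> bool"
  where [code del]: "open_oper S = (\<forall>x\<in>S. \<forall>\<^sub>F (x', y) in uniformity. x' = x \<longrightarrow> y \<in> S)"

instance
proof
  fix x y z :: "'a oper" and a b :: real and U :: "'a oper set"
  show "dist x y = norm (x - y)" by (rule dist_oper_def)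
  show "sgn x = inverse (norm x) *\<^sub>R x" by (rule sgn_oper_def)
  show "(uniformity :: ('a oper \<times> 'a oper) filter) = (INF e\<in>{0 <..}. principal {(x, y). dist x y < e})"
    by (rule uniformity_oper_def)
  show "open U = (\<forall>x\<in>U. \<forall>\<^sub>F (x', y) in uniformity. x' = x \<longrightarrow> y \<in> U)"
    by (rule open_oper_def)
  show "norm x = 0 \<longleftrightarrow> x = 0"
  proof (transfer, clarify)
    fix f :: "'a \<Rightarrow>\<^sub>L 'a" and c :: complex
    show "max (norm f) (norm c) = 0 \<longleftrightarrow> (f, c) = 0"
      using norm_ge_zero[of f] norm_ge_zero[of c] by (auto simp: max_def zero_prod_def)
  qed
  show "norm (x + y) \<le> norm x + norm y"
  proof (transfer, clarsimp)
    fix f g :: "'a \<Rightarrow>\<^sub>L 'a" and c d :: complex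
    show "norm (f + g) \<le> max (norm f) (cmod c) + max (norm g) (cmod d) \<and>
        cmod (c + d) \<le> max (norm f) (cmod c) + max (norm g) (cmod d)"
      by (intro conjI order_trans[OF norm_triangle_ineq] add_mono) auto
  qed
  show "norm (a *\<^sub>R x) = \<bar>a\<bar> * norm x"
    by transfer (auto simp: max_mult_distrib_left)
  show "x + y + z = x + (y + z)" "x + y = y + x" "0 + x = x" "- x + x = 0" "x - y = x + - y"
    by (transfer; simp add: algebra_simps)+
  show "a *\<^sub>R (x + y) = a *\<^sub>R x + a *\<^sub>R y" "(a + b) *\<^sub>R x = a *\<^sub>R x + b *\<^sub>R x"
    "a *\<^sub>R b *\<^sub>R x = (a * b) *\<^sub>R x" "1 *\<^sub>R x = x"
    by (transfer; simp add: algebra_simps)+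
  show "x * y * z = x * (y * z)" "1 * x = x" "x * 1 = x"
    by (transfer; auto intro!: blinfun_eqI)+
  show "(x + y) * z = x * z + y * z" "x * (y + z) = x * y + x * z"
    by (transfer; auto simp: algebra_simps blinfun.bilinear_simps intro!: blinfun_eqI)+
  show "(0 :: 'a oper) \<noteq> 1" by transfer (auto simp: zero_prod_def)
qed

end

instance oper :: (real_normed_vector) real_normed_algebra_1
proof
  fix x y :: "'a oper" and a :: real
  show "a *\<^sub>R x * y = a *\<^sub>R (x * y)" "x * a *\<^sub>R y = a *\<^sub>R (x * y)"
    by (transfer; auto simp: blinfun.bilinear_simps intro!: blinfun_eqI)+
  show "norm (x * y) \<le> norm x * norm y"
  proof (transfer, clarsimp, intro conjI)
    fix f g :: "'a \<Rightarrow>\<^sub>L 'a" and c d :: complex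
    show "norm (f o\<^sub>L g) \<le> max (norm f) (cmod c) * max (norm g) (cmod d)"
      by (rule order_trans[OF norm_blinfun_compose]) (intro mult_mono; simp add: le_max_iff_disj)
    show "cmod (c * d) \<le> max (norm f) (cmod c) * max (norm g) (cmod d)"
      unfolding norm_mult by (intro mult_mono; simp add: le_max_iff_disj)
  qed
  show "norm (1 :: 'a oper) = 1"
    by transfer (simp add: max_absorb2[OF norm_blinfun_id_le])
qed

lemma norm_oper_eq: "norm x = max (norm (fst (oper_rep x))) (norm (snd (oper_rep x)))"
  by (simp add: norm_oper.rep_eq case_prod_beta)

instance oper :: (banach) banach
proof
  fix X :: "nat \<Rightarrow> 'a oper" assume X: "Cauchy X"
  define f where "f n = fst (oper_rep (X n))" for n
  define c where "c n = snd (oper_rep (X n))" for n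
  have nrm: "norm (X m - X n) = max (norm (f m - f n)) (norm (c m - c n))" for m n
    unfolding norm_oper_eq minus_oper.rep_eq f_def c_def by simp
  have "Cauchy f" "Cauchy c"
    using X unfolding Cauchy_iff nrm by (simp_all only: max_less_iff_conj) blast+
  then obtain f' c' where lim: "f \<longlonglongrightarrow> f'" "c \<longlonglongrightarrow> c'"
    unfolding Cauchy_convergent_iff convergent_def by blast
  have "(\<lambda>n. max (norm (f n - f')) (norm (c n - c'))) \<longlonglongrightarrow> max 0 0"
    using lim by (intro tendsto_max) (simp_all only: tendsto_norm_zero_iff LIM_zero_iff)
  moreover have "norm (X n - oper_of (f', c')) = max (norm (f n - f')) (norm (c n - c'))" for n
    unfolding norm_oper_eq minus_oper.rep_eq f_def c_def by (simp add: oper_of_inverse)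
  ultimately have "(\<lambda>n. norm (X n - oper_of (f', c'))) \<longlonglongrightarrow> 0" by (simp only: max.idem)
  then have "X \<longlonglongrightarrow> oper_of (f', c')" by (simp only: tendsto_norm_zero_iff LIM_zero_iff)
  then show "convergent X" unfolding convergent_def ..
qed

lift_definition ap :: "'a::real_normed_vector oper \<Rightarrow> 'a \<Rightarrow> 'a" is "\<lambda>(f, c) x. blinfun_apply f x" .

lemma bounded_bilinear_ap: "bounded_bilinear ap"
proof
  fix a a' :: "'a oper" and b b' :: 'a and r :: real
  show "ap (a + a') b = ap a b + ap a' b" "ap a (b + b') = ap a b + ap a b'"
    "ap (r *\<^sub>R a) b = r *\<^sub>R ap a b" "ap a (r *\<^sub>R b) = r *\<^sub>R ap a b"
    by (transfer; auto simp: blinfun.bilinear_simps)+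
  show "\<exists>K. \<forall>a b. norm (ap a b :: 'a) \<le> norm a * norm b * K"
  proof (intro exI allI)
    fix a and b :: 'a
    show "norm (ap a b) \<le> norm a * norm b * 1"
      by transfer (auto intro!: order_trans[OF norm_blinfun] mult_right_mono)
  qed
qed

interpretation ap: bounded_bilinear ap by (rule bounded_bilinear_ap)

lemma norm_ap: "norm (ap a b) \<le> norm a * norm b"
  by transfer (auto intro!: order_trans[OF norm_blinfun] mult_right_mono)

lemma ap_mult [simp]: "ap (a * b) x = ap a (ap b x)"
  by transfer auto

lemma ap_one [simp]: "ap 1 x = x"
  by transfer auto

section \<open>Polynomials in an operator\<close>

text \<open>The target algebra is noncommutative, so coefficients act through a homomorphism whose
  image commutes with \<open>b\<close>. It is used with \<open>of_real\<close> for real coefficients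
  and with \<open>cop\<close> for complex ones, the operators being formally only a real
  algebra.\<close>

locale poly_eval =
  fixes hom :: "'c::comm_ring_1 \<Rightarrow> 'b::ring_1" and b :: 'b
  assumes hom_add: "hom (x + y) = hom x + hom y"
    and hom_mult: "hom (x * y) = hom x * hom y"
    and hom_0: "hom 0 = 0" and hom_1: "hom 1 = 1"
    and hom_commute: "hom x * b = b * hom x"
begin

definition peval :: "'c poly \<Rightarrow> 'b" where
  "peval p = (\<Sum>i\<le>degree p. hom (coeff p i) * b ^ i)"

lemma peval_le: "degree p \<le> n \<Longrightarrow> peval p = (\<Sum>i\<le>n. hom (coeff p i) * b ^ i)"
  unfolding peval_def by (rule sum.mono_neutral_left) (auto simp: coeff_eq_0 hom_0 not_le)

lemma peval_0 [simp]: "peval 0 = 0"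
  by (simp add: peval_def hom_0)

lemma peval_add: "peval (p + q) = peval p + peval q"
  by (simp add: peval_le[of _ "max (degree p) (degree q)"] degree_add_le hom_add distrib_right sum.distrib)

lemma hom_diff: "hom (x - y) = hom x - hom y"
  using hom_add[of "x - y" y] by (simp add: algebra_simps)

lemma peval_diff: "peval (p - q) = peval p - peval q"
  by (simp add: peval_le[of _ "max (degree p) (degree q)"] degree_diff_le hom_diff left_diff_distrib sum_subtractf)

lemma peval_smult: "peval (smult c p) = hom c * peval p"
  by (simp add: peval_le[of _ "degree p"] degree_smult_le hom_mult sum_distrib_left mult.assoc)

lemma peval_pCons: "peval (pCons a p) = hom a + b * peval p"
  unfolding peval_le[OF degree_pCons_le, of a p]
  by (simp add: sum.atMost_Suc_shift peval_def sum_distrib_left mult.assoc[symmetric] hom_commute del: sum.atMost_Suc)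

lemma peval_mult: "peval (p * q) = peval p * peval q"
  by (induction p) (simp_all add: peval_add peval_smult peval_pCons hom_0 algebra_simps)

lemma peval_power: "peval (p ^ n) = peval p ^ n"
  by (induction n) (simp_all add: peval_mult, simp add: peval_def hom_1)

lemma peval_const: "peval [:c:] = hom c"
  by (simp add: peval_pCons)

lemma peval_1 [simp]: "peval 1 = 1"
  by (simp add: one_pCons peval_const hom_1)

lemma peval_monom: "peval (monom c n) = hom c * b ^ n"
  by (induction n) (simp_all add: peval_const monom_0 monom_Suc peval_pCons hom_0 mult.assoc[symmetric] hom_commute)

end

section \<open>The closed real algebra generated by one element\<close>

lemma subspace_closure:
  fixes S :: "'a::real_normed_vector set"
  assumes "subspace S"
  shows "subspace (closure S)"
proof (rule subspaceI)
  show "0 \<in> closure S" using assms subspace_0 closure_subset by blast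
next
  fix x y assume "x \<in> closure S" "y \<in> closure S"
  then obtain f g where "\<And>n. f n \<in> S" "f \<longlonglongrightarrow> x" "\<And>n. g n \<in> S" "g \<longlonglongrightarrow> y"
    unfolding closure_sequential by blast
  then show "x + y \<in> closure S"
    unfolding closure_sequential
    by (intro exI[of _ "\<lambda>n. f n + g n"]) (auto intro: tendsto_add subspace_add[OF assms])
next
  fix c :: real and x assume "x \<in> closure S"
  then obtain f where "\<And>n. f n \<in> S" "f \<longlonglongrightarrow> x"
    unfolding closure_sequential by blast
  then show "c *\<^sub>R x \<in> closure S"
    unfolding closure_sequential
    by (intro exI[of _ "\<lambda>n. c *\<^sub>R f n"]) (auto intro: tendsto_intros subspace_scale[OF assms])
qed

text \<open>Coefficients are real on purpose: the triple product is conjugate linear in the middle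
  variable, and this keeps conjugates out of its formula on \<open>palg\<close>. Identities reduce
  to powers of \<open>a\<close> by \<open>palg_induct\<close>.\<close>

definition palg :: "'b::real_normed_algebra_1 \<Rightarrow> 'b set" where
  "palg a = closure (span (range (\<lambda>k. a ^ k)))"

lemma palg_induct [consumes 1, case_names closed subspace power]:
  assumes "x \<in> palg a" "closed {x. P x}" "subspace {x. P x}" "\<And>k. P (a ^ k)"
  shows "P x"
proof -
  have "palg a \<subseteq> {x. P x}"
    unfolding palg_def using assms by (intro closure_minimal span_minimal) auto
  then show ?thesis using assms(1) by auto
qed

lemma closed_palg: "closed (palg a)"
  by (simp add: palg_def)

lemma subspace_palg: "subspace (palg a)"
  unfolding palg_def by (intro subspace_closure subspace_span)

lemma power_in_palg: "a ^ k \<in> palg a"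
  unfolding palg_def by (meson closure_subset range_eqI span_superset subset_iff)

lemma one_in_palg: "1 \<in> palg a" and self_in_palg: "a \<in> palg a"
  using power_in_palg[of a 0] power_in_palg[of a 1] by auto

lemma sums_in_palg:
  assumes "\<And>n. f n \<in> palg a" "f sums s"
  shows "s \<in> palg a"
  using assms(2) unfolding sums_def
  by (rule closed_sequentially[OF closed_palg, rotated]) (intro subspace_sum subspace_palg assms(1))

lemma mult_in_palg:
  assumes "x \<in> palg a" "y \<in> palg a"
  shows "x * y \<in> palg a"
proof -
  have *: "a ^ k * y \<in> palg a" for k
    using assms(2)
  proof (induction rule: palg_induct)
    case closed
    have "{x. a ^ k * x \<in> palg a} = (\<lambda>x. a ^ k * x) -` palg a" by auto
    then show ?case by (auto intro!: closed_vimage closed_palg continuous_intros)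
  next
    case subspace
    show ?case using subspace_palg[of a]
      by (auto simp: real_vector.subspace_def distrib_left)
  next
    case (power n)
    then show ?case by (metis power_add power_in_palg)
  qed
  show ?thesis
    using assms(1)
  proof (induction rule: palg_induct)
    case closed
    have "{x. x * y \<in> palg a} = (\<lambda>x. x * y) -` palg a" by auto
    then show ?case by (auto intro!: closed_vimage closed_palg continuous_intros)
  next
    case subspace
    show ?case using subspace_palg[of a]
      by (auto simp: real_vector.subspace_def distrib_right)
  qed (rule *)
qed

lemma palg_commute:
  assumes "x \<in> palg a" "y \<in> palg a"
  shows "x * y = y * x"
proof -
  have *: "a ^ k * y = y * a ^ k" for k
    using assms(2)
  proof (induction rule: palg_induct)
    case closed
    show ?case by (intro closed_Collect_eq continuous_intros)
  next
    case subspace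
    show ?case by (auto simp: real_vector.subspace_def algebra_simps)
  next
    case (power n)
    then show ?case by (metis add.commute power_add)
  qed
  show ?thesis
    using assms(1)
  proof (induction rule: palg_induct)
    case closed
    show ?case by (intro closed_Collect_eq continuous_intros)
  next
    case subspace
    show ?case by (auto simp: real_vector.subspace_def algebra_simps)
  qed (rule *)
qed

lemma power_palg: "x \<in> palg a \<Longrightarrow> x ^ n \<in> palg a"
  by (induction n) (auto intro: one_in_palg mult_in_palg)

text \<open>The power series of the entire function sin z / z, so that \<open>sin a\<close> can be
  divided by \<open>a\<close> even if \<open>a\<close> is not invertible.\<close>

definition sinc :: "'b \<Rightarrow> 'b::{real_normed_algebra_1,banach}" where
  "sinc a = (\<Sum>n. sin_coeff (Suc n) *\<^sub>R a ^ n)"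

lemma abs_sin_coeff_le: "\<bar>sin_coeff n\<bar> \<le> 1 / fact n"
  by (auto simp: sin_coeff_def abs_mult)

lemma summable_sinc: "summable (\<lambda>n. sin_coeff (Suc n) *\<^sub>R (a::'b::{real_normed_algebra_1,banach}) ^ n)"
proof (rule summable_comparison_test'[OF sums_summable[OF exp_converges[of "norm a"]]])
  fix n
  have "norm (sin_coeff (Suc n) *\<^sub>R a ^ n) \<le> (1 / fact (Suc n)) * norm a ^ n"
    unfolding norm_scaleR by (intro mult_mono norm_power_ineq abs_sin_coeff_le) auto
  also have "\<dots> \<le> (1 / fact n) * norm a ^ n"
    by (intro mult_right_mono divide_left_mono fact_mono) auto
  finally show "norm (sin_coeff (Suc n) *\<^sub>R a ^ n) \<le> norm a ^ n /\<^sub>R fact n"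
    by (simp add: field_simps)
qed

lemma sinc_sums: "(\<lambda>n. sin_coeff (Suc n) *\<^sub>R a ^ n) sums sinc a"
  unfolding sinc_def by (rule summable_sums[OF summable_sinc])

lemma sin_eq_sinc: "sin a = a * sinc a" 
proof -
  have "(\<lambda>n. a * (sin_coeff (Suc n) *\<^sub>R a ^ n)) sums (a * sinc a)"
    by (rule sums_mult[OF sinc_sums])
  then have "(\<lambda>n. sin_coeff (Suc n) *\<^sub>R a ^ Suc n) sums (a * sinc a)" by simp
  then have "(\<lambda>n. sin_coeff n *\<^sub>R a ^ n) sums (a * sinc a)"
    by (subst (asm) sums_Suc_iff) simp
  then show ?thesis using sin_converges sums_unique2 by blast
qed

lemma sinc_in_palg: "sinc a \<in> palg a"
  by (rule sums_in_palg[OF _ sinc_sums]) (intro subspace_scale subspace_palg power_in_palg)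

lemma sin_in_palg: "sin a \<in> palg a"
  by (simp add: sin_eq_sinc mult_in_palg sinc_in_palg self_in_palg)

lemma norm_sinc_minus_1:
  assumes "norm a \<le> 1/2"
  shows "norm (sinc a - 1) \<le> norm a"
proof -
  have "(\<lambda>n. sin_coeff (Suc (Suc n)) *\<^sub>R a ^ Suc n) sums (sinc a - sin_coeff (Suc 0) *\<^sub>R a ^ 0)"
    using sinc_sums[of a] by (subst sums_Suc_iff) simp
  then have 1: "(\<lambda>n. sin_coeff (Suc (Suc n)) *\<^sub>R a ^ Suc n) sums (sinc a - 1)"
    by (simp add: sin_coeff_def)
  have 2: "(\<lambda>n. norm a / 2 * (1/2) ^ n) sums (norm a / 2 * (1 / (1 - 1/2)))"
    by (intro sums_mult geometric_sums) simp
  have "norm (sinc a - 1) \<le> norm a / 2 * (1 / (1 - 1/2))"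
  proof (rule norm_sums_le[OF 1 2])
    fix n
    have "(2::real) \<le> fact (Suc (Suc n))"
      using fact_mono[of 2 "Suc (Suc n)", where 'a=real] by simp
    then have "1 / fact (Suc (Suc n)) \<le> (1/2::real)"
      by (intro divide_left_mono) auto
    then have c: "\<bar>sin_coeff (Suc (Suc n))\<bar> \<le> 1/2"
      using abs_sin_coeff_le order_trans by blast
    have "norm (a ^ Suc n) \<le> norm a * norm a ^ n"
      using norm_power_ineq[of a "Suc n"] by simp
    also have "\<dots> \<le> norm a * (1/2) ^ n"
      using assms by (intro mult_left_mono power_mono) auto
    finally have "norm (sin_coeff (Suc (Suc n)) *\<^sub>R a ^ Suc n) \<le> 1/2 * (norm a * (1/2) ^ n)"
      unfolding norm_scaleR by (intro mult_mono c) auto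
    then show "norm (sin_coeff (Suc (Suc n)) *\<^sub>R a ^ Suc n) \<le> norm a / 2 * (1/2) ^ n" by simp
  qed
  then show ?thesis by simp
qed

text \<open>Cauchy's estimate with the integral replaced by the mean over the N-th roots of unity.
  As \<open>N\<close> is the degree plus one, exponents up to the degree stay distinct modulo
  \<open>N\<close> and the mean isolates the coefficient exactly.\<close>

lemma norm_coeff_le_circle:
  fixes p :: "complex poly"
  assumes "\<And>z. cmod z = 1 \<Longrightarrow> cmod (poly p z) \<le> M"
  shows "cmod (coeff p k) \<le> M"
proof (cases "k \<le> degree p")
  case False
  then show ?thesis
    using assms[of 1] norm_ge_zero[of "poly p 1"] by (simp add: coeff_eq_0 del: norm_ge_zero)
next
  case True
  define N where "N = Suc (degree p)"
  define e where "e j = exp (2 * of_real pi * \<i> * of_nat j / of_nat N)" for j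
  have N: "N \<noteq> 0" by (simp add: N_def)
  have e: "cmod (e j) = 1" "e j ^ N = 1" "e j \<noteq> 0" for j
    using complex_root_unity[OF N, of j] by (auto simp: e_def)
  have e_mult: "e i ^ j = e j ^ i" for i j
    by (simp add: e_def exp_of_nat_mult[symmetric] mult.commute mult.left_commute)
  have orth: "(\<Sum>j<N. e j ^ l / e j ^ k) = (if l = k then of_nat N else 0)" if "l < N" for l
  proof (cases "l = k")
    case False
    have kN: "k < N" using True by (simp add: N_def)
    define w where "w = e l / e k"
    have "w ^ N = 1" by (simp add: w_def power_divide e)
    moreover have "w \<noteq> 1"
    proof
      assume "w = 1"
      then have "e l = e k" by (simp add: w_def e field_simps)
      then have "l mod N = k mod N"
        using complex_root_unity_eq[of N l k] N by (simp add: e_def)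
      then show False using kN that False by simp
    qed
    ultimately have "(\<Sum>j<N. w ^ j) = 0" by (simp add: geometric_sum)
    then show ?thesis using False by (simp add: w_def power_divide e_mult[of l] e_mult[of k])
  qed (simp add: e)
  have "(\<Sum>j<N. poly p (e j) / e j ^ k) = (\<Sum>j<N. \<Sum>l\<le>degree p. coeff p l * (e j ^ l / e j ^ k))"
    by (simp add: poly_altdef sum_divide_distrib)
  also have "\<dots> = (\<Sum>l\<le>degree p. coeff p l * (\<Sum>j<N. e j ^ l / e j ^ k))"
    by (subst sum.swap) (simp add: sum_distrib_left)
  also have "\<dots> = (\<Sum>l\<le>degree p. if l = k then coeff p l * of_nat N else 0)"
  proof (intro sum.cong refl)
    fix l assume "l \<in> {..degree p}"
    then have "l < N" by (simp add: N_def)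
    then show "coeff p l * (\<Sum>j<N. e j ^ l / e j ^ k) = (if l = k then coeff p l * of_nat N else 0)"
      by (simp add: orth)
  qed
  also have "\<dots> = coeff p k * of_nat N"
    using True by simp
  finally have "cmod (coeff p k) * N = cmod (\<Sum>j<N. poly p (e j) / e j ^ k)"
    by (simp add: norm_mult)
  also have "\<dots> \<le> (\<Sum>j<N. M)"
    by (rule sum_norm_le) (simp add: norm_divide norm_power e assms)
  finally show ?thesis using N by (simp add: mult.commute)
qed

section \<open>Polynomials in the sine of a hermitian operator\<close>

lemma poly_eval_of_real: "poly_eval (of_real :: real \<Rightarrow> 'b::real_algebra_1) b"
  by unfold_locales (auto simp: of_real_def scaleR_left_distrib)

abbreviation rpeval :: "'b::real_algebra_1 \<Rightarrow> real poly \<Rightarrow> 'b" where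
  "rpeval \<equiv> poly_eval.peval of_real"

lemmas rpeval_simps = poly_eval.peval_add[OF poly_eval_of_real] poly_eval.peval_diff[OF poly_eval_of_real]
  poly_eval.peval_mult[OF poly_eval_of_real] poly_eval.peval_power[OF poly_eval_of_real]
  poly_eval.peval_const[OF poly_eval_of_real] poly_eval.peval_1[OF poly_eval_of_real]
  poly_eval.peval_0[OF poly_eval_of_real] poly_eval.peval_pCons[OF poly_eval_of_real]

lemma rpeval_in_palg:
  assumes "b \<in> palg a"
  shows "rpeval b p \<in> palg a"
  unfolding poly_eval.peval_def[OF poly_eval_of_real] of_real_def scaleR_conv_of_real[symmetric]
  by (intro subspace_sum subspace_palg) (simp add: subspace_scale subspace_palg power_palg assms)

lemma oper_eqI:
  assumes "\<And>x. ap a x = ap b x" "snd (oper_rep a) = snd (oper_rep b)"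
  shows "a = b"
  using assms by transfer (auto intro: blinfun_eqI)

definition opL :: "('a::real_normed_vector \<Rightarrow> 'a) \<Rightarrow> 'a oper" where
  "opL f = oper_of (Blinfun f, 0)"

lemma ap_opL: "bounded_linear f \<Longrightarrow> ap (opL f) x = f x"
  by (simp add: ap.rep_eq opL_def oper_of_inverse bounded_linear_Blinfun_apply)

lemma norm_opL_le:
  assumes "bounded_linear f" "\<And>x. norm (f x) \<le> K * norm x" "0 \<le> K"
  shows "norm (opL f) \<le> K"
  using assms by (simp add: norm_oper_eq opL_def oper_of_inverse norm_blinfun_bound bounded_linear_Blinfun_apply)

lemma i_power_fact: "(\<i> ^ n / fact n :: complex) = complex_of_real (cos_coeff n) + \<i> * complex_of_real (sin_coeff n)"
proof (cases "even n")
  case True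
  then obtain k where "n = 2 * k" by blast
  then show ?thesis by (simp add: cos_coeff_def sin_coeff_def power_mult)
next
  case False
  then obtain k where "n = 2 * k + 1" by (auto elim: oddE)
  then show ?thesis by (simp add: cos_coeff_def sin_coeff_def power_mult)
qed

section \<open>Complex scalars as operators and the sup bound\<close>

context complex_banach_space
begin

lemma scale_scaleR: "scale c (r *\<^sub>R x) = r *\<^sub>R scale c x"
  by (metis scale_of_real scale_left_commute)

lemma bounded_linear_scale: "bounded_linear (scale c)"
  by (rule bounded_linear_intro[of _ "cmod c"]) (simp_all add: scale_right_distrib scale_scaleR norm_scale mult.commute)

text \<open>The scalar component is \<open>c\<close> as well, since only then is \<open>cop\<close>
  a unital ring homomorphism into the algebra.\<close>

definition cop :: "complex \<Rightarrow> 'a oper" where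
  "cop c = oper_of (Blinfun (scale c), c)"

lemma ap_cop [simp]: "ap (cop c) x = scale c x"
  by (simp add: ap.rep_eq cop_def oper_of_inverse bounded_linear_Blinfun_apply bounded_linear_scale)

lemma snd_cop [simp]: "snd (oper_rep (cop c)) = c"
  by (simp add: cop_def oper_of_inverse)

lemma snd_oper_simps [simp]:
  "snd (oper_rep (a + b)) = snd (oper_rep a) + snd (oper_rep b)"
  "snd (oper_rep (a * b)) = snd (oper_rep a) * snd (oper_rep b)"
  "snd (oper_rep (r *\<^sub>R a)) = r *\<^sub>R snd (oper_rep a)"
  "snd (oper_rep 0) = 0" "snd (oper_rep 1) = 1" "snd (oper_rep (opL f)) = 0"
  by (simp_all add: plus_oper.rep_eq times_oper.rep_eq scaleR_oper.rep_eq zero_oper.rep_eq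
      one_oper.rep_eq case_prod_beta opL_def oper_of_inverse)

lemma cop_add: "cop (c + d) = cop c + cop d"
  and cop_mult: "cop (c * d) = cop c * cop d"
  and cop_0: "cop 0 = 0" and cop_1: "cop 1 = 1"
  by (rule oper_eqI; simp add: ap.add_left ap.zero_left scale_left_distrib)+

lemma cop_of_real: "cop (of_real r) = r *\<^sub>R 1"
  by (rule oper_eqI) (simp_all add: ap.scaleR_left scale_of_real complex_eq_iff)

lemma cop_power: "cop (c ^ n) = cop c ^ n"
  by (induction n) (simp_all add: cop_1 cop_mult)

lemma cop_opL_commute:
  assumes "bounded_linear f" "\<And>c x. f (scale c x) = scale c (f x)"
  shows "cop c * opL f = opL f * cop c"
  by (rule oper_eqI) (simp_all add: ap_opL assms)

text \<open>On the unit circle z - 1/z = 2i Im z, so Im z is the scalar counterpart of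
  \<open>B\<close>, and the factor \<open>U ^ degree p\<close> clears the negative powers. The
  induction is Horner's scheme.\<close>

lemma Laurent_polynomial:
  fixes U U' B :: "'a oper" and p :: "real poly"
  assumes UU': "U * U' = 1" "U' * U = 1" and B: "U - U' = cop (2 * \<i>) * B"
    and comm: "\<And>c. cop c * U = U * cop c"
  shows "\<exists>P. degree P \<le> 2 * degree p \<and>
    poly_eval.peval cop U P = U ^ degree p * rpeval B p \<and>
    (\<forall>z. cmod z = 1 \<longrightarrow> poly P z = z ^ degree p * of_real (poly p (Im z)))"
proof -
  have comm': "cop c * U ^ n = U ^ n * cop c" for c n
    by (rule power_commuting_commutes[OF comm[symmetric], symmetric])
  interpret cp: poly_eval cop U
    by unfold_locales (auto simp: cop_add cop_mult cop_0 cop_1 comm)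
  define k where "k = 1 / (2 * \<i>)"
  have B': "B = cop k * (U - U')"
    unfolding B mult.assoc[symmetric] cop_mult[symmetric] by (simp add: k_def cop_1)
  have k: "cop k * (U * U - 1) = U * B" "U * B = B * U"
    unfolding B' mult.assoc[symmetric] comm[symmetric]
    by (simp_all add: algebra_simps UU' mult.assoc)
  have z: "k * (z * z - 1) = z * of_real (Im z)" if "cmod z = 1" for z
  proof -
    have "z * cnj z = 1" using that by (simp add: complex_norm_square[symmetric])
    then have "z * z - 1 = z * (z - cnj z)" by (simp add: right_diff_distrib)
    also have "z - cnj z = 2 * \<i> * of_real (Im z)"
      by (simp add: complex_diff_cnj)
    finally show ?thesis by (simp add: k_def field_simps)
  qed
  show ?thesis
  proof (induction p)
    case 0
    then show ?case by (intro exI[of _ 0]) (simp add: rpeval_simps)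
  next
    case (pCons a p)
    have of_real_cop: "of_real a = cop (of_real a)" unfolding cop_of_real by (simp add: of_real_def)
    show ?case
    proof (cases "p = 0")
      case True
      then show ?thesis
        by (intro exI[of _ "[:of_real a:]"]) (simp add: rpeval_simps cp.peval_const of_real_cop)
    next
      case False
      define d where "d = degree p"
      have d: "degree (pCons a p) = Suc d" using False by (simp add: d_def)
      obtain Q where Q: "degree Q \<le> 2 * d" "cp.peval Q = U ^ d * rpeval B p"
        "\<And>z. cmod z = 1 \<Longrightarrow> poly Q z = z ^ d * of_real (poly p (Im z))"
        using pCons.IH unfolding d_def by blast
      \<comment> \<open>Since U B = k (U^2 - 1), the operator U^(d+1) (a + B p(B)) equals a U^(d+1)
        + k (U^2 - 1) U^d p(B).\<close>
      define P where "P = monom (of_real a) (Suc d) + smult k (pCons 0 (pCons 0 Q) - Q)"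
      have "degree P \<le> 2 * Suc d"
        unfolding P_def using Q(1)
        by (intro degree_add_le order_trans[OF degree_monom_le] order_trans[OF degree_smult_le]
            degree_diff_le order_trans[OF degree_pCons_le]) auto
      moreover have "cp.peval P = U ^ Suc d * rpeval B (pCons a p)"
      proof -
        have "cop k * (U * (U * cp.peval Q) - cp.peval Q) = cop k * (U * U - 1) * cp.peval Q"
          by (simp add: algebra_simps)
        also have "\<dots> = U * (B * U ^ d) * rpeval B p" by (simp add: k(1) Q(2) mult.assoc)
        also have "B * U ^ d = U ^ d * B"
          by (rule power_commuting_commutes[OF k(2), symmetric])
        finally show ?thesis
          by (simp add: P_def cp.peval_add cp.peval_monom cp.peval_smult cp.peval_diff cp.peval_pCons
              cop_0 rpeval_simps of_real_cop comm'[of _ "Suc d", simplified] distrib_left mult.assoc)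
      qed
      moreover have "\<forall>z. cmod z = 1 \<longrightarrow> poly P z = z ^ Suc d * of_real (poly (pCons a p) (Im z))"
      proof (intro allI impI)
        fix z :: complex assume "cmod z = 1"
        have "k * (z * (z * poly Q z) - poly Q z) = k * (z * z - 1) * poly Q z"
          by (simp add: algebra_simps)
        also have "\<dots> = z * of_real (Im z) * (z ^ d * of_real (poly p (Im z)))"
          using z[OF \<open>cmod z = 1\<close>] Q(3)[OF \<open>cmod z = 1\<close>] by simp
        finally show "poly P z = z ^ Suc d * of_real (poly (pCons a p) (Im z))"
          by (simp add: P_def poly_monom algebra_simps)
      qed
      ultimately show ?thesis unfolding d by blast
    qed
  qed
qed

lemma exp_ii:
  fixes a :: "'a oper"
  assumes comm: "cop \<i> * a = a * cop \<i>"
  shows "exp (cop \<i> * a) = cos a + cop \<i> * sin a"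
proof -
  have pow: "(cop \<i> * a) ^ n = cop (\<i> ^ n) * a ^ n" for n
  proof (induction n)
    case (Suc n)
    have "a * cop (\<i> ^ n) = cop (\<i> ^ n) * a"
      unfolding cop_power by (rule power_commuting_commutes[symmetric, OF comm])
    then show ?case
      by (simp add: Suc cop_mult mult.assoc) (simp add: mult.assoc[symmetric])
  qed (simp add: cop_1)
  have "(cop \<i> * a) ^ n /\<^sub>R fact n = cos_coeff n *\<^sub>R a ^ n + cop \<i> * (sin_coeff n *\<^sub>R a ^ n)" for n
  proof -
    have "(cop \<i> * a) ^ n /\<^sub>R fact n = cop (of_real (inverse (fact n))) * cop (\<i> ^ n) * a ^ n"
      unfolding cop_of_real pow by simp
    also have "cop (of_real (inverse (fact n))) * cop (\<i> ^ n) = cop (\<i> ^ n / fact n)"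
      by (simp add: cop_mult[symmetric] field_simps)
    also have "\<dots> = cos_coeff n *\<^sub>R 1 + cop \<i> * (sin_coeff n *\<^sub>R 1)"
      by (simp add: i_power_fact cop_add cop_mult cop_of_real)
    finally show ?thesis by (simp add: distrib_right)
  qed
  moreover have "(\<lambda>n. cos_coeff n *\<^sub>R a ^ n + cop \<i> * (sin_coeff n *\<^sub>R a ^ n)) sums (cos a + cop \<i> * sin a)"
    by (intro sums_add sums_mult cos_converges sin_converges)
  ultimately show ?thesis
    using exp_converges[of "cop \<i> * a"] sums_unique2 by simp
qed

lemma bounded_clinear_bounded_linear:
  assumes "bounded_clinear scale scale f"
  shows "bounded_linear f" "f (scale c x) = scale c (f x)"
proof -
  have l: "Vector_Spaces.linear scale scale f" and "\<exists>K. \<forall>x. norm (f x) \<le> K * norm x"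
    using assms by (auto simp: bounded_clinear_def)
  then obtain K where K: "\<And>x. norm (f x) \<le> K * norm x" by blast
  interpret l: Vector_Spaces.linear scale scale f by (rule l)
  show sc: "f (scale c x) = scale c (f x)" for c x
    by (rule l.scale)
  show "bounded_linear f"
    by (rule bounded_linear_intro[of _ K])
      (use K sc[of "of_real _"] l.add in \<open>auto simp: scale_of_real mult.commute\<close>)
qed

text \<open>Multiplication by the isometry \<open>U ^ degree p\<close> leaves norms unchanged and
  turns p(B) into a polynomial in \<open>U\<close> with at most 2d + 1 coefficients. Each is at most
  \<open>M\<close> by Cauchy's estimate, because Im z stays in [-1,1] on the circle.\<close>

lemma hermitian_bound:
  fixes M :: real
  assumes "hermitian_op scale f"
    and p: "\<And>s. \<bar>s\<bar> \<le> 1 \<Longrightarrow> \<bar>poly p s\<bar> \<le> M"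
  shows "norm (ap (rpeval (sin (opL f)) p) x) \<le> (2 * real (degree p) + 1) * M * norm x"
proof -
  have bc: "bounded_clinear scale scale f"
    and iso: "\<And>t x. norm (op_exp scale (\<i> * of_real t) f x) = norm x"
    using assms(1) unfolding hermitian_op_def by auto
  note bl = bounded_clinear_bounded_linear[OF bc]
  define a where "a = opL f"
  have comm: "cop c * a = a * cop c" for c
    unfolding a_def by (rule cop_opL_commute[OF bl])
  define U where "U = exp (cop \<i> * a)"
  have ap_a: "ap a y = f y" for y
    by (simp add: a_def ap_opL bl)
  have f_pow: "(f ^^ n) (scale c y) = scale c ((f ^^ n) y)" for n c y
    by (induction n) (simp_all add: bl)
  have U_exp: "ap U y = op_exp scale \<i> f y" for y
  proof -
    have "(\<lambda>n. ap ((cop \<i> * a) ^ n /\<^sub>R fact n) y) sums ap U y"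
      unfolding U_def by (rule bounded_linear.sums[OF ap.bounded_linear_left exp_converges])
    moreover have "ap ((cop \<i> * a) ^ n /\<^sub>R fact n) y = scale (\<i> ^ n / fact n) ((f ^^ n) y)" for n
    proof -
      have "ap ((cop \<i> * a) ^ n) y = scale (\<i> ^ n) ((f ^^ n) y)"
        by (induction n) (simp_all add: ap_a bl)
      then have "ap ((cop \<i> * a) ^ n /\<^sub>R fact n) y = scale (of_real (inverse (fact n)) * \<i> ^ n) ((f ^^ n) y)"
        by (simp only: ap.scaleR_left scale_of_real[symmetric] scale_scale)
      then show ?thesis by (simp add: field_simps)
    qed
    ultimately show ?thesis unfolding op_exp_def by (simp only: sums_iff)
  qed
  have isoU: "norm (ap (U ^ n) y) = norm y" for n y
    by (induction n) (use iso[of 1] in \<open>simp_all add: U_exp\<close>)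
  have UU: "U * exp (- (cop \<i> * a)) = 1" "exp (- (cop \<i> * a)) * U = 1"
    using exp_minus_inverse[of "cop \<i> * a"] exp_minus_inverse[of "- (cop \<i> * a)"] by (simp_all add: U_def)
  have "exp (- (cop \<i> * a)) = cos a - cop \<i> * sin a"
    using exp_ii[of "- a"] comm[of \<i>] by simp
  then have UB: "U - exp (- (cop \<i> * a)) = cop (2 * \<i>) * sin a"
    unfolding U_def exp_ii[OF comm] using cop_add[of \<i> \<i>] by (simp add: distrib_right)
  have commU: "cop c * U = U * cop c" for c
  proof -
    have "cop c * (cop \<i> * a) = cop \<i> * a * cop c"
      unfolding mult.assoc comm[symmetric] by (simp add: mult.assoc[symmetric] cop_mult[symmetric] mult.commute)
    then have "cop c * (cop \<i> * a) ^ n = (cop \<i> * a) ^ n * cop c" for n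
      by (rule power_commuting_commutes[symmetric, OF sym])
    then have "cop c * ((cop \<i> * a) ^ n /\<^sub>R fact n) = ((cop \<i> * a) ^ n /\<^sub>R fact n) * cop c" for n
      by simp
    moreover have "(\<lambda>n. cop c * ((cop \<i> * a) ^ n /\<^sub>R fact n)) sums (cop c * U)"
      unfolding U_def by (intro sums_mult exp_converges)
    moreover have "(\<lambda>n. ((cop \<i> * a) ^ n /\<^sub>R fact n) * cop c) sums (U * cop c)"
      unfolding U_def by (intro sums_mult2 exp_converges)
    ultimately show ?thesis by (simp only: sums_unique2)
  qed
  obtain P where P: "degree P \<le> 2 * degree p"
    "poly_eval.peval cop U P = U ^ degree p * rpeval (sin a) p"
    "\<And>z. cmod z = 1 \<Longrightarrow> poly P z = z ^ degree p * of_real (poly p (Im z))"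
    using Laurent_polynomial[OF UU UB commU, of p] by blast
  interpret cp: poly_eval cop U
    by unfold_locales (auto simp: cop_add cop_mult cop_0 cop_1 commU)
  have M: "cmod (coeff P i) \<le> M" for i
  proof (rule norm_coeff_le_circle)
    fix z assume z: "cmod z = 1"
    then have "\<bar>Im z\<bar> \<le> 1" using abs_Im_le_cmod[of z] by simp
    then show "cmod (poly P z) \<le> M" using p by (simp add: P(3) z norm_mult norm_power)
  qed
  have "M \<ge> 0" using M[of 0] norm_ge_zero order_trans by blast
  have "norm (ap (rpeval (sin a) p) x) = norm (ap (cp.peval P) x)"
    by (simp add: P(2) isoU)
  also have "ap (cp.peval P) x = (\<Sum>i\<le>degree P. scale (coeff P i) (ap (U ^ i) x))"
    by (simp add: cp.peval_def ap.sum_left)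
  also have "norm \<dots> \<le> (\<Sum>i\<le>degree P. M * norm x)"
    by (rule sum_norm_le) (simp add: norm_scale isoU M mult_right_mono)
  also have "\<dots> = (degree P + 1) * (M * norm x)" by simp
  also have "\<dots> \<le> (2 * degree p + 1) * (M * norm x)"
    using P(1) \<open>M \<ge> 0\<close> by (intro mult_right_mono) auto
  finally show ?thesis by (simp add: a_def algebra_simps)
qed

end

section \<open>Identities in Jordan triples\<close>

context jordan_banach_triple
begin

lemma tp_add_left: "tp (x + x') y z = tp x y z + tp x' y z"
  and tp_scale_left: "tp (scale c x) y z = scale c (tp x y z)"
proof -
  interpret l: Vector_Spaces.linear scale scale "\<lambda>x. tp x y z" by (rule tp_linear)
  show "tp (x + x') y z = tp x y z + tp x' y z" "tp (scale c x) y z = scale c (tp x y z)"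
    by (rule l.add l.scale)+
qed

lemma tp_add_right: "tp x y (z + z') = tp x y z + tp x y z'"
  and tp_scale_right: "tp x y (scale c z) = scale c (tp x y z)"
  by (simp_all only: tp_commute[of x y] tp_add_left tp_scale_left)

lemmas tp_add = tp_add_left tp_add_middle tp_add_right

lemma tp_scaleR:
  "tp (r *\<^sub>R x) y z = r *\<^sub>R tp x y z" "tp x (r *\<^sub>R y) z = r *\<^sub>R tp x y z" "tp x y (r *\<^sub>R z) = r *\<^sub>R tp x y z"
  using tp_scale_left[of "of_real r"] tp_scale_middle[of _ "of_real r"] tp_scale_right[of _ _ "of_real r"]
  by (simp_all add: scale_of_real)

lemma tp_diff:
  "tp (x - x') y z = tp x y z - tp x' y z" "tp x (y - y') z = tp x y z - tp x y' z"
  "tp x y (z - z') = tp x y z - tp x y z'"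
  using tp_add_left[of "x - x'" x' y z] tp_add_middle[of x "y - y'" y' z] tp_add_right[of x y "z - z'" z']
  by (simp_all only: eq_diff_eq diff_add_cancel)

lemma tp_zero [simp]: "tp 0 y z = 0" "tp x 0 z = 0" "tp x y 0 = 0"
  using tp_diff(1)[of 0 0 y z] tp_diff(2)[of x 0 0 z] tp_diff(3)[of x y 0 0] by auto

lemma tendsto_tp [tendsto_intros]:
  assumes "(f \<longlongrightarrow> a) F" "(g \<longlongrightarrow> b) F" "(k \<longlongrightarrow> c) F"
  shows "((\<lambda>n. tp (f n) (g n) (k n)) \<longlongrightarrow> tp a b c) F"
  using continuous_on_tendsto_compose[OF tp_continuous tendsto_Pair[OF assms(1) tendsto_Pair[OF assms(2,3)]]]
  by simp

lemma continuous_on_tp [continuous_intros]: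
  assumes "continuous_on S f" "continuous_on S g" "continuous_on S k"
  shows "continuous_on S (\<lambda>x. tp (f x) (g x) (k x))"
  using assms by (auto simp: continuous_on_def intro!: tendsto_tp)

lemma tp_bounded: "\<exists>K>0. \<forall>x y z. norm (tp x y z) \<le> K * norm x * norm y * norm z"
proof -
  have "isCont (\<lambda>(x, y, z). tp x y z) (0, 0, 0)"
    using tp_continuous by (simp add: continuous_on_eq_continuous_at)
  then obtain d where d: "d > 0" and
    dd: "\<And>u. dist u (0, 0, 0) < d \<Longrightarrow> dist ((\<lambda>(x, y, z). tp x y z) u) (tp 0 0 0) < 1"
    unfolding continuous_at_eps_delta by (metis (no_types, lifting) case_prod_conv zero_less_one)
  have small: "norm (tp x y z) < 1" if "norm x \<le> d/4" "norm y \<le> d/4" "norm z \<le> d/4" for x y z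
  proof -
    have "norm (y, z) \<le> norm y + norm z" "norm (x, (y, z)) \<le> norm x + norm (y, z)"
      by (rule norm_Pair_le)+
    then have "dist (x, y, z) (0, 0, 0) < d"
      using that d by (simp add: dist_norm)
    from dd[OF this] show ?thesis by simp
  qed
  have "norm (tp x y z) \<le> (4/d) ^ 3 * norm x * norm y * norm z" for x y z
  proof (cases "x = 0 \<or> y = 0 \<or> z = 0")
    case False
    define r where "r u = d / (4 * norm u)" for u :: 'a
    have r: "r u > 0" "norm (r u *\<^sub>R u) \<le> d / 4" if "u \<noteq> 0" for u
      using that d by (auto simp: r_def)
    have "norm (tp (r x *\<^sub>R x) (r y *\<^sub>R y) (r z *\<^sub>R z)) < 1"
      using False r by (intro small) auto
    then have "r x * (r y * (r z * norm (tp x y z))) < 1"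
      using False r(1)[of x] r(1)[of y] r(1)[of z] by (simp add: tp_scaleR mult_ac)
    then show ?thesis using False d by (simp add: r_def field_simps power3_eq_cube)
  qed auto
  then show ?thesis using d by (intro exI[of _ "(4/d) ^ 3"]) auto
qed

lemma bounded_linear_tp: "bounded_linear (\<lambda>z. tp x y z)" "bounded_linear (\<lambda>y. tp x y z)"
proof -
  obtain K where K: "\<And>x y z. norm (tp x y z) \<le> K * norm x * norm y * norm z" using tp_bounded by blast
  show "bounded_linear (\<lambda>z. tp x y z)"
    by (rule bounded_linear_intro[of _ "K * norm x * norm y"])
      (auto simp: tp_add tp_scaleR intro: order_trans[OF K])
  show "bounded_linear (\<lambda>y. tp x y z)"
    by (rule bounded_linear_intro[of _ "K * norm x * norm z"])
      (auto simp: tp_add tp_scaleR intro: order_trans[OF K])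
qed

lemma jordan: "tp a b (tp x y z) = tp (tp a b x) y z - tp x (tp b a y) z + tp x y (tp a b z)"
  using jordan_identity[of a b x y z] by (simp add: algebra_simps)

text \<open>The odd power h^(2k+1) of Jordan triple theory; only odd powers exist in a
  triple.\<close>

definition opw :: "'a \<Rightarrow> nat \<Rightarrow> 'a" where
  "opw h k = ((\<lambda>z. tp h h z) ^^ k) h"

lemma opw_0 [simp]: "opw h 0 = h" and opw_Suc: "opw h (Suc k) = tp h h (opw h k)"
  by (simp_all add: opw_def)

text \<open>Comparing the commutators of \<open>L(h,h)\<close> with \<open>L(x\<^sub>j,x\<^sub>k)\<close>, \<open>j + k = n\<close>, with the one of
  \<open>L(x\<^sub>n,h)\<close> with \<open>L(h,h)\<close> shows that \<open>n + 2\<close> times the common commutator vanishes.\<close>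

lemma tp_opw_left:
  assumes "j + k = n"
  shows "tp (opw h j) (opw h k) z = tp (opw h n) h z"
  using assms
proof (induction n arbitrary: j k z)
  case 0
  then show ?case by simp
next
  case (Suc n)
  define D where "D = tp h h (tp (opw h n) h z) - tp (opw h n) h (tp h h z)"
  define M where "M i = tp (opw h i) (opw h (Suc n - i)) z" for i
  have step: "M (Suc i) = M i + D" if "i \<le> n" for i
  proof -
    have "D = tp h h (tp (opw h i) (opw h (n - i)) z) - tp (opw h i) (opw h (n - i)) (tp h h z)"
      using that by (simp add: D_def Suc.IH)
    also have "\<dots> = tp (opw h (Suc i)) (opw h (n - i)) z - tp (opw h i) (opw h (Suc (n - i))) z"
      by (simp add: jordan_identity opw_Suc)
    finally show ?thesis using that by (simp add: M_def Suc_diff_le)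
  qed
  have M: "i \<le> Suc n \<Longrightarrow> M i = M 0 + real i *\<^sub>R D" for i
    by (induction i) (simp_all add: step algebra_simps)
  have "tp h (opw h n) h = tp (opw h n) h h" using Suc.IH[of 0 n h] by simp
  then have *: "tp h (opw h n) h = opw h (Suc n)" "tp (opw h n) h h = opw h (Suc n)"
    using tp_commute[of "opw h n" h h] by (simp_all add: opw_Suc)
  then have "- D = M (Suc n) - M 0"
    using jordan_identity[of "opw h n" h h h z]
    by (simp add: D_def M_def *)
  with M[of "Suc n"] have "real (Suc n) *\<^sub>R D = - D" by simp
  then have "real (Suc n) *\<^sub>R D + D = 0" by (simp only: add.left_inverse)
  then have "(real (Suc n) + 1) *\<^sub>R D = 0" by (simp only: scaleR_left_distrib scaleR_one)
  then have "D = 0" by (simp only: scaleR_eq_0_iff) linarith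
  then have "M j = M (Suc n)" using Suc.prems M[of j] M[of "Suc n"] by simp
  then show ?case using Suc.prems by (simp add: M_def) (metis add_diff_cancel_left')
qed

text \<open>Power associativity. \<open>L(h,h)\<close> commutes with \<open>L(x_i,x_j)\<close>: the
  two correction terms of the Jordan identity have the same index sum, so they cancel by
  \<open>tp_opw_left\<close>.\<close>

lemma tp_opw: "tp (opw h i) (opw h j) (opw h k) = opw h (i + j + k + 1)"
proof (induction k)
  case 0
  show ?case
    using tp_commute[of "opw h (i + j)" h h] by (simp add: tp_opw_left[of i j "i + j"] opw_Suc)
next
  case (Suc k)
  have "tp h h (tp (opw h i) (opw h j) (opw h k)) = tp (opw h i) (opw h j) (tp h h (opw h k))"
    using tp_opw_left[of "Suc i" j "Suc (i + j)" h "opw h k"] tp_opw_left[of i "Suc j" "Suc (i + j)" h "opw h k"]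
    by (simp add: jordan[of h h "opw h i"] opw_Suc)
  then show ?case using Suc by (simp add: opw_Suc)
qed

lemma quadratic_compose: "tp x (tp y z y) x = 2 *\<^sub>R tp x y (tp x y z) - tp (tp x y x) y z"
proof -
  have "tp z y (tp x y x) = tp (tp z y x) y x - tp x (tp y z y) x + tp x y (tp z y x)"
    by (rule jordan)
  moreover have "tp z y (tp x y x) = tp (tp x y x) y z" "tp z y x = tp x y z"
    "tp (tp x y z) y x = tp x y (tp x y z)"
    by (rule tp_commute)+
  ultimately have "tp (tp x y x) y z = tp x y (tp x y z) - tp x (tp y z y) x + tp x y (tp x y z)"
    by (simp only:)
  then show ?thesis by (simp add: scaleR_2 algebra_simps)
qed

text \<open>A case of the fundamental formula Q(Q(a)b) = Q(a)Q(b)Q(a). With A = L(b,b) and L =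
  L({b,b,b},b), the operators A and Q = Q(b) commute and Q^2 = 2A^2 - L. The Jordan identity
  expresses Q({b,b,b}) as 2A^2 Q - LQ, which is Q^3.\<close>

lemma quadratic_cube: "tp (tp b b b) z (tp b b b) = tp b (tp b (tp b z b) b) b"
proof -
  define c where "c = tp b b b"
  define d where "d = tp b b c"
  define Q where "Q z = tp b z b" for z
  define A where "A z = tp b b z" for z
  define L where "L z = tp c b z" for z
  \<comment> \<open>Expanding the same product by the Jordan identity in two ways gives u + v = 2w
    and w + v = 2u, whence 3u = 3w. Both commutation facts below come from this.\<close>
  have eqs: "u = w \<and> v = w" if "u = w - v + w" "w = u - v + u" for u v w :: 'a
  proof -
    have "w + w - (w - v + w) = v" "u + u - (u - v + u) = v" by simp_all
    then have v: "w + w - u = v" "u + u - w = v" by (simp_all only: that[symmetric])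
    have "u + u + u = (u + u - w) + (u + w)" by simp
    also have "\<dots> = (w + w - u) + (u + w)" by (simp only: v)
    also have "\<dots> = w + w + w" by simp
    finally have "u + u + u = w + w + w" .
    moreover have "3 *\<^sub>R x = x + x + x" for x :: 'a
      using scaleR_left_distrib[of 2 1 x] by (simp add: scaleR_2)
    ultimately have "3 *\<^sub>R u = 3 *\<^sub>R w" by (simp only:)
    then have "u = w" by simp
    then show ?thesis using v(1) by simp
  qed
  have bc: "tp b c b = d" using tp_opw[of b 0 1 0] by (simp add: c_def d_def opw_Suc numeral_2_eq_2)
  have cbb: "tp c b b = d" unfolding d_def by (rule tp_commute)
  have bcy: "tp b c y = L y" for y
    using tp_opw_left[of 0 1 1 b y] by (simp add: L_def c_def opw_Suc)
  have 1: "A (Q y) = tp c y b" "Q (A y) = tp c y b" for y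
  proof -
    have "A (Q y) = tp c y b - Q (A y) + tp b y c"
      unfolding A_def Q_def c_def by (rule jordan)
    moreover have "tp b y c = tp (Q y) b b - tp b (tp y b b) b + A (Q y)"
      unfolding A_def Q_def c_def by (rule jordan)
    moreover have "tp b y c = tp c y b" "tp (Q y) b b = A (Q y)" "tp y b b = A y"
      unfolding A_def by (rule tp_commute)+
    ultimately show "A (Q y) = tp c y b" "Q (A y) = tp c y b"
      using eqs[of "A (Q y)" "tp c y b" "Q (A y)"] by (simp_all add: Q_def)
  qed
  have 2: "L (Q y) = tp d y b" for y
  proof -
    have "L (Q y) = tp d y b - tp b (tp b c y) b + tp b y d"
      unfolding L_def Q_def cbb[symmetric] by (rule jordan)
    moreover have "tp b y d = tp (Q y) c b - tp b (tp y b c) b + tp b c (Q y)"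
      unfolding bc[symmetric] Q_def by (rule jordan)
    moreover have "tp b y d = tp d y b" "tp (Q y) c b = tp b c (Q y)" "tp y b c = L y"
      unfolding L_def by (rule tp_commute)+
    ultimately show "L (Q y) = tp d y b"
      using eqs[of "L (Q y)" "tp d y b" "Q (L y)"] by (simp add: bcy Q_def)
  qed
  have QQ: "Q (Q y) = A (A y) + A (A y) - L y" for y
    using quadratic_compose[of b b y] by (simp add: Q_def A_def L_def c_def scaleR_2)
  have "A (tp c z b) = tp d z b - tp c (A z) b + tp c z c"
    unfolding A_def d_def using jordan[of b b c z b] by (simp only: c_def)
  then have "A (A (Q z)) = L (Q z) - A (Q (A z)) + tp c z c"
    by (simp only: 1(1)[symmetric] 2[symmetric])
  then have "tp c z c = A (A (Q z)) + A (Q (A z)) - L (Q z)" by (simp add: algebra_simps)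
  also have "A (Q (A z)) = A (A (Q z))" by (simp only: 1)
  also have "A (A (Q z)) + A (A (Q z)) - L (Q z) = Q (Q (Q z))" by (rule QQ[symmetric])
  finally show ?thesis by (simp add: c_def Q_def)
qed

text \<open>In the Jordan identity for the commutator of L(y,c) and L(b,c) everything containing
  L(b,c) vanishes, including {y,c,b} = L(b,c)y. Only L(b, Q(c)y) remains. The other half is the
  mirror image.\<close>

lemma orthogonal_inner:
  assumes "\<And>z. tp b c z = 0" "\<And>z. tp c b z = 0"
  shows "tp b (tp c y c) z = 0" "tp (tp c y c) b z = 0"
proof -
  have "tp y c b = tp b c y" by (rule tp_commute)
  then show "tp b (tp c y c) z = 0" "tp (tp c y c) b z = 0"
    using jordan_identity[of y c b c z] jordan_identity[of c y c b z] assms by simp_all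
qed

definition mop :: "'a \<Rightarrow> 'a oper" where "mop h = opL (\<lambda>z. tp h h z)"

lemma ap_mop [simp]: "ap (mop h) z = tp h h z"
  unfolding mop_def by (rule ap_opL) (rule bounded_linear_tp)

lemma ap_mop_power: "ap (mop h ^ k) h = opw h k"
  by (induction k) (simp_all add: opw_Suc)

lemma norm_mop_le: "\<exists>K>0. \<forall>h. norm (mop h) \<le> K * norm h ^ 2"
proof -
  obtain K where K: "K > 0" "\<And>x y z. norm (tp x y z) \<le> K * norm x * norm y * norm z" using tp_bounded by blast
  have "norm (mop h) \<le> K * norm h ^ 2" for h
    unfolding mop_def by (rule norm_opL_le[OF bounded_linear_tp(1)])
      (use K in \<open>auto simp: power2_eq_square mult.assoc\<close>)
  then show ?thesis using K by blast
qed

lemma mop_scaleR: "mop (r *\<^sub>R h) = r^2 *\<^sub>R mop h"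
  by (rule oper_eqI) (simp_all add: ap.scaleR_left tp_scaleR power2_eq_square, simp add: mop_def)

lemma tp_palg_left:
  assumes "X \<in> palg (mop h)" "Y \<in> palg (mop h)"
  shows "tp (ap X h) (ap Y h) z = tp (ap (X * Y) h) h z"
proof -
  have cont: "continuous_on UNIV (\<lambda>x. ap x u)" for u :: 'a
    by (rule linear_continuous_on) (rule ap.bounded_linear_left)
  note [continuous_intros] = continuous_on_compose2[OF cont _ subset_UNIV]
  have 1: "tp (opw h k) (ap Y h) z = tp (ap (mop h ^ k * Y) h) h z" for k
    using assms(2)
  proof (induction rule: palg_induct)
    case closed
    show ?case by (intro closed_Collect_eq continuous_intros)
  next
    case subspace
    show ?case
      by (auto simp: real_vector.subspace_def ap.bilinear_simps tp_add tp_scaleR distrib_left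
          ap.zero_left ap.add_left ap.scaleR_left ap.add_right ap.zero_right ap.scaleR_right)
  next
    case (power n)
    show ?case by (simp add: power_add[symmetric] ap_mop_power tp_opw_left del: ap_mult)
  qed
  show ?thesis
    using assms(1)
  proof (induction rule: palg_induct)
    case closed
    show ?case by (intro closed_Collect_eq continuous_intros)
  next
    case subspace
    show ?case
      by (auto simp: real_vector.subspace_def tp_add tp_scaleR ap.zero_left ap.add_left ap.scaleR_left)
  next
    case (power n)
    show ?case using 1[of n] by (simp add: ap_mop_power del: ap_mult)
  qed
qed

text \<open>Three copies of \<open>h\<close> leave one \<open>h\<close> and the factor
  \<open>mop h\<close>. On powers this is \<open>tp_opw\<close>; linearity and continuity, one
  variable at a time, do the rest.\<close>

lemma tp_palg:
  assumes "X \<in> palg (mop h)" "Y \<in> palg (mop h)" "Z \<in> palg (mop h)"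
  shows "tp (ap X h) (ap Y h) (ap Z h) = ap (X * Y * Z * mop h) h"
proof -
  have cont: "continuous_on UNIV (\<lambda>x. ap x u)" for u :: 'a
    by (rule linear_continuous_on) (rule ap.bounded_linear_left)
  note [continuous_intros] = continuous_on_compose2[OF cont _ subset_UNIV]
  have 1: "tp (opw h k) h (opw h l) = ap (mop h ^ k * mop h ^ l * mop h) h" for k l
    using tp_opw[of h k 0 l] by (simp only: power_add[symmetric] power_Suc2[symmetric] ap_mop_power) simp
  have 2: "tp (ap X h) h (opw h l) = ap (X * mop h ^ l * mop h) h" if "X \<in> palg (mop h)" for l X
    using that
  proof (induction rule: palg_induct)
    case closed
    show ?case by (intro closed_Collect_eq continuous_intros)
  next
    case subspace
    show ?case
      by (auto simp: real_vector.subspace_def tp_add tp_scaleR ap.zero_left ap.add_left ap.scaleR_left)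
  next
    case (power n)
    show ?case using 1[of n l] by (simp add: ap_mop_power del: ap_mult)
  qed
  have 3: "tp (ap X h) h (ap Z h) = ap (X * Z * mop h) h" if "X \<in> palg (mop h)" for X
    using assms(3)
  proof (induction rule: palg_induct)
    case closed
    show ?case by (intro closed_Collect_eq continuous_intros)
  next
    case subspace
    show ?case
      by (auto simp: real_vector.subspace_def tp_add tp_scaleR ap.zero_left ap.add_left ap.scaleR_left
         ap.add_right ap.zero_right ap.scaleR_right)
  next
    case (power n)
    show ?case using 2[OF that, of n] by (simp add: ap_mop_power del: ap_mult)
  qed
  show ?thesis
    using 3[of "X * Y"] assms by (simp add: tp_palg_left mult_in_palg del: ap_mult)
qed

lemma palg_mop_invariant:
  assumes "X \<in> palg (mop h)" "closed S" "Real_Vector_Spaces.subspace S" "\<And>k. ap (mop h ^ k) u \<in> S"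
  shows "ap X u \<in> S"
  using assms(1)
proof (induction rule: palg_induct)
  case closed
  have "{x. ap x u \<in> S} = (\<lambda>x. ap x u) -` S" by auto
  then show ?case
    by (simp add: closed_vimage assms linear_continuous_on[OF ap.bounded_linear_left] continuous_on_eq_continuous_at linear_continuous_at[OF ap.bounded_linear_left])
next
  case subspace
  show ?case using assms(3)
    by (auto simp: real_vector.subspace_def ap.zero_left ap.add_left ap.scaleR_left)
qed (rule assms)

end

section \<open>Functional calculus\<close>

lemma power_mult_commute:
  fixes x y :: "'b::monoid_mult"
  assumes "x * y = y * x"
  shows "(x * y) ^ n = x ^ n * y ^ n"
proof (induction n)
  case (Suc n)
  have "x ^ n * y = y * x ^ n" by (rule power_commuting_commutes[OF assms])
  then show ?case by (simp add: Suc mult.assoc) (simp add: mult.assoc[symmetric])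
qed simp

lemma Weierstrass_poly:
  assumes "continuous_on {-1..1} f" "\<epsilon> > 0"
  shows "\<exists>p. \<forall>s. \<bar>s\<bar> \<le> 1 \<longrightarrow> \<bar>f s - poly p s\<bar> \<le> (\<epsilon>::real)"
proof -
  obtain g where g: "real_polynomial_function g" "\<And>x. x \<in> {-1..1} \<Longrightarrow> \<bar>f x - g x\<bar> < \<epsilon>"
    using Stone_Weierstrass_real_polynomial_function[OF compact_Icc assms] by blast
  then obtain a n where a: "g = (\<lambda>x. \<Sum>i\<le>n. a i * x ^ i)"
    by (auto simp: real_polynomial_function_iff_sum)
  have "poly (\<Sum>i\<le>n. monom (a i) i) x = g x" for x
    by (simp add: a poly_sum poly_monom)
  then show ?thesis using g(2) by (intro exI[of _ "\<Sum>i\<le>n. monom (a i) i"]) (fastforce simp: abs_le_iff)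
qed

text \<open>The weight \<open>sqrt \<bar>s\<bar>\<close> is the size of \<open>h\<close> itself in the calculus \<open>p \<mapsto> p(B)h\<close>, which therefore extends to
  functions unbounded at 0 such as \<open>s\<^sup>-\<^sup>1\<^sup>/\<^sup>3\<close>.\<close>

definition wapprox :: "(real \<Rightarrow> real) \<Rightarrow> real poly \<Rightarrow> real \<Rightarrow> bool" where
  "wapprox f p \<epsilon> \<longleftrightarrow> (\<forall>s. \<bar>s\<bar> \<le> 1 \<longrightarrow> sqrt \<bar>s\<bar> * \<bar>f s - poly p s\<bar> \<le> \<epsilon>)"

definition wapproximable :: "(real \<Rightarrow> real) \<Rightarrow> bool" where
  "wapproximable f \<longleftrightarrow> (\<forall>\<epsilon>>0. \<exists>p. wapprox f p \<epsilon>)"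

lemma wapprox_uniform:
  assumes "\<And>s. \<bar>s\<bar> \<le> 1 \<Longrightarrow> \<bar>f s - poly p s\<bar> \<le> \<epsilon>"
  shows "wapprox f p \<epsilon>"
  unfolding wapprox_def
proof (intro allI impI)
  fix s :: real assume s: "\<bar>s\<bar> \<le> 1"
  have "sqrt \<bar>s\<bar> * \<bar>f s - poly p s\<bar> \<le> 1 * \<bar>f s - poly p s\<bar>"
    using s by (intro mult_right_mono) auto
  then show "sqrt \<bar>s\<bar> * \<bar>f s - poly p s\<bar> \<le> \<epsilon>" using assms[OF s] by simp
qed

lemma wapproximable_continuous: "continuous_on {-1..1} f \<Longrightarrow> wapproximable f"
  unfolding wapproximable_def by (blast dest: Weierstrass_poly intro: wapprox_uniform)

lemma wapprox_triangle:
  assumes "wapprox f p \<delta>" "\<And>s. \<bar>s\<bar> \<le> 1 \<Longrightarrow> sqrt \<bar>s\<bar> * \<bar>g s - f s\<bar> \<le> \<epsilon>"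
  shows "wapprox g p (\<epsilon> + \<delta>)"
  unfolding wapprox_def
proof (intro allI impI)
  fix s :: real assume s: "\<bar>s\<bar> \<le> 1"
  have "sqrt \<bar>s\<bar> * \<bar>g s - poly p s\<bar> \<le> sqrt \<bar>s\<bar> * (\<bar>g s - f s\<bar> + \<bar>f s - poly p s\<bar>)"
    by (intro mult_left_mono) auto
  also have "\<dots> \<le> \<epsilon> + \<delta>"
    using assms(1)[unfolded wapprox_def, rule_format, OF s] assms(2)[OF s] by (simp add: distrib_left)
  finally show "sqrt \<bar>s\<bar> * \<bar>g s - poly p s\<bar> \<le> \<epsilon> + \<delta>" .
qed

text \<open>The odd branch of s^(-1/3), written through the absolute value to cover negative
  \<open>s\<close>; its value at 0 is 0.\<close>

definition inv_cbrt :: "real \<Rightarrow> real" where "inv_cbrt s = s * \<bar>s\<bar> powr (-4/3)"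

lemma inv_cbrt_cube: "s \<noteq> 0 \<Longrightarrow> s * inv_cbrt s ^ 3 = 1"
proof -
  assume s: "s \<noteq> 0"
  have "(\<bar>s\<bar> powr (-4/3)) ^ 3 = \<bar>s\<bar> powr (-4)"
  proof -
    have "(\<bar>s\<bar> powr (-4/3)) ^ 3 = (\<bar>s\<bar> powr (-4/3)) powr real 3"
      using s by (subst powr_realpow) auto
    then show ?thesis by (simp add: powr_powr)
  qed
  also have "\<dots> = 1 / s ^ 4"
    using s by (simp add: powr_minus divide_inverse powr_numeral)
  finally have t: "(\<bar>s\<bar> powr (-4/3)) ^ 3 = 1 / s ^ 4" .
  have "s * inv_cbrt s ^ 3 = s ^ 4 * (\<bar>s\<bar> powr (-4/3)) ^ 3"
    unfolding inv_cbrt_def power_mult_distrib by (simp add: power4_eq_xxxx power3_eq_cube)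
  then show ?thesis using s unfolding t by simp
qed

text \<open>The product is |s|^(1/6), which still tends to 0 at 0: the weight outweighs the
  singularity.\<close>

lemma inv_cbrt_weight: 
  assumes "0 < \<delta>" "\<bar>s\<bar> \<le> \<delta>"
  shows "sqrt \<bar>s\<bar> * \<bar>inv_cbrt s\<bar> \<le> \<delta> powr (1/6)"
proof (cases "s = 0")
  case False
  have "sqrt \<bar>s\<bar> * \<bar>inv_cbrt s\<bar> = \<bar>s\<bar> powr (1/2) * (\<bar>s\<bar> powr 1 * \<bar>s\<bar> powr (-4/3))"
    using False by (simp add: inv_cbrt_def powr_half_sqrt abs_mult)
  also have "\<dots> = \<bar>s\<bar> powr (1/6)" by (simp only: powr_add[symmetric]) simp
  also have "\<dots> \<le> \<delta> powr (1/6)" using assms by (intro powr_mono2) auto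
  finally show ?thesis .
qed simp

lemma wapproximable_inv_cbrt: "wapproximable inv_cbrt"
  unfolding wapproximable_def
proof (intro allI impI)
  fix \<epsilon> :: real assume "\<epsilon> > 0"
  \<comment> \<open>Sixth power, because the weighted function on [0, \<delta>] is at most
    \<delta>^(1/6). Below the cutoff \<delta> the factor |s|^(-4/3) is frozen to get a continuous
    function.\<close>
  define \<delta> where "\<delta> = (\<epsilon>/2) powr 6"
  have "\<delta> powr (1/6) = (\<epsilon>/2) powr (6 * (1/6))" unfolding \<delta>_def by (rule powr_powr)
  then have \<delta>: "\<delta> > 0" "\<delta> powr (1/6) = \<epsilon>/2" using \<open>\<epsilon> > 0\<close> by (simp_all add: \<delta>_def)
  define f where "f s = s * (max \<bar>s\<bar> \<delta>) powr (-4/3)" for s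
  have "continuous_on {-1..1} f"
    unfolding f_def using \<delta> by (intro continuous_intros) auto
  then obtain p where p: "wapprox f p (\<epsilon>/2)"
    using wapproximable_continuous[unfolded wapproximable_def] half_gt_zero[OF \<open>\<epsilon> > 0\<close>] by blast
  have "sqrt \<bar>s\<bar> * \<bar>inv_cbrt s - f s\<bar> \<le> \<epsilon>/2" for s
  proof (cases "\<bar>s\<bar> \<le> \<delta> \<and> s \<noteq> 0")
    case True
    then have "\<delta> powr (-4/3) \<le> \<bar>s\<bar> powr (-4/3)" using \<delta> by (intro powr_mono2') auto
    then have "\<bar>\<bar>s\<bar> powr (-4/3) - \<delta> powr (-4/3)\<bar> \<le> \<bar>s\<bar> powr (-4/3)" by simp
    then have "\<bar>inv_cbrt s - f s\<bar> \<le> \<bar>inv_cbrt s\<bar>"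
      using True by (simp add: inv_cbrt_def f_def max_def abs_mult mult_left_mono flip: right_diff_distrib)
    then have "sqrt \<bar>s\<bar> * \<bar>inv_cbrt s - f s\<bar> \<le> sqrt \<bar>s\<bar> * \<bar>inv_cbrt s\<bar>"
      by (intro mult_left_mono) auto
    then show ?thesis using inv_cbrt_weight[OF \<delta>(1), of s] True \<delta>(2) by linarith
  next
    case False
    then have "inv_cbrt s = f s" using \<delta> by (auto simp: inv_cbrt_def f_def max_def)
    then show ?thesis using \<open>\<epsilon> > 0\<close> by simp
  qed
  then have "wapprox inv_cbrt p (\<epsilon>/2 + \<epsilon>/2)" by (intro wapprox_triangle[OF p])
  then show "\<exists>p. wapprox inv_cbrt p \<epsilon>" by auto
qed

text \<open>Since s f^3 = 1, the error is s (f - q)(f^2 + f q + q^2). The factor \<open>s\<close>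
  supplies the weight for two of the three remaining factors; with weighted bounds 1 for
  \<open>f\<close> and 2 for \<open>q\<close>, 7 = 1 + 2 + 4.\<close>

lemma wapprox_inv_cbrt_cube:
  assumes p: "wapprox inv_cbrt p \<epsilon>" and "0 \<le> \<epsilon>" "\<epsilon> \<le> 1" and s: "\<bar>s\<bar> \<le> 1"
  shows "sqrt \<bar>s\<bar> * \<bar>1 - s * poly p s ^ 3\<bar> \<le> 7 * \<epsilon>"
proof (cases "s = 0")
  case False
  define w where "w = sqrt \<bar>s\<bar>"
  define f where "f = inv_cbrt s"
  define q where "q = poly p s"
  have w: "w \<ge> 0" "w * w = \<bar>s\<bar>" by (simp_all add: w_def)
  have fq: "w * \<bar>f - q\<bar> \<le> \<epsilon>" using p s by (simp add: wapprox_def w_def f_def q_def)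
  have f1: "w * \<bar>f\<bar> \<le> 1" using inv_cbrt_weight[of 1 s] s by (simp add: w_def f_def)
  have "w * \<bar>q\<bar> \<le> w * (\<bar>f\<bar> + \<bar>f - q\<bar>)" using w by (intro mult_left_mono) auto
  then have q2: "w * \<bar>q\<bar> \<le> 2" using fq f1 assms by (simp add: distrib_left)
  have "1 - s * q ^ 3 = s * (f ^ 3 - q ^ 3)"
    using inv_cbrt_cube[OF False] by (simp add: right_diff_distrib f_def)
  also have "f ^ 3 - q ^ 3 = (f - q) * (f * f + f * q + q * q)"
    by (simp add: algebra_simps power3_eq_cube)
  finally have "w * \<bar>1 - s * q ^ 3\<bar> = (w * \<bar>f - q\<bar>) * (w * w * \<bar>f * f + f * q + q * q\<bar>)"
    by (simp add: abs_mult w(2))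
  also have "w * w * \<bar>f * f + f * q + q * q\<bar> \<le> w * w * (\<bar>f\<bar> * \<bar>f\<bar> + \<bar>f\<bar> * \<bar>q\<bar> + \<bar>q\<bar> * \<bar>q\<bar>)"
  proof (intro mult_left_mono)
    show "\<bar>f * f + f * q + q * q\<bar> \<le> \<bar>f\<bar> * \<bar>f\<bar> + \<bar>f\<bar> * \<bar>q\<bar> + \<bar>q\<bar> * \<bar>q\<bar>"
      unfolding abs_mult[symmetric]
      by (rule order_trans[OF abs_triangle_ineq add_right_mono[OF abs_triangle_ineq]])
  qed simp
  also have "\<dots> = (w * \<bar>f\<bar>) * (w * \<bar>f\<bar>) + (w * \<bar>f\<bar>) * (w * \<bar>q\<bar>) + (w * \<bar>q\<bar>) * (w * \<bar>q\<bar>)"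
    by (simp add: algebra_simps)
  also have "\<dots> \<le> 1 * 1 + 1 * 2 + 2 * 2"
    using w f1 q2 by (intro add_mono mult_mono) auto
  finally have "w * \<bar>1 - s * q ^ 3\<bar> \<le> (w * \<bar>f - q\<bar>) * 7" using w by (simp add: mult_left_mono)
  then show ?thesis using fq by (simp add: w_def q_def)
qed (use assms in simp)

lemma exponential_beats_linear:
  fixes y a b r :: real and m :: "nat \<Rightarrow> nat"
  assumes "filterlim m at_top sequentially" "0 \<le> a" "a < r"
    and "\<And>n. r ^ m n * y \<le> a ^ m n * (b * real (m n) + c)"
  shows "y \<le> 0"
proof -
  define q where "q = a / r"
  have q: "\<bar>q\<bar> < 1" using assms(2,3) by (simp add: q_def)
  have r: "r > 0" using assms(2,3) by linarith
  have "(\<lambda>n. b * (of_nat n * q ^ n) + c * q ^ n) \<longlonglongrightarrow> b * 0 + c * 0"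
    using q by (intro tendsto_intros powser_times_n_limit_0 LIMSEQ_power_zero) auto
  then have "(\<lambda>n. b * (of_nat (m n) * q ^ m n) + c * q ^ m n) \<longlonglongrightarrow> b * 0 + c * 0"
    by (rule filterlim_compose[OF _ assms(1)])
  moreover have "y \<le> b * (of_nat (m n) * q ^ m n) + c * q ^ m n" for n
    using assms(4)[of n] r by (simp add: q_def power_divide field_simps)
  ultimately have "y \<le> b * 0 + c * 0" by (intro LIMSEQ_le_const) auto
  then show ?thesis by simp
qed

context jb_star_triple
begin

lemma norm_mop_poly:
  fixes M :: real
  assumes "\<And>s. \<bar>s\<bar> \<le> 1 \<Longrightarrow> \<bar>poly p s\<bar> \<le> M"
  shows "norm (ap (rpeval (sin (mop h)) p) x) \<le> (2 * real (degree p) + 1) * M * norm x"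
  unfolding mop_def by (rule hermitian_bound[OF hermitian_L assms])

text \<open>Iterating \<open>norm_cube\<close> turns the sup bound with its degree factor into a spectral radius bound.\<close>

lemma norm_calculus:
  assumes h: "norm (mop h) \<le> 1/2"
    and M: "\<And>s. \<bar>s\<bar> \<le> 1 \<Longrightarrow> \<bar>s\<bar> * poly p s ^ 2 \<le> M"
  shows "norm (ap (rpeval (sin (mop h)) p) h) ^ 2 \<le> 2 * M"
proof (rule ccontr)
  assume contra: "\<not> ?thesis"
  define A where "A = mop h"
  define B where "B = sin A"
  define V where "V = sinc A"
  define P where "P = rpeval B p"
  define y where "y = ap P h"
  have "M \<ge> 0" using M[of 0] by simp
  have BAV: "B = V * A" "A * V = V * A"
    unfolding B_def V_def sin_eq_sinc by (simp_all add: palg_commute[OF self_in_palg sinc_in_palg])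
  have B: "B \<in> palg A" and V: "V \<in> palg A" and A: "A \<in> palg A"
    by (simp_all add: B_def V_def sin_in_palg sinc_in_palg self_in_palg)
  then have P: "P \<in> palg A" unfolding P_def by (intro rpeval_in_palg)
  \<comment> \<open>By \<open>tp_palg\<close>, cubing \<open>Y n\<close> applied to \<open>h\<close>
    multiplies by one more \<open>A\<close>, so the exponent m becomes 3m + 1, and 3^n = 2m + 1
    matches it with the exponent of the norm.\<close>
  define m :: "nat \<Rightarrow> nat" where "m = rec_nat 0 (\<lambda>_ k. 3 * k + 1)"
  have m: "m 0 = 0" "m (Suc n) = 3 * m n + 1" for n by (simp_all add: m_def)
  have m_ge: "n \<le> m n" for n by (induction n) (auto simp: m)
  have m3: "3 ^ n = 2 * m n + 1" for n by (induction n) (auto simp: m)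
  define Y where "Y n = (P * P * A) ^ m n * P" for n
  have Y: "Y n \<in> palg A" for n
    unfolding Y_def by (intro mult_in_palg power_palg P A)
  have YY: "Y n * Y n * Y n * A = Y (Suc n)" for n
  proof -
    define X where "X = (P * P * A) ^ m n"
    have X: "X \<in> palg A" unfolding X_def by (intro mult_in_palg power_palg P A)
    have XP: "P * X = X * P" by (rule palg_commute[OF P X])
    have XP': "P * (X * Z) = X * (P * Z)" for Z by (simp add: XP flip: mult.assoc)
    have AP: "A * P = P * A" by (rule palg_commute[OF A P])
    have e: "m (Suc n) = m n + m n + m n + 1" by (simp add: m)
    have "Y n * Y n * Y n * A = X * X * X * (P * P * A) * P"
      unfolding Y_def X_def[symmetric] by (simp add: XP XP' AP mult.assoc)
    then show ?thesis by (simp only: Y_def X_def e power_add power_one_right)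
  qed
  have normY: "norm (ap (Y n) h) = norm y ^ (2 * m n + 1)" for n
    unfolding m3[symmetric]
  proof (induction n)
    case (Suc n)
    have "tp (ap (Y n) h) (ap (Y n) h) (ap (Y n) h) = ap (Y (Suc n)) h"
      using tp_palg[OF Y[unfolded A_def] Y[unfolded A_def] Y[unfolded A_def]] YY[of n] by (simp only: A_def)
    moreover have "norm y ^ 3 ^ Suc n = (norm y ^ 3 ^ n) ^ 3" by (simp add: power_mult[symmetric] mult.commute)
    ultimately show ?case using norm_cube[of "ap (Y n) h"] Suc by (simp only:)
  qed (simp add: Y_def y_def m)
  \<comment> \<open>\<open>V\<close> differs from the unit by at most 1/2, hence is bounded below by
    1/2. Because V A = B, applying V^m turns (P P A)^m P into a polynomial in \<open>B\<close>; the
    cost 2^m is the source of the 2 in the conclusion.\<close>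
  have V1: "norm u \<le> 2 * norm (ap V u)" for u
  proof -
    have "norm (ap (V - 1) u) \<le> 1/2 * norm u"
    proof (rule order_trans[OF norm_ap mult_right_mono])
      show "norm (V - 1) \<le> 1/2"
        unfolding V_def A_def using norm_sinc_minus_1[OF h] h by linarith
    qed simp
    moreover have "u = ap V u - ap (V - 1) u" by (simp add: ap.diff_left)
    ultimately show ?thesis using norm_triangle_ineq4[of "ap V u" "ap (V - 1) u"] by simp
  qed
  have Vm: "norm u \<le> 2 ^ k * norm (ap (V ^ k) u)" for k u
  proof (induction k)
    case (Suc k)
    have "norm u \<le> 2 ^ k * (2 * norm (ap V (ap (V ^ k) u)))"
      by (rule order_trans[OF Suc mult_left_mono[OF V1]]) simp
    then show ?case by simp
  qed simp
  obtain C where C: "\<And>s. \<bar>s\<bar> \<le> 1 \<Longrightarrow> \<bar>poly p s\<bar> \<le> C"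
  proof -
    have "compact (poly p ` {-1..1::real})"
      by (intro compact_continuous_image continuous_intros) auto
    then obtain C where "\<forall>x\<in>poly p ` {-1..1::real}. norm x \<le> C"
      by (auto dest!: compact_imp_bounded simp: bounded_iff)
    then show ?thesis by (intro that[of C]) (auto simp: abs_le_iff)
  qed
  have "C \<ge> 0" using C[of 0] by simp
  define q where "q = p * p * [:0, 1:]"
  have B': "rpeval B [:0, 1:] = B" by (simp add: rpeval_simps)
  have key: "norm (ap (Y n) h) \<le> (2 * M) ^ m n * ((2 * real (degree q) * C * norm h) * real (m n) + (2 * real (degree p) + 1) * C * norm h)" for n
  proof -
    define k where "k = m n"
    have "V * (P * P * A) = P * P * B"
    proof -
      have "V * (P * P) = P * P * V" by (intro palg_commute[of _ A] mult_in_palg V P)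
      then show ?thesis unfolding BAV(1) by (simp add: mult.assoc[symmetric])
    qed
    moreover have "V * (P * P * A) = P * P * A * V" by (intro palg_commute[of _ A] mult_in_palg V P A)
    ultimately have "V ^ k * (P * P * A) ^ k = (P * P * B) ^ k"
      by (simp only: power_mult_commute[symmetric])
    moreover have "rpeval B (q ^ k * p) = (P * P * B) ^ k * P"
      by (simp only: q_def rpeval_simps(3,4) B' P_def)
    ultimately have "V ^ k * Y n = rpeval B (q ^ k * p)"
      by (simp add: Y_def k_def mult.assoc[symmetric])
    then have "norm (ap (Y n) h) \<le> 2 ^ k * norm (ap (rpeval B (q ^ k * p)) h)"
      using Vm[of "ap (Y n) h" k] by (simp flip: ap_mult)
    also have "norm (ap (rpeval B (q ^ k * p)) h) \<le> (2 * real (degree (q ^ k * p)) + 1) * (M ^ k * C) * norm h"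
      unfolding B_def A_def
    proof (rule norm_mop_poly)
      fix s :: real assume s: "\<bar>s\<bar> \<le> 1"
      have "\<bar>poly q s\<bar> \<le> M" using M[OF s] by (simp add: q_def abs_mult power2_eq_square mult_ac)
      then show "\<bar>poly (q ^ k * p) s\<bar> \<le> M ^ k * C"
        unfolding poly_mult poly_power abs_mult power_abs
        using C[OF s] \<open>M \<ge> 0\<close> by (intro mult_mono power_mono) auto
    qed
    also have "\<dots> \<le> (2 * real (k * degree q + degree p) + 1) * (M ^ k * C) * norm h"
    proof -
      have "degree (q ^ k * p) \<le> k * degree q + degree p"
        using degree_mult_le[of "q ^ k" p] degree_power_le[of q k] by (simp add: mult.commute)
      then have "real (degree (q ^ k * p)) \<le> real (k * degree q + degree p)" by (rule of_nat_mono)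
      then show ?thesis using \<open>M \<ge> 0\<close> \<open>C \<ge> 0\<close> by (intro mult_right_mono) auto
    qed
    finally show ?thesis
      by (simp add: k_def[symmetric] power_mult_distrib algebra_simps)
  qed
  \<comment> \<open>The norm of \<open>Y n\<close> at \<open>h\<close> is exactly norm y ^ (2m + 1),
    while \<open>key\<close> allows only (2M)^m times a linear function of m.\<close>
  have "norm y \<le> 0"
  proof (rule exponential_beats_linear[of m "2 * M" "norm y ^ 2"])
    show "filterlim m at_top sequentially"
      by (rule filterlim_at_top_mono[OF filterlim_ident]) (simp add: m_ge)
    show "0 \<le> 2 * M" "2 * M < norm y ^ 2"
      using \<open>M \<ge> 0\<close> contra by (auto simp: y_def P_def B_def A_def)
    show "(norm y ^ 2) ^ m n * norm y \<le> (2 * M) ^ m n * ((2 * real (degree q) * C * norm h) * real (m n) + (2 * real (degree p) + 1) * C * norm h)" for n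
      using key[of n] normY[of n] by (simp only: power_add power_one_right power_mult)
  qed
  then show False using contra \<open>M \<ge> 0\<close> by (simp add: y_def P_def B_def A_def)
qed

lemma norm_calculus_diff:
  assumes "norm (mop h) \<le> 1/2" "\<epsilon> \<ge> 0" "wapprox (poly q) p \<epsilon>"
  shows "norm (ap (rpeval (sin (mop h)) q) h - ap (rpeval (sin (mop h)) p) h) \<le> 2 * \<epsilon>"
proof -
  have "norm (ap (rpeval (sin (mop h)) (q - p)) h) ^ 2 \<le> 2 * \<epsilon> ^ 2"
  proof (rule norm_calculus[OF assms(1)])
    fix s :: real assume "\<bar>s\<bar> \<le> 1"
    then have "sqrt \<bar>s\<bar> * \<bar>poly q s - poly p s\<bar> \<le> \<epsilon>" using assms(3) by (simp add: wapprox_def)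
    then have "(sqrt \<bar>s\<bar> * \<bar>poly q s - poly p s\<bar>) ^ 2 \<le> \<epsilon> ^ 2" by (rule power_mono) simp
    then show "\<bar>s\<bar> * poly (q - p) s ^ 2 \<le> \<epsilon> ^ 2" by (simp add: power_mult_distrib)
  qed
  also have "\<dots> \<le> (2 * \<epsilon>) ^ 2" by (simp add: power_mult_distrib)
  finally have "norm (ap (rpeval (sin (mop h)) (q - p)) h) \<le> 2 * \<epsilon>"
    by (rule power2_le_imp_le) (use assms(2) in simp)
  then show ?thesis by (simp only: rpeval_simps(2) ap.diff_left)
qed

text \<open>Plays the role of f(B)h for \<open>B = sin (mop h)\<close>; f(B) need not exist as an
  operator. Prescribing the distance to all polynomial approximations at once frees it from any
  choice of sequence.\<close>

definition fc :: "'a \<Rightarrow> (real \<Rightarrow> real) \<Rightarrow> 'a" where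
  "fc h f = (SOME x. \<forall>p \<epsilon>. \<epsilon> \<ge> 0 \<longrightarrow> wapprox f p \<epsilon> \<longrightarrow> norm (x - ap (rpeval (sin (mop h)) p) h) \<le> 2 * \<epsilon>)"

lemma wapprox_poly_poly:
  assumes "wapprox f p \<delta>" "wapprox f q \<epsilon>"
  shows "wapprox (poly q) p (\<epsilon> + \<delta>)"
  using assms(2) by (intro wapprox_triangle[OF assms(1)]) (simp add: wapprox_def abs_minus_commute)

text \<open>Shows that the property chosen in \<open>fc\<close> can be satisfied: approximants of
  error 1/(n+1) form a Cauchy sequence by \<open>norm_calculus_diff\<close>, and its limit has the
  required distance from every other approximant.\<close>

lemma fc_bound:
  assumes h: "norm (mop h) \<le> 1/2" and f: "wapproximable f" and "\<epsilon> \<ge> 0" "wapprox f p \<epsilon>"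
  shows "norm (fc h f - ap (rpeval (sin (mop h)) p) h) \<le> 2 * \<epsilon>"
proof -
  define u where "u p = ap (rpeval (sin (mop h)) p) h" for p
  have u: "norm (u q - u p) \<le> 2 * (\<epsilon> + \<delta>)" if "wapprox f p \<delta>" "wapprox f q \<epsilon>" "\<delta> \<ge> 0" "\<epsilon> \<ge> 0" for p q \<epsilon> \<delta>
    unfolding u_def by (rule order_trans[OF norm_calculus_diff[OF h _ wapprox_poly_poly[OF that(1,2)]]])
      (use that in auto)
  have "\<forall>n. \<exists>p. wapprox f p (1 / real (Suc n))"
    using f by (simp add: wapproximable_def)
  then have "\<exists>P. \<forall>n. wapprox f (P n) (1 / real (Suc n))" by (rule choice)
  then obtain P where P: "\<And>n. wapprox f (P n) (1 / real (Suc n))" by blast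
  have "Cauchy (\<lambda>n. u (P n))"
  proof (rule CauchyI)
    fix e :: real assume "e > 0"
    then obtain N where N: "4 / e < real N" using reals_Archimedean2 by blast
    show "\<exists>M. \<forall>m\<ge>M. \<forall>n\<ge>M. norm (u (P m) - u (P n)) < e"
    proof (intro exI[of _ N] allI impI)
      fix m n assume "N \<le> m" "N \<le> n"
      then have "1 / real (Suc m) \<le> 1 / real (Suc N)" "1 / real (Suc n) \<le> 1 / real (Suc N)"
        by (auto intro!: divide_left_mono)
      then have "2 * (1 / real (Suc m) + 1 / real (Suc n)) \<le> 4 / real (Suc N)" by simp
      also have "\<dots> < e" using N \<open>e > 0\<close> by (simp add: field_simps)
      finally show "norm (u (P m) - u (P n)) < e"
        using u[OF P[of n] P[of m]] by (simp add: add.commute)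
    qed
  qed
  then obtain x where x: "(\<lambda>n. u (P n)) \<longlonglongrightarrow> x" unfolding Cauchy_convergent_iff convergent_def by blast
  define Q where "Q x \<longleftrightarrow> (\<forall>p \<epsilon>. \<epsilon> \<ge> 0 \<longrightarrow> wapprox f p \<epsilon> \<longrightarrow> norm (x - u p) \<le> 2 * \<epsilon>)" for x
  have "Q x"
    unfolding Q_def
  proof (intro allI impI)
    fix p \<epsilon> assume p: "\<epsilon> \<ge> 0" "wapprox f p \<epsilon>"
    have "(\<lambda>n. norm (u (P n) - u p)) \<longlonglongrightarrow> norm (x - u p)" by (intro tendsto_intros x)
    moreover have "(\<lambda>n. 2 * (inverse (real (Suc n)) + \<epsilon>)) \<longlonglongrightarrow> 2 * (0 + \<epsilon>)"
      by (intro tendsto_intros LIMSEQ_inverse_real_of_nat)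
    moreover have "norm (u (P n) - u p) \<le> 2 * (inverse (real (Suc n)) + \<epsilon>)" for n
      using u[OF p(2) P p(1), of n] by (simp add: inverse_eq_divide)
    ultimately have "norm (x - u p) \<le> 2 * (0 + \<epsilon>)"
      by (intro LIMSEQ_le) auto
    then show "norm (x - u p) \<le> 2 * \<epsilon>" by simp
  qed
  then have "Q (SOME x. Q x)" by (rule someI)
  also have "(SOME x. Q x) = fc h f" by (simp only: Q_def fc_def u_def)
  finally show ?thesis using assms(3,4) by (simp add: Q_def u_def)
qed

lemma fc_limit:
  assumes "norm (mop h) \<le> 1/2" "wapproximable f"
  shows "\<exists>P. (\<forall>n. wapprox f (P n) (1 / real (Suc n))) \<and>
    (\<lambda>n. ap (rpeval (sin (mop h)) (P n)) h) \<longlonglongrightarrow> fc h f"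
proof -
  have "\<forall>n. \<exists>p. wapprox f p (1 / real (Suc n))"
    using assms by (simp add: wapproximable_def)
  then have "\<exists>P. \<forall>n. wapprox f (P n) (1 / real (Suc n))" by (rule choice)
  then obtain P where P: "\<And>n. wapprox f (P n) (1 / real (Suc n))" by blast
  have "(\<lambda>n. 2 * inverse (real (Suc n))) \<longlonglongrightarrow> 2 * 0"
    by (intro tendsto_intros LIMSEQ_inverse_real_of_nat)
  then have lim0: "(\<lambda>n. 2 * (1 / real (Suc n))) \<longlonglongrightarrow> 0" by (simp add: inverse_eq_divide)
  have le: "norm (ap (rpeval (sin (mop h)) (P n)) h - fc h f) \<le> 2 * (1 / real (Suc n))" for n
    unfolding norm_minus_commute[of _ "fc h f"] by (rule fc_bound[OF assms _ P]) simp
  have "(\<lambda>n. ap (rpeval (sin (mop h)) (P n)) h - fc h f) \<longlonglongrightarrow> 0"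
    by (rule Lim_null_comparison[OF always_eventually lim0]) (intro allI le)
  then have "(\<lambda>n. ap (rpeval (sin (mop h)) (P n)) h) \<longlonglongrightarrow> fc h f" by (rule LIM_zero_cancel)
  with P show ?thesis by blast
qed

end

section \<open>Closed complex subspaces and lines modulo them\<close>

context complex_banach_space
begin

lemma real_subspace:
  assumes "subspace J"
  shows "Real_Vector_Spaces.subspace J"
proof (rule real_vector.subspaceI)
  show "0 \<in> J" by (rule subspace_0[OF assms])
  show "x + y \<in> J" if "x \<in> J" "y \<in> J" for x y by (rule subspace_add[OF assms that])
  show "r *\<^sub>R x \<in> J" if "x \<in> J" for r x
    using subspace_scale[OF assms that, of "of_real r"] by (simp add: scale_of_real)
qed

text \<open>With \<open>d\<close> the distance from \<open>h\<close> to \<open>J\<close>, this makes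
  the coefficient functional on the line through \<open>h\<close> plus \<open>J\<close>
  bounded.\<close>

lemma distance_from_subspace:
  assumes "closed J" "subspace J" "h \<notin> J"
  shows "\<exists>d>0. \<forall>c. \<forall>j\<in>J. cmod c * d \<le> norm (scale c h + j)"
proof -
  have ne: "J \<noteq> {}" using subspace_0[OF assms(2)] by auto
  have d: "infdist h J > 0"
    using assms(1,3) ne infdist_nonneg[of h J] in_closed_iff_infdist_zero[of J h] by force
  have "cmod c * infdist h J \<le> norm (scale c h + j)" if j: "j \<in> J" for c j
  proof (cases "c = 0")
    case False
    have "scale (- (1 / c)) j \<in> J" by (rule subspace_scale[OF assms(2) j])
    then have "infdist h J \<le> dist h (scale (- (1 / c)) j)" by (rule infdist_le)
    also have "\<dots> = norm (scale (1 / c) (scale c h + j))"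
      using False by (simp add: dist_norm scale_right_distrib)
    also have "\<dots> = norm (scale c h + j) / cmod c" by (simp add: norm_scale norm_divide)
    finally show ?thesis using False by (simp add: field_simps)
  qed simp
  then show ?thesis using d by blast
qed

text \<open>By \<open>distance_from_subspace\<close> the coefficients along a convergent sequence
  are Cauchy, so they have a limit that can be subtracted.\<close>

lemma closed_line_plus_subspace:
  assumes "closed J" "subspace J"
  shows "closed {x. \<exists>c. x - scale c h \<in> J}"
proof (cases "h \<in> J")
  case True
  have "{x. \<exists>c. x - scale c h \<in> J} = J"
  proof (intro equalityI subsetI)
    fix x assume "x \<in> {x. \<exists>c. x - scale c h \<in> J}"
    then obtain c where "x - scale c h \<in> J" by blast
    from subspace_add[OF assms(2) this subspace_scale[OF assms(2) True, of c]] show "x \<in> J" by simp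
  qed (auto intro: exI[of _ 0])
  then show ?thesis using assms by simp
next
  case False
  obtain d where d: "d > 0" "\<And>c j. j \<in> J \<Longrightarrow> cmod c * d \<le> norm (scale c h + j)"
    using distance_from_subspace[OF assms False] by blast
  show ?thesis
    unfolding closed_sequential_limits
  proof (intro allI impI, elim conjE)
    fix x l assume "\<forall>n. x n \<in> {x. \<exists>c. x - scale c h \<in> J}" and l: "x \<longlonglongrightarrow> l"
    then have "\<forall>n. \<exists>c. x n - scale c h \<in> J" by simp
    then have "\<exists>c. \<forall>n. x n - scale (c n) h \<in> J" by (rule choice)
    then obtain c where c: "\<And>n. x n - scale (c n) h \<in> J" by blast
    have le: "cmod (c m - c n) * d \<le> norm (x m - x n)" for m n
    proof -
      have "x m - x n - scale (c m - c n) h = (x m - scale (c m) h) - (x n - scale (c n) h)"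
        by (simp add: scale_left_diff_distrib)
      then have "x m - x n - scale (c m - c n) h \<in> J"
        using subspace_diff[OF assms(2) c[of m] c[of n]] by (simp only:)
      from d(2)[OF this, of "c m - c n"] show ?thesis by simp
    qed
    have "Cauchy c"
    proof (rule CauchyI)
      fix e :: real assume "e > 0"
      then obtain N where N: "\<forall>m\<ge>N. \<forall>n\<ge>N. norm (x m - x n) < e * d"
        using CauchyD[OF LIMSEQ_imp_Cauchy[OF l], of "e * d"] d(1) by auto
      have "cmod (c m - c n) < e" if "m \<ge> N" "n \<ge> N" for m n
      proof -
        have "cmod (c m - c n) * d < e * d" using le[of m n] N that by (meson le_less_trans)
        then show ?thesis using d(1) by simp
      qed
      then show "\<exists>M. \<forall>m\<ge>M. \<forall>n\<ge>M. norm (c m - c n) < e" by blast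
    qed
    then obtain k where k: "c \<longlonglongrightarrow> k" unfolding Cauchy_convergent_iff convergent_def by blast
    have "(\<lambda>n. scale (c n - k) h) \<longlonglongrightarrow> 0"
    proof (rule tendsto_norm_zero_cancel)
      have "(\<lambda>n. cmod (c n - k) * norm h) \<longlonglongrightarrow> 0 * norm h"
        by (intro tendsto_mult tendsto_const tendsto_norm_zero LIM_zero k)
      then show "(\<lambda>n. norm (scale (c n - k) h)) \<longlonglongrightarrow> 0" by (simp add: norm_scale)
    qed
    then have "(\<lambda>n. (x n - scale k h) - scale (c n - k) h) \<longlonglongrightarrow> (l - scale k h) - 0"
      by (intro tendsto_diff l tendsto_const)
    then have "(\<lambda>n. x n - scale (c n) h) \<longlonglongrightarrow> l - scale k h"
      by (simp add: scale_left_diff_distrib)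
    then have "l - scale k h \<in> J" by (rule closed_sequentially[OF assms(1) c])
    then show "l \<in> {x. \<exists>c. x - scale c h \<in> J}" by blast
  qed
qed

end

section \<open>Cube roots and orthogonal parts from the calculus\<close>

context jb_star_triple
begin

lemma rpeval_sin_in_palg: "rpeval (sin (mop h)) p \<in> palg (mop h)"
  by (rule rpeval_in_palg[OF sin_in_palg])

lemma fc_closed:
  assumes "norm (mop h) \<le> 1/2" "wapproximable f" "closed S" "\<And>X. X \<in> palg (mop h) \<Longrightarrow> ap X h \<in> S"
  shows "fc h f \<in> S"
proof -
  obtain P where "(\<lambda>n. ap (rpeval (sin (mop h)) (P n)) h) \<longlonglongrightarrow> fc h f"
    using fc_limit[OF assms(1,2)] by blast
  then show ?thesis
    by (rule closed_sequentially[OF assms(3) assms(4)[OF rpeval_sin_in_palg]])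
qed

text \<open>If \<open>P n\<close> approximates B^(-1/3), then B (P n)^3 tends to the unit on
  \<open>h\<close>. Substituting \<open>B = V A\<close> gives the shape in which
  \<open>tp_palg\<close> produces this operator.\<close>

lemma cube_root_aux:
  assumes h: "norm (mop h) \<le> 1/2"
  obtains P where "\<And>n. P n \<in> palg (mop h)"
    "(\<lambda>n. ap (P n) h) \<longlonglongrightarrow> fc h inv_cbrt"
    "(\<lambda>n. ap (sinc (mop h) * P n * P n * P n * mop h) h) \<longlonglongrightarrow> h"
proof -
  obtain p where p: "\<And>n. wapprox inv_cbrt (p n) (1 / real (Suc n))"
    "(\<lambda>n. ap (rpeval (sin (mop h)) (p n)) h) \<longlonglongrightarrow> fc h inv_cbrt"
    using fc_limit[OF h wapproximable_inv_cbrt] by blast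
  define P where "P n = rpeval (sin (mop h)) (p n)" for n
  have P: "P n \<in> palg (mop h)" for n unfolding P_def by (rule rpeval_sin_in_palg)
  have V: "sinc (mop h) \<in> palg (mop h)" "mop h \<in> palg (mop h)" by (rule sinc_in_palg self_in_palg)+
  define q where "q n = [:0, 1:] * (p n * p n * p n)" for n
  have eq: "rpeval (sin (mop h)) (q n) = sinc (mop h) * P n * P n * P n * mop h" for n
  proof -
    have "rpeval (sin (mop h)) (q n) = sin (mop h) * (P n * P n * P n)"
      by (simp only: q_def rpeval_simps(3) P_def) (simp add: rpeval_simps)
    also have "\<dots> = sinc (mop h) * mop h * (P n * P n * P n)"
      by (simp only: sin_eq_sinc palg_commute[OF V])
    also have "\<dots> = sinc (mop h) * ((P n * P n * P n) * mop h)"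
      unfolding mult.assoc[of "sinc (mop h)"]
      by (subst palg_commute[OF V(2)]) (intro mult_in_palg P, rule refl)
    finally show ?thesis by (simp only: mult.assoc)
  qed
  have le: "norm (ap (rpeval (sin (mop h)) (q n)) h - h) \<le> 14 * (1 / real (Suc n))" for n
  proof -
    have "wapprox (poly 1) (q n) (7 * (1 / real (Suc n)))"
      unfolding wapprox_def
    proof (intro allI impI)
      fix s :: real assume "\<bar>s\<bar> \<le> 1"
      from wapprox_inv_cbrt_cube[OF p(1) _ _ this, of n]
      show "sqrt \<bar>s\<bar> * \<bar>poly 1 s - poly (q n) s\<bar> \<le> 7 * (1 / real (Suc n))"
        by (simp add: q_def power3_eq_cube)
    qed
    from norm_calculus_diff[OF h _ this] show ?thesis
      by (simp add: rpeval_simps(6) norm_minus_commute[of _ h])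
  qed
  have "(\<lambda>n. 14 * inverse (real (Suc n))) \<longlonglongrightarrow> 14 * 0"
    by (intro tendsto_mult tendsto_const LIMSEQ_inverse_real_of_nat)
  then have lim0: "(\<lambda>n. 14 * (1 / real (Suc n))) \<longlonglongrightarrow> 0" by (simp add: inverse_eq_divide)
  have "(\<lambda>n. ap (rpeval (sin (mop h)) (q n)) h - h) \<longlonglongrightarrow> 0"
    by (rule Lim_null_comparison[OF always_eventually lim0]) (intro allI le)
  then have "(\<lambda>n. ap (rpeval (sin (mop h)) (q n)) h) \<longlonglongrightarrow> h" by (rule LIM_zero_cancel)
  then show ?thesis using that[of P] P p(2) unfolding eq P_def[symmetric] by blast
qed

text \<open>Formally y = B^(-1/3) h and x = V y, so that {x,y,y} = V A B^(-1) h = h. The clause on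
  closed sets \<open>S\<close> is there to place both factors in the ideal.\<close>

lemma cube_root:
  assumes h: "norm (mop h) \<le> 1/2"
  shows "\<exists>x y. tp x y y = h \<and> norm x \<le> 3 \<and> norm y \<le> 2 \<and>
    (\<forall>S. closed S \<longrightarrow> (\<forall>X\<in>palg (mop h). ap X h \<in> S) \<longrightarrow> x \<in> S \<and> y \<in> S)"
proof -
  define V where "V = sinc (mop h)"
  define y where "y = fc h inv_cbrt"
  have V: "V \<in> palg (mop h)" unfolding V_def by (rule sinc_in_palg)
  obtain P where P: "\<And>n. P n \<in> palg (mop h)" "(\<lambda>n. ap (P n) h) \<longlonglongrightarrow> y"
    "(\<lambda>n. ap (V * P n * P n * P n * mop h) h) \<longlonglongrightarrow> h"
    using cube_root_aux[OF h] unfolding V_def y_def by blast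
  have Vlim: "(\<lambda>n. ap (V * P n) h) \<longlonglongrightarrow> ap V y"
    unfolding ap_mult by (intro ap.tendsto tendsto_const P)
  have "(\<lambda>n. tp (ap (V * P n) h) (ap (P n) h) (ap (P n) h)) \<longlonglongrightarrow> tp (ap V y) y y"
    by (intro tendsto_tp Vlim P)
  then have "(\<lambda>n. ap (V * P n * P n * P n * mop h) h) \<longlonglongrightarrow> tp (ap V y) y y"
    by (simp only: tp_palg[OF mult_in_palg[OF V P(1)] P(1) P(1)])
  then have "tp (ap V y) y y = h" using P(3) LIMSEQ_unique by blast
  moreover have y2: "norm y \<le> 2"
  proof -
    \<comment> \<open>The zero polynomial already has weighted error 1, as |s|^(1/6) is at most 1;
      \<open>fc_bound\<close> doubles it.\<close>
    have "wapprox inv_cbrt 0 1"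
      unfolding wapprox_def using inv_cbrt_weight[of 1] by simp
    from fc_bound[OF h wapproximable_inv_cbrt _ this] show ?thesis
      by (simp add: rpeval_simps(7) ap.zero_left y_def)
  qed
  moreover have "norm (ap V y) \<le> 3"
  proof -
    have "norm (V - 1) \<le> 1/2" unfolding V_def using norm_sinc_minus_1[OF h] h by linarith
    then have "norm V \<le> 3/2" using norm_triangle_ineq[of "V - 1" 1] by simp
    then have "norm V * norm y \<le> 3/2 * 2" using y2 by (intro mult_mono) auto
    then show ?thesis using norm_ap[of V y] by linarith
  qed
  moreover have "ap V y \<in> S \<and> y \<in> S" if S: "closed S" "\<forall>X\<in>palg (mop h). ap X h \<in> S" for S
  proof
    show "ap V y \<in> S"
      by (rule closed_sequentially[OF S(1) _ Vlim]) (use S(2) mult_in_palg V P(1) in blast)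
    show "y \<in> S"
      by (rule closed_sequentially[OF S(1) _ P(2)]) (use S(2) P(1) in blast)
  qed
  ultimately show ?thesis by blast
qed

text \<open>By \<open>cube_root_aux\<close>, \<open>h\<close> is a limit of operators in
  \<open>palg (mop h)\<close> applied to A h = {h,h,h}.\<close>

lemma cube_mem:
  assumes h: "norm (mop h) \<le> 1/2" and "closed S" "Real_Vector_Spaces.subspace S"
    and S: "\<And>k. ap (mop h ^ k) (tp h h h) \<in> S"
  shows "h \<in> S"
proof -
  obtain P where P: "\<And>n. P n \<in> palg (mop h)"
    "(\<lambda>n. ap (sinc (mop h) * P n * P n * P n * mop h) h) \<longlonglongrightarrow> h"
    using cube_root_aux[OF h] by blast
  have "ap (sinc (mop h) * P n * P n * P n) (tp h h h) \<in> S" for n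
    by (rule palg_mop_invariant[OF _ assms(2,3) S]) (intro mult_in_palg sinc_in_palg P)
  then have "ap (sinc (mop h) * P n * P n * P n * mop h) h \<in> S" for n by simp
  then show ?thesis by (rule closed_sequentially[OF assms(2) _ P(2)])
qed

lemma fc_limit_uniform:
  assumes h: "norm (mop h) \<le> 1/2" and f: "continuous_on {-1..1} f"
  obtains P where "\<And>n s. \<bar>s\<bar> \<le> 1 \<Longrightarrow> \<bar>f s - poly (P n) s\<bar> \<le> 1 / real (Suc n)"
    "(\<lambda>n. ap (rpeval (sin (mop h)) (P n)) h) \<longlonglongrightarrow> fc h f"
proof -
  have "\<forall>n. \<exists>p. \<forall>s. \<bar>s\<bar> \<le> 1 \<longrightarrow> \<bar>f s - poly p s\<bar> \<le> 1 / real (Suc n)"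
    by (intro allI Weierstrass_poly[OF f]) simp
  then have "\<exists>P. \<forall>n s. \<bar>s\<bar> \<le> 1 \<longrightarrow> \<bar>f s - poly (P n) s\<bar> \<le> 1 / real (Suc n)" by (rule choice)
  then obtain P where P: "\<And>n s. \<bar>s\<bar> \<le> 1 \<Longrightarrow> \<bar>f s - poly (P n) s\<bar> \<le> 1 / real (Suc n)" by blast
  have "(\<lambda>n. 2 * inverse (real (Suc n))) \<longlonglongrightarrow> 2 * 0"
    by (intro tendsto_mult tendsto_const LIMSEQ_inverse_real_of_nat)
  then have lim0: "(\<lambda>n. 2 * (1 / real (Suc n))) \<longlonglongrightarrow> 0" by (simp add: inverse_eq_divide)
  have le: "norm (ap (rpeval (sin (mop h)) (P n)) h - fc h f) \<le> 2 * (1 / real (Suc n))" for n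
    unfolding norm_minus_commute[of _ "fc h f"]
    by (rule fc_bound[OF h wapproximable_continuous[OF f] _ wapprox_uniform[OF P]]) simp_all
  have "(\<lambda>n. ap (rpeval (sin (mop h)) (P n)) h - fc h f) \<longlonglongrightarrow> 0"
    by (rule Lim_null_comparison[OF always_eventually lim0]) (intro allI le)
  then have "(\<lambda>n. ap (rpeval (sin (mop h)) (P n)) h) \<longlonglongrightarrow> fc h f" by (rule LIM_zero_cancel)
  then show ?thesis using that P by blast
qed

text \<open>For uniform approximants p, q the product p q is uniformly small, and {p(B)h, q(B)h, z}
  = {(p q)(B)h, h, z} by \<open>tp_palg_left\<close>.\<close>

lemma fc_orthogonal:
  assumes h: "norm (mop h) \<le> 1/2" and f: "continuous_on {-1..1} f" and g: "continuous_on {-1..1} g"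
    and fg: "\<And>s. \<bar>s\<bar> \<le> 1 \<Longrightarrow> f s * g s = 0"
    and C: "\<And>s. \<bar>s\<bar> \<le> 1 \<Longrightarrow> \<bar>f s\<bar> \<le> C" "\<And>s. \<bar>s\<bar> \<le> 1 \<Longrightarrow> \<bar>g s\<bar> \<le> C"
  shows "tp (fc h f) (fc h g) z = 0"
proof -
  define E where "E p = rpeval (sin (mop h)) p" for p
  have E: "E p \<in> palg (mop h)" for p unfolding E_def by (rule rpeval_sin_in_palg)
  obtain P where P: "\<And>n s. \<bar>s\<bar> \<le> 1 \<Longrightarrow> \<bar>f s - poly (P n) s\<bar> \<le> 1 / real (Suc n)"
    "(\<lambda>n. ap (E (P n)) h) \<longlonglongrightarrow> fc h f" unfolding E_def by (rule fc_limit_uniform[OF h f]) blast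
  obtain Q where Q: "\<And>n s. \<bar>s\<bar> \<le> 1 \<Longrightarrow> \<bar>g s - poly (Q n) s\<bar> \<le> 1 / real (Suc n)"
    "(\<lambda>n. ap (E (Q n)) h) \<longlonglongrightarrow> fc h g" unfolding E_def by (rule fc_limit_uniform[OF h g]) blast
  have le: "norm (ap (E (P n * Q n)) h) \<le> 2 * ((2 * C + 1) * (1 / real (Suc n)))" for n
  proof -
    define \<epsilon> where "\<epsilon> = 1 / real (Suc n)"
    have \<epsilon>: "0 \<le> \<epsilon>" "\<epsilon> \<le> 1" by (simp_all add: \<epsilon>_def)
    have C0: "C \<ge> 0" using C(1)[of 0] by simp
    have "wapprox (poly 0) (P n * Q n) ((2 * C + 1) * \<epsilon>)"
    proof (rule wapprox_uniform)
      fix s :: real assume s: "\<bar>s\<bar> \<le> 1"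
      have p: "\<bar>poly (P n) s - f s\<bar> \<le> \<epsilon>" and q: "\<bar>poly (Q n) s - g s\<bar> \<le> \<epsilon>"
        using P(1)[OF s, of n] Q(1)[OF s, of n] by (simp_all only: \<epsilon>_def abs_minus_commute)
      have q': "\<bar>poly (Q n) s\<bar> \<le> C + 1"
        using q C(2)[OF s] \<epsilon> by linarith
      have "poly (P n * Q n) s = (poly (P n) s - f s) * poly (Q n) s + f s * (poly (Q n) s - g s)"
        using fg[OF s] by (simp add: algebra_simps)
      then have "\<bar>poly (P n * Q n) s\<bar> \<le> \<bar>poly (P n) s - f s\<bar> * \<bar>poly (Q n) s\<bar> + \<bar>f s\<bar> * \<bar>poly (Q n) s - g s\<bar>"
        by (simp only: abs_mult[symmetric] abs_triangle_ineq)
      also have "\<dots> \<le> \<epsilon> * (C + 1) + C * \<epsilon>"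
        by (intro add_mono mult_mono p q q' C(1)[OF s] \<epsilon> C0 abs_ge_zero)
      finally show "\<bar>poly 0 s - poly (P n * Q n) s\<bar> \<le> (2 * C + 1) * \<epsilon>"
        by (simp add: algebra_simps)
    qed
    from norm_calculus_diff[OF h _ this] \<epsilon> C0 show ?thesis
      by (simp add: E_def rpeval_simps(7) ap.zero_left \<epsilon>_def)
  qed
  have "(\<lambda>n. 2 * ((2 * C + 1) * inverse (real (Suc n)))) \<longlonglongrightarrow> 2 * ((2 * C + 1) * 0)"
    by (intro tendsto_mult tendsto_const LIMSEQ_inverse_real_of_nat)
  then have lim0: "(\<lambda>n. 2 * ((2 * C + 1) * (1 / real (Suc n)))) \<longlonglongrightarrow> 0" by (simp add: inverse_eq_divide)
  have "(\<lambda>n. ap (E (P n * Q n)) h) \<longlonglongrightarrow> 0"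
    by (rule Lim_null_comparison[OF always_eventually lim0]) (intro allI le)
  then have "(\<lambda>n. tp (ap (E (P n * Q n)) h) h z) \<longlonglongrightarrow> tp 0 h z"
    by (intro tendsto_tp tendsto_const)
  moreover have "tp (ap (E (P n * Q n)) h) h z = tp (ap (E (P n)) h) (ap (E (Q n)) h) z" for n
    unfolding tp_palg_left[OF E E] by (simp only: E_def rpeval_simps(3))
  moreover have "(\<lambda>n. tp (ap (E (P n)) h) (ap (E (Q n)) h) z) \<longlonglongrightarrow> tp (fc h f) (fc h g) z"
    by (intro tendsto_tp tendsto_const P Q)
  ultimately show ?thesis using LIMSEQ_unique by force
qed

lemma fc_diff_le:
  assumes h: "norm (mop h) \<le> 1/2" and f: "continuous_on {-1..1} f" and g: "continuous_on {-1..1} g"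
    and \<epsilon>: "\<And>s. \<bar>s\<bar> \<le> 1 \<Longrightarrow> \<bar>f s - g s\<bar> \<le> \<epsilon>"
  shows "norm (fc h f - fc h g) \<le> 2 * \<epsilon>"
proof (rule field_le_epsilon)
  fix e :: real assume e: "e > 0"
  have \<epsilon>0: "\<epsilon> \<ge> 0" using \<epsilon>[of 0] by simp
  obtain p where p: "\<And>s. \<bar>s\<bar> \<le> 1 \<Longrightarrow> \<bar>g s - poly p s\<bar> \<le> e/4"
    using Weierstrass_poly[OF g, of "e/4"] e by auto
  have wg: "wapprox g p (e/4)" by (rule wapprox_uniform[OF p])
  have wf: "wapprox f p (\<epsilon> + e/4)"
  proof (rule wapprox_uniform)
    fix s :: real assume "\<bar>s\<bar> \<le> 1"
    from p[OF this] \<epsilon>[OF this] show "\<bar>f s - poly p s\<bar> \<le> \<epsilon> + e/4" by linarith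
  qed
  have "norm (fc h g - ap (rpeval (sin (mop h)) p) h) \<le> 2 * (e/4)"
    by (rule fc_bound[OF h wapproximable_continuous[OF g] _ wg]) (use e in simp)
  moreover have "norm (fc h f - ap (rpeval (sin (mop h)) p) h) \<le> 2 * (\<epsilon> + e/4)"
    by (rule fc_bound[OF h wapproximable_continuous[OF f] _ wf]) (use e \<epsilon>0 in simp)
  ultimately show "norm (fc h f - fc h g) \<le> 2 * \<epsilon> + e"
    using norm_triangle_ineq4[of "fc h f - ap (rpeval (sin (mop h)) p) h" "fc h g - ap (rpeval (sin (mop h)) p) h"]
    by simp
qed

text \<open>If q approximates g, then q + p approximates f with the same error, so the two
  approximants differ by exactly p.\<close>

lemma fc_poly_diff:
  assumes h: "norm (mop h) \<le> 1/2" and f: "continuous_on {-1..1} f" and g: "continuous_on {-1..1} g"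
    and p: "\<And>s. \<bar>s\<bar> \<le> 1 \<Longrightarrow> f s - g s = poly p s"
  shows "fc h f - fc h g = ap (rpeval (sin (mop h)) p) h"
proof -
  have "norm (fc h f - fc h g - ap (rpeval (sin (mop h)) p) h) \<le> 0"
  proof (rule field_le_epsilon)
    fix e :: real assume e: "e > 0"
    obtain q where q: "\<And>s. \<bar>s\<bar> \<le> 1 \<Longrightarrow> \<bar>g s - poly q s\<bar> \<le> e/4"
      using Weierstrass_poly[OF g, of "e/4"] e by auto
    have wg: "wapprox g q (e/4)" by (rule wapprox_uniform[OF q])
    have wf: "wapprox f (q + p) (e/4)"
    proof (rule wapprox_uniform)
      fix s :: real assume "\<bar>s\<bar> \<le> 1"
      from q[OF this] p[OF this] show "\<bar>f s - poly (q + p) s\<bar> \<le> e/4" unfolding poly_add by linarith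
    qed
    have "norm (fc h g - ap (rpeval (sin (mop h)) q) h) \<le> 2 * (e/4)"
      by (rule fc_bound[OF h wapproximable_continuous[OF g] _ wg]) (use e in simp)
    moreover have "norm (fc h f - ap (rpeval (sin (mop h)) (q + p)) h) \<le> 2 * (e/4)"
      by (rule fc_bound[OF h wapproximable_continuous[OF f] _ wf]) (use e in simp)
    ultimately show "norm (fc h f - fc h g - ap (rpeval (sin (mop h)) p) h) \<le> 0 + e"
      using norm_triangle_ineq4[of "fc h f - ap (rpeval (sin (mop h)) (q + p)) h" "fc h g - ap (rpeval (sin (mop h)) q) h"]
      by (simp add: rpeval_simps(1) ap.add_left algebra_simps)
  qed
  then show ?thesis by simp
qed

end

section \<open>Indecomposable inner ideals\<close>

context jb_star_triple
begin

lemma small_multiple: "\<exists>r>0. norm (mop (r *\<^sub>R h)) \<le> 1/2"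
proof -
  obtain r :: real where r: "r > 0" "r ^ 2 * norm (mop h) \<le> 1/2"
  proof
    define n where "n = norm (mop h) + 1"
    have n: "n \<ge> 1" "norm (mop h) \<le> n" by (simp_all add: n_def)
    show "1 / (2 * n) > 0" using n by simp
    have "(1 / (2 * n)) ^ 2 * norm (mop h) \<le> (1 / (2 * n)) ^ 2 * n"
      using n by (intro mult_left_mono) auto
    also have "\<dots> = 1 / (4 * n)" using n by (simp add: power2_eq_square)
    also have "\<dots> \<le> 1/2" using n by (simp add: divide_le_eq)
    finally show "(1 / (2 * n)) ^ 2 * norm (mop h) \<le> 1/2" .
  qed
  then show ?thesis by (intro exI[of _ r]) (simp add: mop_scaleR)
qed

lemma ideal_closed_under:
  assumes "triple_ideal scale tp J"
  shows "subspace J" "\<And>x y z. z \<in> J \<Longrightarrow> tp x y z \<in> J" "\<And>x y z. z \<in> J \<Longrightarrow> tp x z y \<in> J"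
    "\<And>x y z. z \<in> J \<Longrightarrow> tp z x y \<in> J"
proof -
  show "subspace J" and 1: "z \<in> J \<Longrightarrow> tp x y z \<in> J" and "z \<in> J \<Longrightarrow> tp x z y \<in> J" for x y z
    using assms unfolding triple_ideal_def by blast+
  show "z \<in> J \<Longrightarrow> tp z x y \<in> J" for x y z
    unfolding tp_commute[of z x y] by (rule 1)
qed

text \<open>After scaling \<open>a\<close>, this is \<open>cube_mem\<close>: an ideal containing
  {h,h,h} is invariant under \<open>mop h\<close>.\<close>

lemma cube_in_ideal:
  assumes J: "closed J" "triple_ideal scale tp J" and a: "tp a a a \<in> J"
  shows "a \<in> J"
proof -
  note id = ideal_closed_under[OF J(2)]
  note rs = real_subspace[OF id(1)]
  obtain r where r: "r > 0" "norm (mop (r *\<^sub>R a)) \<le> 1/2" using small_multiple by blast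
  define h where "h = r *\<^sub>R a"
  have h3: "tp h h h \<in> J"
    unfolding h_def tp_scaleR by (intro real_vector.subspace_scale[OF rs] a)
  have pow: "ap (mop h ^ k) (tp h h h) \<in> J" for k
    by (induction k) (simp_all add: h3 id(2))
  have "h \<in> J"
    by (rule cube_mem[OF r(2)[folded h_def] J(1) rs pow])
  then have "(1 / r) *\<^sub>R h \<in> J" by (rule real_vector.subspace_scale[OF rs])
  then show ?thesis using r(1) by (simp add: h_def)
qed

text \<open>The elements orthogonal to a fixed one rarely form a triple ideal, but they do form an
  inner ideal, and inner ideals still contain the odd powers of their elements.\<close>

definition inner_ideal :: "'a set \<Rightarrow> bool" where
  "inner_ideal M \<longleftrightarrow> closed M \<and> subspace M \<and> (\<forall>c\<in>M. \<forall>z. tp c z c \<in> M)"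

definition triple_orth :: "'a \<Rightarrow> 'a \<Rightarrow> bool" where
  "triple_orth b c \<longleftrightarrow> (\<forall>z. tp b c z = 0 \<and> tp c b z = 0)"

lemma inner_ideal_triple_orth: "inner_ideal {c. triple_orth b c}"
  unfolding inner_ideal_def
proof (intro conjI ballI allI)
  have "{c. triple_orth b c} = (\<Inter>z. {c. tp b c z = 0} \<inter> {c. tp c b z = 0})"
    by (auto simp: triple_orth_def)
  then show "closed {c. triple_orth b c}"
    by (auto intro!: closed_Int closed_INT closed_Collect_eq continuous_intros)
  show "subspace {c. triple_orth b c}"
    by (rule subspaceI) (auto simp: triple_orth_def tp_add tp_scale_left tp_scale_middle)
  show "tp c z c \<in> {c. triple_orth b c}" if "c \<in> {c. triple_orth b c}" for c z
    using that orthogonal_inner[of b c z] by (simp add: triple_orth_def)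
qed

lemma inner_ideal_Int: "inner_ideal M \<Longrightarrow> inner_ideal N \<Longrightarrow> inner_ideal (M \<inter> N)"
  by (auto simp: inner_ideal_def intro: closed_Int subspace_inter)

text \<open>If every \<open>M\<close> outside \<open>J\<close> splits, keep one half
  \<open>b\<close> of an orthogonal pair and continue in \<open>M\<close> intersected with the
  elements orthogonal to \<open>b\<close>; the other half shows that this is still not inside
  \<open>J\<close>. All later choices are orthogonal to \<open>b\<close>.\<close>

lemma orthogonal_sequence_or_indecomposable:
  assumes "J \<noteq> UNIV"
  shows "(\<exists>b::nat \<Rightarrow> 'a. (\<forall>n. b n \<notin> J) \<and> (\<forall>m n. m \<noteq> n \<longrightarrow> triple_orth (b m) (b n))) \<or>
    (\<exists>M. inner_ideal M \<and> \<not> M \<subseteq> J \<and> (\<forall>b\<in>M. \<forall>c\<in>M. triple_orth b c \<longrightarrow> b \<in> J \<or> c \<in> J))"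
proof (rule disjCI)
  assume no: "\<not> (\<exists>M. inner_ideal M \<and> \<not> M \<subseteq> J \<and> (\<forall>b\<in>M. \<forall>c\<in>M. triple_orth b c \<longrightarrow> b \<in> J \<or> c \<in> J))"
  have "\<exists>M. \<forall>n. (inner_ideal (M n) \<and> \<not> M n \<subseteq> J) \<and>
      (\<exists>b\<in>M n. b \<notin> J \<and> M (Suc n) \<subseteq> M n \<inter> {c. triple_orth b c})"
  proof (rule dependent_nat_choice)
    have "inner_ideal UNIV" by (auto simp: inner_ideal_def)
    then show "\<exists>M. inner_ideal M \<and> \<not> M \<subseteq> J" using assms by blast
  next
    fix M and n :: nat
    assume M: "inner_ideal M \<and> \<not> M \<subseteq> J"
    then obtain b c where bc: "b \<in> M" "c \<in> M" "triple_orth b c" "b \<notin> J" "c \<notin> J" using no by blast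
    then have "inner_ideal (M \<inter> {c. triple_orth b c}) \<and> \<not> M \<inter> {c. triple_orth b c} \<subseteq> J"
      using inner_ideal_Int[OF conjunct1[OF M] inner_ideal_triple_orth[of b]] by blast
    then show "\<exists>N. (inner_ideal N \<and> \<not> N \<subseteq> J) \<and> (\<exists>b\<in>M. b \<notin> J \<and> N \<subseteq> M \<inter> {c. triple_orth b c})"
      using bc by blast
  qed
  then obtain M where "\<forall>n. (inner_ideal (M n) \<and> \<not> M n \<subseteq> J) \<and>
      (\<exists>b\<in>M n. b \<notin> J \<and> M (Suc n) \<subseteq> M n \<inter> {c. triple_orth b c})"
    by (rule exE)
  then have "\<forall>n. \<exists>b. b \<in> M n \<and> b \<notin> J \<and> M (Suc n) \<subseteq> M n \<inter> {c. triple_orth b c}"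
    by (simp add: Bex_def)
  then have "\<exists>b. \<forall>n. b n \<in> M n \<and> b n \<notin> J \<and> M (Suc n) \<subseteq> M n \<inter> {c. triple_orth (b n) c}"
    by (rule choice)
  then obtain b where "\<forall>n. b n \<in> M n \<and> b n \<notin> J \<and> M (Suc n) \<subseteq> M n \<inter> {c. triple_orth (b n) c}"
    by (rule exE)
  then have b: "b n \<in> M n" "b n \<notin> J" "M (Suc n) \<subseteq> M n \<inter> {c. triple_orth (b n) c}" for n
    by simp_all
  have mono: "M n \<subseteq> M m" if "m \<le> n" for m n
    by (rule lift_Suc_antimono_le[of M, OF le_infE[OF b(3)] that]) assumption
  have lt: "triple_orth (b m) (b n)" if "m < n" for m n
    using b(1)[of n] b(3)[of m] mono[of "Suc m" n] that by auto
  have neq: "triple_orth (b m) (b n)" if "m \<noteq> n" for m n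
  proof (cases "m < n")
    case False
    then show ?thesis using lt[of n m] that by (auto simp: triple_orth_def)
  qed (rule lt)
  show "\<exists>b::nat \<Rightarrow> 'a. (\<forall>n. b n \<notin> J) \<and> (\<forall>m n. m \<noteq> n \<longrightarrow> triple_orth (b m) (b n))"
    by (rule exI[of _ b]) (simp add: b(2) neq)
qed

text \<open>The sets of cut points \<open>\<lambda>\<close> for which the part of \<open>h\<close> above, respectively below \<open>\<lambda>\<close> lies in
  \<open>J\<close> are closed, nonempty and cover the connected interval \<open>[-1, 1]\<close>, so they meet.\<close>

lemma sin_eigenvector_modulo:
  assumes J: "closed J" "subspace J" and M: "inner_ideal M"
    and indec: "\<forall>b\<in>M. \<forall>c\<in>M. triple_orth b c \<longrightarrow> b \<in> J \<or> c \<in> J"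
    and h: "h \<in> M" "norm (mop h) \<le> 1/2"
  shows "\<exists>l. ap (sin (mop h)) h - l *\<^sub>R h \<in> J"
proof -
  have Mcl: "closed M" and Msub: "subspace M" using M by (auto simp: inner_ideal_def)
  have opwM: "opw h k \<in> M" for k
  proof (induction k)
    case (Suc k)
    have "tp h (opw h k) h \<in> M" using M h(1) by (simp add: inner_ideal_def)
    then show ?case using tp_opw[of h 0 k 0] by simp
  qed (simp add: h)
  have XM: "ap X h \<in> M" if "X \<in> palg (mop h)" for X
    by (rule palg_mop_invariant[OF that Mcl real_subspace[OF Msub]]) (simp add: ap_mop_power opwM)
  \<comment> \<open>\<open>u l\<close> and \<open>v l\<close> are the positive and negative parts of
    s - l. Their product vanishes, which gives orthogonality, and their difference is a polynomial,
    which produces the eigenvalue equation.\<close>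
  define u where "u l s = max (s - l) 0" for l s :: real
  define v where "v l s = max (l - s) 0" for l s :: real
  have cu: "continuous_on {-1..1} (u l)" and cv: "continuous_on {-1..1} (v l)" for l
    unfolding u_def v_def by (intro continuous_intros)+
  have uM: "fc h (u l) \<in> M" and vM: "fc h (v l) \<in> M" for l
    by (rule fc_closed[OF h(2) wapproximable_continuous[OF cu] Mcl XM], assumption)
      (rule fc_closed[OF h(2) wapproximable_continuous[OF cv] Mcl XM], assumption)
  have orth: "triple_orth (fc h (u l)) (fc h (v l))" if "l \<in> {-1..1}" for l
    unfolding triple_orth_def
    by (intro allI conjI fc_orthogonal[OF h(2), where C = 2] cu cv)
      (use that in \<open>auto simp: u_def v_def max_def abs_le_iff\<close>)
  have ucont: "continuous_on {-1..1} (\<lambda>l. fc h (u l))" and vcont: "continuous_on {-1..1} (\<lambda>l. fc h (v l))"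
  proof -
    have "2-lipschitz_on {-1..1} (\<lambda>l. fc h (u l))"
    proof (rule lipschitz_onI)
      show "dist (fc h (u x)) (fc h (u y)) \<le> 2 * dist x y" for x y
        unfolding dist_norm[of "fc h (u x)"] by (rule fc_diff_le[OF h(2) cu cu]) (auto simp: u_def dist_real_def)
    qed simp
    then show "continuous_on {-1..1} (\<lambda>l. fc h (u l))" by (rule lipschitz_on_continuous_on)
    have "2-lipschitz_on {-1..1} (\<lambda>l. fc h (v l))"
    proof (rule lipschitz_onI)
      show "dist (fc h (v x)) (fc h (v y)) \<le> 2 * dist x y" for x y
        unfolding dist_norm[of "fc h (v x)"] by (rule fc_diff_le[OF h(2) cv cv]) (auto simp: v_def dist_real_def)
    qed simp
    then show "continuous_on {-1..1} (\<lambda>l. fc h (v l))" by (rule lipschitz_on_continuous_on)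
  qed
  define A where "A = {-1..1} \<inter> (\<lambda>l. fc h (u l)) -` J"
  define B where "B = {-1..1} \<inter> (\<lambda>l. fc h (v l)) -` J"
  have closed: "closed A" "closed B"
    unfolding A_def B_def using J(1) ucont vcont
    by (auto intro!: continuous_closed_preimage)
  have fc0: "fc h f = 0" if "continuous_on {-1..1} f" "\<And>s. \<bar>s\<bar> \<le> 1 \<Longrightarrow> f s = 0" for f
    using fc_bound[OF h(2) wapproximable_continuous[OF that(1)], of 0 0] that(2)
    by (simp add: wapprox_def rpeval_simps(7) ap.zero_left)
  have "fc h (u 1) = 0" by (rule fc0[OF cu]) (auto simp: u_def)
  moreover have "fc h (v (-1)) = 0" by (rule fc0[OF cv]) (auto simp: v_def)
  ultimately have "1 \<in> A \<inter> {-1..1}" "-1 \<in> B \<inter> {-1..1}"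
    using subspace_0[OF J(2)] by (auto simp: A_def B_def)
  moreover have "{-1..1} \<subseteq> A \<union> B"
    using indec uM vM orth unfolding A_def B_def by blast
  ultimately have "A \<inter> B \<inter> {-1..1} \<noteq> {}"
    using connected_Icc[of "-1" "1::real", unfolded connected_closed] closed by blast
  then obtain l where "fc h (u l) \<in> J" "fc h (v l) \<in> J" by (auto simp: A_def B_def)
  then have "fc h (u l) - fc h (v l) \<in> J" by (rule subspace_diff[OF J(2)])
  also have "fc h (u l) - fc h (v l) = ap (rpeval (sin (mop h)) [:- l, 1:]) h"
    by (rule fc_poly_diff[OF h(2) cu cv]) (auto simp: u_def v_def)
  also have "\<dots> = ap (sin (mop h)) h - l *\<^sub>R h"
    by (simp add: rpeval_simps ap.diff_left ap.add_left ap.minus_left of_real_def ap.scaleR_left)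
  finally show ?thesis by blast
qed

text \<open>Removes the sine. With \<open>A = mop h\<close>, scaling \<open>h\<close> by a gives
  sin(a^2 A)(a h) = a^3 A sinc(a^2 A) h. After division by a^3 the left factor tends to A h =
  {h,h,h} as a tends to 0, and the line plus \<open>J\<close> is closed.\<close>

lemma cube_eigenvector_modulo:
  assumes J: "closed J" "subspace J" and M: "inner_ideal M"
    and indec: "\<forall>b\<in>M. \<forall>c\<in>M. triple_orth b c \<longrightarrow> b \<in> J \<or> c \<in> J"
    and h: "h \<in> M"
  shows "\<exists>c. tp h h h - scale c h \<in> J"
proof -
  note rs = real_subspace[OF J(2)]
  define N where "N = norm (mop h) + 1"
  have N: "N \<ge> 1" "norm (mop h) \<le> N" by (simp_all add: N_def)
  define a where "a n = 1 / (2 * N * real (Suc n))" for n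
  have a0: "a n > 0" "a n ^ 2 * N \<le> 1/2" "a n ^ 2 * N \<le> inverse (real (Suc n))" for n
  proof -
    show "a n > 0" using N by (simp add: a_def)
    have "a n \<le> 1" using N mult_mono[of 1 N 1 "real (Suc n)"] by (simp add: a_def divide_le_eq)
    then have *: "a n ^ 2 * N \<le> a n * N"
      using \<open>a n > 0\<close> N by (intro mult_right_mono) (auto simp: power2_eq_square)
    have eq: "a n * N = 1/2 * inverse (real (Suc n))" using N by (simp add: a_def field_simps del: of_nat_Suc)
    have "inverse (real (Suc n)) \<le> 1" by (simp add: inverse_le_1_iff)
    then show "a n ^ 2 * N \<le> 1/2" using * eq by linarith
    show "a n ^ 2 * N \<le> inverse (real (Suc n))" using * eq inverse_nonnegative_iff_nonnegative[of "real (Suc n)"] of_nat_0_le_iff[of "Suc n"] by linarith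
  qed
  have mop: "mop (a n *\<^sub>R h) = a n ^ 2 *\<^sub>R mop h" for n by (rule mop_scaleR)
  have small: "norm (mop (a n *\<^sub>R h)) \<le> 1/2" "norm (mop (a n *\<^sub>R h)) \<le> inverse (real (Suc n))" for n
  proof -
    have "norm (mop (a n *\<^sub>R h)) \<le> a n ^ 2 * N" unfolding mop using N by (simp add: mult_left_mono)
    then show "norm (mop (a n *\<^sub>R h)) \<le> 1/2" "norm (mop (a n *\<^sub>R h)) \<le> inverse (real (Suc n))"
      using a0(2,3)[of n] by linarith+
  qed
  define w where "w n = ap (mop h) (ap (sinc (mop (a n *\<^sub>R h))) h)" for n
  have "w n \<in> {x. \<exists>c. x - scale c h \<in> J}" for n
  proof -
    have "a n *\<^sub>R h \<in> M"
      using h M real_vector.subspace_scale[OF real_subspace] by (auto simp: inner_ideal_def)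
    from sin_eigenvector_modulo[OF J M indec this small(1)]
    obtain l where l: "ap (sin (mop (a n *\<^sub>R h))) (a n *\<^sub>R h) - l *\<^sub>R a n *\<^sub>R h \<in> J" by blast
    have "ap (sin (mop (a n *\<^sub>R h))) (a n *\<^sub>R h) = (a n * a n ^ 2) *\<^sub>R w n"
      unfolding sin_eq_sinc w_def mop ap_mult ap.scaleR_left ap.scaleR_right by (simp add: mult.commute)
    then have "(1 / (a n * a n ^ 2)) *\<^sub>R ((a n * a n ^ 2) *\<^sub>R w n - l *\<^sub>R a n *\<^sub>R h) \<in> J"
      using l by (intro real_vector.subspace_scale[OF rs]) simp
    then have "w n - (1 / (a n * a n ^ 2) * (l * a n)) *\<^sub>R h \<in> J"
      using a0(1)[of n] by (simp add: scaleR_right_diff_distrib)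
    then have "w n - scale (of_real (1 / (a n * a n ^ 2) * (l * a n))) h \<in> J"
      by (simp only: scale_of_real)
    then show ?thesis by blast
  qed
  moreover have "w \<longlonglongrightarrow> tp h h h"
  proof -
    have "norm (sinc (mop (a n *\<^sub>R h)) - 1) \<le> inverse (real (Suc n))" for n
      using norm_sinc_minus_1[OF small(1)] small(2) order_trans by blast
    then have "(\<lambda>n. sinc (mop (a n *\<^sub>R h)) - 1) \<longlonglongrightarrow> 0"
      by (intro Lim_null_comparison[OF always_eventually LIMSEQ_inverse_real_of_nat]) blast
    then have "(\<lambda>n. sinc (mop (a n *\<^sub>R h))) \<longlonglongrightarrow> 1" by (rule LIM_zero_cancel)
    then have "w \<longlonglongrightarrow> ap (mop h) (ap 1 h)"
      unfolding w_def by (intro ap.tendsto tendsto_const)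
    then show ?thesis by simp
  qed
  ultimately have "tp h h h \<in> {x. \<exists>c. x - scale c h \<in> J}"
    by (rule closed_sequentially[OF closed_line_plus_subspace[OF J]])
  then show ?thesis by blast
qed

lemma independent_modulo:
  assumes J: "subspace J" and "e \<notin> J" "\<not> (\<exists>c. x - scale c e \<in> J)"
    and "scale \<alpha> e + scale \<beta> x \<in> J"
  shows "\<alpha> = 0" "\<beta> = 0"
proof -
  show b: "\<beta> = 0"
  proof (rule ccontr)
    assume "\<beta> \<noteq> 0"
    have "scale (1 / \<beta>) (scale \<alpha> e + scale \<beta> x) \<in> J" by (rule subspace_scale[OF J assms(4)])
    then have "x - scale (- (\<alpha> / \<beta>)) e \<in> J"
      using \<open>\<beta> \<noteq> 0\<close> by (simp add: scale_right_distrib add.commute)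
    then show False using assms(3) by blast
  qed
  show "\<alpha> = 0"
  proof (rule ccontr)
    assume "\<alpha> \<noteq> 0"
    have "scale (1 / \<alpha>) (scale \<alpha> e + scale \<beta> x) \<in> J" by (rule subspace_scale[OF J assms(4)])
    then show False using \<open>\<alpha> \<noteq> 0\<close> b assms(2) by simp
  qed
qed

text \<open>With \<open>z\<^sub>t = e + t x\<close> one has
  \<open>{z\<^sub>2,z\<^sub>2,z\<^sub>2} = 3{z\<^sub>1,z\<^sub>1,z\<^sub>1} + {z\<^sub>-,z\<^sub>-,z\<^sub>-} - 3{e,e,e} + 6{x,x,x}\<close>, where \<open>z\<^sub>- = e - x\<close>;
  if all these cubes are multiples modulo \<open>J\<close>, comparing coefficients determines \<open>{e,x,e}\<close> modulo \<open>J\<close>.\<close>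

lemma middle_product_modulo:
  assumes J: "subspace J" and e: "e \<notin> J" and x: "\<not> (\<exists>c. x - scale c e \<in> J)"
    and cubes: "tp e e e - scale \<epsilon> e \<in> J" "tp x x x - scale \<mu> x \<in> J"
      "tp (e + x) (e + x) (e + x) - scale l1 (e + x) \<in> J"
      "tp (e - x) (e - x) (e - x) - scale l2 (e - x) \<in> J"
      "tp (e + x + x) (e + x + x) (e + x + x) - scale l3 (e + x + x) \<in> J"
    and eex: "tp e e x - scale \<epsilon> x \<in> J"
  shows "\<exists>d. tp e x e - scale d e + scale \<epsilon> x \<in> J"
proof -
  note add = subspace_add[OF J] and diff = subspace_diff[OF J]
  have c1: "tp x e e = tp e e x" "tp x x e = tp e x x" by (rule tp_commute)+
  define k0 where "k0 = tp e e e - scale \<epsilon> e"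
  define kx where "kx = tp x x x - scale \<mu> x"
  define k1 where "k1 = tp (e + x) (e + x) (e + x) - scale l1 (e + x)"
  define k2 where "k2 = tp (e - x) (e - x) (e - x) - scale l2 (e - x)"
  define k3 where "k3 = tp (e + x + x) (e + x + x) (e + x + x) - scale l3 (e + x + x)"
  define k4 where "k4 = tp e e x - scale \<epsilon> x"
  have k: "k0 \<in> J" "kx \<in> J" "k1 \<in> J" "k2 \<in> J" "k3 \<in> J" "k4 \<in> J"
    using cubes eex by (simp_all only: k0_def kx_def k1_def k2_def k3_def k4_def)
  have three: "scale (3 * c) v = scale c v + scale c v + scale c v"
    "scale (c * 3) v = scale c v + scale c v + scale c v" for c v
    by (simp_all add: scale_left_distrib[symmetric])
  have six: "scale (6 * c) v = scale (3 * c) v + scale (3 * c) v"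
    "scale (c * 6) v = scale (3 * c) v + scale (3 * c) v" for c v
    by (simp_all add: scale_left_distrib[symmetric])
  have two: "scale (2 * c) v = scale c v + scale c v" "scale (c * 2) v = scale c v + scale c v" for c v
    by (simp_all add: scale_left_distrib[symmetric])
  have cube1: "tp (e + x) (e + x) (e + x) =
      tp e e e + (tp e e x + tp e e x) + tp e x e + (tp e x x + tp e x x) + tp x e x + tp x x x"
    by (simp add: tp_add c1 add_ac)
  have cube2: "tp (e - x) (e - x) (e - x) =
      tp e e e - (tp e e x + tp e e x) - tp e x e + (tp e x x + tp e x x) + tp x e x - tp x x x"
    by (simp add: tp_diff c1 algebra_simps)
  have cube3: "tp (e + x + x) (e + x + x) (e + x + x) =
     (tp (e + x) (e + x) (e + x) + tp (e + x) (e + x) (e + x) + tp (e + x) (e + x) (e + x))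
     + tp (e - x) (e - x) (e - x) - (tp e e e + tp e e e + tp e e e)
     + (tp x x x + tp x x x + tp x x x + tp x x x + tp x x x + tp x x x)"
    unfolding cube1 cube2 by (simp add: tp_add c1 algebra_simps)
  have "k3 - (k1 + k1 + k1) - k2 + (k0 + k0 + k0) - (kx + kx + kx + kx + kx + kx) =
      scale (3 * l1 + l2 - 3 * \<epsilon> - l3) e + scale (3 * l1 - l2 + 6 * \<mu> - 2 * l3) x"
    unfolding k3_def cube3 unfolding k1_def k2_def k0_def kx_def
    by (simp add: scale_left_distrib scale_left_diff_distrib scale_right_distrib scale_right_diff_distrib
        six three two algebra_simps)
  moreover have "k3 - (k1 + k1 + k1) - k2 + (k0 + k0 + k0) - (kx + kx + kx + kx + kx + kx) \<in> J"
    by (intro add diff k)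
  ultimately have "scale (3 * l1 + l2 - 3 * \<epsilon> - l3) e + scale (3 * l1 - l2 + 6 * \<mu> - 2 * l3) x \<in> J"
    by (simp only:)
  from independent_modulo[OF J e x this]
  have l: "3 * l1 + l2 - 3 * \<epsilon> - l3 = 0" "3 * l1 - l2 + 6 * \<mu> - 2 * l3 = 0" .
  \<comment> \<open>Twice the first equation minus the second eliminates \<open>l3\<close>.\<close>
  have l12: "l1 + l2 = 2 * \<epsilon> + 2 * \<mu>"
  proof -
    have "3 * (l1 + l2) - 6 * \<epsilon> - 6 * \<mu> = 2 * (3 * l1 + l2 - 3 * \<epsilon> - l3) - (3 * l1 - l2 + 6 * \<mu> - 2 * l3)"
      by (simp add: algebra_simps)
    then have "3 * (l1 + l2) = 3 * (2 * \<epsilon> + 2 * \<mu>)" unfolding l by (simp add: algebra_simps)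
    then show ?thesis unfolding mult_cancel_left by simp
  qed
  \<comment> \<open>The difference of the cubes of e + x and e - x is 4{e,e,x} + 2{e,x,e} +
    2{x,x,x}, in which only {e,x,e} is not yet known modulo \<open>J\<close>.\<close>
  have "k1 - k2 - (kx + kx) - (k4 + k4 + k4 + k4) =
      tp e x e + tp e x e - scale (l1 - l2) e - scale (l1 + l2) x + scale (2 * \<mu>) x + (scale (2 * \<epsilon>) x + scale (2 * \<epsilon>) x)"
    unfolding k1_def k2_def kx_def k4_def cube1 cube2
    by (simp add: scale_left_distrib scale_left_diff_distrib scale_right_distrib scale_right_diff_distrib
        two algebra_simps)
  also have "\<dots> = scale 2 (tp e x e - scale ((l1 - l2) / 2) e + scale \<epsilon> x)"
    unfolding l12 using two(1)[of 1]
    by (simp add: scale_right_distrib scale_right_diff_distrib scale_left_distrib two)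
  finally have "scale (1/2) (k1 - k2 - (kx + kx) - (k4 + k4 + k4 + k4)) =
      tp e x e - scale ((l1 - l2) / 2) e + scale \<epsilon> x" by simp
  moreover have "scale (1/2) (k1 - k2 - (kx + kx) - (k4 + k4 + k4 + k4)) \<in> J"
    by (intro subspace_scale[OF J] add diff k)
  ultimately show ?thesis by auto
qed

text \<open>Applying the previous lemma to \<open>x\<close> and to \<open>\<i> x\<close> forces \<open>x\<close> into the line through \<open>e\<close> modulo \<open>J\<close>.\<close>

lemma indecomposable_minimal:
  assumes J: "closed J" "triple_ideal scale tp J" and M: "inner_ideal M" "e \<in> M" "e \<notin> J"
    and indec: "\<forall>b\<in>M. \<forall>c\<in>M. triple_orth b c \<longrightarrow> b \<in> J \<or> c \<in> J"
  shows "\<exists>c. tp e y e - scale c e \<in> J"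
proof (rule ccontr)
  note id = ideal_closed_under[OF J(2)]
  note add = subspace_add[OF id(1)] and diff = subspace_diff[OF id(1)]
  have M': "subspace M" using M(1) by (simp add: inner_ideal_def)
  note cubes = cube_eigenvector_modulo[OF J(1) id(1) M(1) indec]
  define x where "x = tp e y e"
  assume "\<not> (\<exists>c. tp e y e - scale c e \<in> J)"
  then have x: "\<not> (\<exists>c. x - scale c e \<in> J)" by (simp add: x_def)
  have xM: "x \<in> M" using M(1,2) by (simp add: x_def inner_ideal_def)
  obtain \<epsilon> where \<epsilon>: "tp e e e - scale \<epsilon> e \<in> J" using cubes[OF M(2)] by blast
  \<comment> \<open>Otherwise {e,e,e} and hence \<open>e\<close> would lie in
    \<open>J\<close>.\<close>
  have "\<epsilon> \<noteq> 0" using \<epsilon> cube_in_ideal[OF J, of e] M(3) by auto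
  \<comment> \<open>For x = Q(e)y one has {e,e,x} = {{e,e,e},y,e}, by expanding in two ways as in
    \<open>quadratic_cube\<close>; replacing {e,e,e} by \<epsilon> e changes it only by an element
    of \<open>J\<close>.\<close>
  have eex: "tp e e x - scale \<epsilon> x \<in> J"
  proof -
    define k where "k = tp e e e - scale \<epsilon> e"
    define g where "g = tp e (tp e e y) e"
    have k: "k \<in> J" using \<epsilon> by (simp add: k_def)
    have e3: "tp e e e = scale \<epsilon> e + k" by (simp add: k_def)
    have 1: "tp e e x = tp (tp e e e) y e - g + tp e y (tp e e e)"
      unfolding x_def g_def by (rule jordan)
    have 2: "tp e y (tp e e e) = tp x e e - tp e (tp y e e) e + tp e e x"
      unfolding x_def by (rule jordan)
    have 3: "tp x e e = tp e e x" "tp y e e = tp e e y" "tp e y k = tp k y e" by (rule tp_commute)+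
    have A: "tp e e x = scale \<epsilon> x + tp k y e - g + (scale \<epsilon> x + tp k y e)"
      using 1 unfolding e3 tp_add tp_scale_left tp_scale_right 3 x_def[symmetric] .
    have B: "scale \<epsilon> x + tp k y e = tp e e x - g + tp e e x"
      using 2 unfolding 3 g_def[symmetric] unfolding e3 tp_add tp_scale_left tp_scale_right 3 x_def[symmetric] .
    have "tp e e x = scale \<epsilon> x + tp k y e"
    proof -
      define u w where "u = tp e e x" and "w = scale \<epsilon> x + tp k y e"
      have "u = w - g + w" "w = u - g + u" using A B by (simp_all only: u_def w_def)
      then have "w + w - u = g" "u + u - w = g" by (metis add.commute add_diff_cancel_right' add_diff_eq diff_diff_eq2)+
      then have "u + u + u = w + w + w" by (simp add: algebra_simps)
      moreover have "v + v + v = 3 *\<^sub>R v" for v :: 'a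
        using scaleR_left_distrib[of 2 1 v] by (simp add: scaleR_2)
      ultimately have "3 *\<^sub>R u = 3 *\<^sub>R w" by (simp only:)
      then show ?thesis by (simp add: u_def w_def)
    qed
    then have "tp e e x - scale \<epsilon> x = tp k y e" by simp
    then show ?thesis using id(4)[OF k] by simp
  qed
  have key: "\<exists>d. tp e v e - scale d e + scale \<epsilon> v \<in> J"
    if v: "v \<in> M" "\<not> (\<exists>c. v - scale c e \<in> J)" "tp e e v - scale \<epsilon> v \<in> J" for v
  proof -
    have "e + v \<in> M" "e - v \<in> M" "e + v + v \<in> M"
      by (intro subspace_add[OF M'] subspace_diff[OF M'] M(2) v(1))+
    from cubes[OF this(1)] cubes[OF this(2)] cubes[OF this(3)] cubes[OF v(1)]
    obtain l1 l2 l3 m where "tp v v v - scale m v \<in> J"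
      "tp (e + v) (e + v) (e + v) - scale l1 (e + v) \<in> J"
      "tp (e - v) (e - v) (e - v) - scale l2 (e - v) \<in> J"
      "tp (e + v + v) (e + v + v) (e + v + v) - scale l3 (e + v + v) \<in> J" by blast
    from middle_product_modulo[OF id(1) M(3) v(2) \<epsilon> this v(3)] show ?thesis .
  qed
  obtain d where d: "tp e x e - scale d e + scale \<epsilon> x \<in> J"
    using key[OF xM x eex] by blast
  obtain d' where d': "tp e (scale \<i> x) e - scale d' e + scale \<epsilon> (scale \<i> x) \<in> J"
  proof (rule exE[OF key])
    show "scale \<i> x \<in> M" by (rule subspace_scale[OF M' xM])
    show "\<not> (\<exists>c. scale \<i> x - scale c e \<in> J)"
    proof
      assume "\<exists>c. scale \<i> x - scale c e \<in> J"
      then obtain c where "scale \<i> x - scale c e \<in> J" by blast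
      then have "scale (- \<i>) (scale \<i> x - scale c e) \<in> J" by (rule subspace_scale[OF id(1)])
      then have "x - scale (- \<i> * c) e \<in> J" by (simp add: scale_right_diff_distrib)
      then show False using x by blast
    qed
    have "scale \<i> (tp e e x - scale \<epsilon> x) \<in> J" by (rule subspace_scale[OF id(1) eex])
    then show "tp e e (scale \<i> x) - scale \<epsilon> (scale \<i> x) \<in> J"
      by (simp add: tp_scale_right scale_right_diff_distrib mult.commute)
  qed
  \<comment> \<open>Conjugate linearity gives {e, ix, e} = -i {e,x,e}, so this combination cancels
    the middle products, while the terms linear in \<open>x\<close> add up to 2 \<epsilon>
    x.\<close>
  have "scale (1 / (2 * \<epsilon>)) ((tp e x e - scale d e + scale \<epsilon> x)
      - scale \<i> (tp e (scale \<i> x) e - scale d' e + scale \<epsilon> (scale \<i> x))) \<in> J"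
    by (intro subspace_scale[OF id(1)] diff d d')
  also have "(tp e x e - scale d e + scale \<epsilon> x)
      - scale \<i> (tp e (scale \<i> x) e - scale d' e + scale \<epsilon> (scale \<i> x))
    = scale (2 * \<epsilon>) x - scale (d - \<i> * d') e"
    using scale_left_distrib[of \<epsilon> \<epsilon> x]
    by (simp add: tp_scale_middle scale_right_distrib scale_right_diff_distrib scale_left_diff_distrib algebra_simps)
  finally have "x - scale ((d - \<i> * d') / (2 * \<epsilon>)) e \<in> J"
    using \<open>\<epsilon> \<noteq> 0\<close> by (simp add: scale_right_diff_distrib)
  then show False using x by blast
qed

end

section \<open>Generalised triple homomorphisms\<close>

text \<open>The supremum of the norms of the \<open>f i x\<close> is a seminorm, countably
  subadditive because each \<open>f i\<close> is bounded on \<open>J\<close>;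
  \<open>zabreiko\<close> bounds it.\<close>

lemma uniform_boundedness_on:
  fixes f :: "'i \<Rightarrow> 'a::banach \<Rightarrow> 'b::banach"
  assumes J: "closed J" "subspace J"
    and add: "\<And>i x y. i \<in> I \<Longrightarrow> f i (x + y) = f i x + f i y"
    and scale: "\<And>i r x. i \<in> I \<Longrightarrow> f i (r *\<^sub>R x) = r *\<^sub>R f i x"
    and each: "\<And>i. i \<in> I \<Longrightarrow> \<exists>K. \<forall>x\<in>J. norm (f i x) \<le> K * norm x"
    and pointwise: "\<And>x. x \<in> J \<Longrightarrow> \<exists>M. \<forall>i\<in>I. norm (f i x) \<le> M"
  shows "\<exists>K. \<forall>i\<in>I. \<forall>x\<in>J. norm (f i x) \<le> K * norm x"
proof (cases "I = {}")
  case False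
  define p where "p x = (SUP i\<in>I. norm (f i x))" for x
  have bdd: "bdd_above ((\<lambda>i. norm (f i x)) ` I)" if "x \<in> J" for x
    using pointwise[OF that] by (auto intro: bdd_aboveI2)
  have le_p: "norm (f i x) \<le> p x" if "i \<in> I" "x \<in> J" for i x
    unfolding p_def by (rule cSUP_upper[OF that(1) bdd[OF that(2)]])
  have p_le: "p x \<le> M" if "\<And>i. i \<in> I \<Longrightarrow> norm (f i x) \<le> M" for x M
    unfolding p_def by (rule cSUP_least[OF False that])
  obtain i0 where i0: "i0 \<in> I" using False by blast
  have nonneg: "0 \<le> p x" if "x \<in> J" for x
    using le_p[OF i0 that] norm_ge_zero order_trans by blast
  have p_scale_le: "p (c *\<^sub>R x) \<le> \<bar>c\<bar> * p x" if "x \<in> J" for c x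
    by (rule p_le) (simp add: scale le_p that mult_left_mono)
  have "\<exists>K. \<forall>x\<in>J. p x \<le> K * norm x"
  proof (rule zabreiko[OF J nonneg], assumption)
    fix c x assume x: "x \<in> J"
    show "p (c *\<^sub>R x) = \<bar>c\<bar> * p x"
    proof (cases "c = 0")
      case True
      have "p 0 \<le> 0" by (rule p_le) (use scale[of _ 0 0] in simp)
      then show ?thesis using True nonneg[OF subspace_0[OF J(2)]] by simp
    next
      case False
      have "p ((1 / c) *\<^sub>R (c *\<^sub>R x)) \<le> \<bar>1 / c\<bar> * p (c *\<^sub>R x)"
        by (rule p_scale_le) (rule subspace_scale[OF J(2) x])
      then have "\<bar>c\<bar> * p x \<le> p (c *\<^sub>R x)" using False by (simp add: field_simps)
      then show ?thesis using p_scale_le[OF x, of c] by simp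
    qed
  next
    fix x y assume "x \<in> J" "y \<in> J"
    then show "p (x + y) \<le> p x + p y"
      by (intro p_le) (auto simp: add intro!: norm_triangle_mono le_p)
  next
    fix a x assume a: "\<And>n::nat. a n \<in> J" and sums: "a sums x" and sm: "summable (\<lambda>n. p (a n))"
    have part: "(\<Sum>k<n. a k) \<in> J" for n by (rule subspace_sum[OF J(2) a])
    have xJ: "x \<in> J" using sums unfolding sums_def by (rule closed_sequentially[OF J(1) part])
    show "p x \<le> (\<Sum>n. p (a n))"
    proof (rule p_le)
      fix i assume i: "i \<in> I"
      obtain K where K: "\<And>x. x \<in> J \<Longrightarrow> norm (f i x) \<le> K * norm x" using each[OF i] by blast
      have f0: "f i 0 = 0" using scale[OF i, of 0 0] by simp
      have fsum: "f i (\<Sum>k<n. a k) = (\<Sum>k<n. f i (a k))" for n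
        by (induction n) (simp_all add: f0 add[OF i])
      have fdiff: "f i (u - v) = f i u - f i v" for u v
        using add[OF i, of "u - v" v] by simp
      have "(\<lambda>n. (\<Sum>k<n. a k) - x) \<longlonglongrightarrow> 0" using sums unfolding sums_def by (rule LIM_zero)
      then have K0: "(\<lambda>n. K * norm ((\<Sum>k<n. a k) - x)) \<longlonglongrightarrow> 0"
        using tendsto_mult[OF tendsto_const tendsto_norm_zero, of _ sequentially K] by simp
      have "(\<lambda>n. f i (\<Sum>k<n. a k) - f i x) \<longlonglongrightarrow> 0"
        by (rule Lim_null_comparison[OF always_eventually K0])
          (intro allI, unfold fdiff[symmetric], intro K subspace_diff[OF J(2)] part xJ)
      then have "(\<lambda>n. f i (\<Sum>k<n. a k)) \<longlonglongrightarrow> f i x" by (rule LIM_zero_cancel)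
      then have "(\<lambda>n. norm (f i (\<Sum>k<n. a k))) \<longlonglongrightarrow> norm (f i x)" by (rule tendsto_norm)
      moreover have "norm (f i (\<Sum>k<n. a k)) \<le> (\<Sum>n. p (a n))" for n
      proof -
        have "norm (f i (\<Sum>k<n. a k)) \<le> (\<Sum>k<n. p (a k))"
          unfolding fsum by (rule sum_norm_le) (rule le_p[OF i a])
        also have "\<dots> \<le> (\<Sum>n. p (a n))" by (rule sum_le_suminf[OF sm]) (use nonneg a in auto)
        finally show ?thesis .
      qed
      ultimately show "norm (f i x) \<le> (\<Sum>n. p (a n))" by (auto intro: LIMSEQ_le_const2)
    qed
  qed
  then obtain K where "\<And>x. x \<in> J \<Longrightarrow> p x \<le> K * norm x" by blast
  then have "\<forall>i\<in>I. \<forall>x\<in>J. norm (f i x) \<le> K * norm x" using le_p order_trans by blast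
  then show ?thesis by blast
qed simp

locale triple_hom = E: jb_star_triple scaleE tpE + F: jordan_banach_triple scaleF tpF
  for scaleE :: "complex \<Rightarrow> 'a::banach \<Rightarrow> 'a" and tpE :: "'a \<Rightarrow> 'a \<Rightarrow> 'a \<Rightarrow> 'a"
    and scaleF :: "complex \<Rightarrow> 'b::banach \<Rightarrow> 'b" and tpF :: "'b \<Rightarrow> 'b \<Rightarrow> 'b \<Rightarrow> 'b" +
  fixes T :: "'a \<Rightarrow> 'b"
  assumes hom: "generalised_triple_hom scaleE tpE scaleF tpF T"
begin

lemma T_add: "T (x + y) = T x + T y" and T_scale: "T (scaleE c x) = scaleF c (T x)"
proof -
  interpret l: Vector_Spaces.linear scaleE scaleF T
    using hom by (simp add: generalised_triple_hom_def)
  show "T (x + y) = T x + T y" "T (scaleE c x) = scaleF c (T x)" by (rule l.add l.scale)+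
qed

lemma T_scaleR: "T (r *\<^sub>R x) = r *\<^sub>R T x"
  using T_scale[of "of_real r" x] by (simp add: E.scale_of_real F.scale_of_real)

lemma T_diff: "T (x - y) = T x - T y"
  using T_add[of "x - y" y] by simp

lemma T_0 [simp]: "T 0 = 0"
  using T_scaleR[of 0 0] by simp

lemma T_sum: "T (\<Sum>k<n. a k) = (\<Sum>k<(n::nat). T (a k))"
  by (induction n) (simp_all add: T_add)

lemma T_triple: "\<exists>C>0. \<forall>a b c. norm (T (tpE a b c) - tpF (T a) (T b) (T c)) \<le> C * norm a * norm b * norm c"
  using hom by (simp add: generalised_triple_hom_def)

section \<open>The separating space and maps that annihilate it\<close>

abbreviation S where "S \<equiv> separating_space T"

lemma separating_space_iff: "z \<in> S \<longleftrightarrow> (\<forall>e>0. \<exists>x. norm x < e \<and> norm (T x - z) < e)"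
proof
  assume "z \<in> S"
  then obtain x where x: "x \<longlonglongrightarrow> 0" "(\<lambda>n. T (x n)) \<longlonglongrightarrow> z" by (auto simp: separating_space_def)
  show "\<forall>e>0. \<exists>x. norm x < e \<and> norm (T x - z) < e"
  proof (intro allI impI)
    fix e :: real assume "e > 0"
    have "\<forall>\<^sub>F n in sequentially. dist (x n) 0 < e" "\<forall>\<^sub>F n in sequentially. dist (T (x n)) z < e"
      using tendstoD[OF x(1) \<open>e > 0\<close>] tendstoD[OF x(2) \<open>e > 0\<close>] .
    then have "\<forall>\<^sub>F n in sequentially. norm (x n) < e \<and> norm (T (x n) - z) < e"
      by eventually_elim (simp add: dist_norm)
    then show "\<exists>x. norm x < e \<and> norm (T x - z) < e"
      by (auto dest: eventually_happens)
  qed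
next
  assume R: "\<forall>e>0. \<exists>x. norm x < e \<and> norm (T x - z) < e"
  have "\<forall>n. \<exists>x. norm x < inverse (real (Suc n)) \<and> norm (T x - z) < inverse (real (Suc n))"
    using R by simp
  then have "\<exists>x. \<forall>n. norm (x n) < inverse (real (Suc n)) \<and> norm (T (x n) - z) < inverse (real (Suc n))"
    by (rule choice)
  then obtain x where x: "\<And>n. norm (x n) < inverse (real (Suc n))" "\<And>n. norm (T (x n) - z) < inverse (real (Suc n))"
    by blast
  have "x \<longlonglongrightarrow> 0"
    by (rule Lim_null_comparison[OF always_eventually LIMSEQ_inverse_real_of_nat]) (intro allI less_imp_le x)
  moreover have "(\<lambda>n. T (x n) - z) \<longlonglongrightarrow> 0"
    by (rule Lim_null_comparison[OF always_eventually LIMSEQ_inverse_real_of_nat]) (intro allI less_imp_le x)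
  then have "(\<lambda>n. T (x n)) \<longlonglongrightarrow> z" by (rule LIM_zero_cancel)
  ultimately show "z \<in> S" by (auto simp: separating_space_def)
qed

lemma subspace_separating: "subspace S"
proof (rule subspaceI)
  show "0 \<in> S" unfolding separating_space_iff by (auto intro: exI[of _ 0])
next
  fix y z assume "y \<in> S" "z \<in> S"
  then obtain u v where uv: "u \<longlonglongrightarrow> 0" "(\<lambda>n. T (u n)) \<longlonglongrightarrow> y" "v \<longlonglongrightarrow> 0" "(\<lambda>n. T (v n)) \<longlonglongrightarrow> z"
    by (auto simp: separating_space_def)
  have "(\<lambda>n. u n + v n) \<longlonglongrightarrow> 0 + 0" "(\<lambda>n. T (u n) + T (v n)) \<longlonglongrightarrow> y + z" by (intro tendsto_add uv)+
  then show "y + z \<in> S"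
    unfolding separating_space_def by (auto simp: T_add intro!: exI[of _ "\<lambda>n. u n + v n"])
next
  fix z and r :: real assume "z \<in> S"
  then obtain u where u: "u \<longlonglongrightarrow> 0" "(\<lambda>n. T (u n)) \<longlonglongrightarrow> z"
    by (auto simp: separating_space_def)
  have "(\<lambda>n. r *\<^sub>R u n) \<longlonglongrightarrow> r *\<^sub>R 0" "(\<lambda>n. r *\<^sub>R T (u n)) \<longlonglongrightarrow> r *\<^sub>R z"
    by (intro tendsto_scaleR tendsto_const u)+
  then show "r *\<^sub>R z \<in> S"
    unfolding separating_space_def by (auto simp: T_scaleR intro!: exI[of _ "\<lambda>n. r *\<^sub>R u n"])
qed

text \<open>Modulo its separating space \<open>T\<close> has closed graph, hence is bounded.\<close>

lemma distance_to_separating_bounded: "\<exists>K. \<forall>x. infdist (T x) S \<le> K * norm x"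
proof -
  note sub = subspace_separating
  have ne: "S \<noteq> {}" using subspace_0[OF sub] by auto
  have attain: "\<exists>s\<in>S. norm (v - s) < infdist v S + e" if "e > 0" for v e
  proof -
    have "infdist v S < infdist v S + e" using that by simp
    then have "(INF s\<in>S. dist v s) < infdist v S + e" using ne by (simp add: infdist_def)
    then have "\<exists>s\<in>S. dist v s < infdist v S + e"
      using ne by (subst (asm) cINF_less_iff) (auto intro: bdd_belowI2[of _ 0])
    then show ?thesis by (simp add: dist_norm)
  qed
  have le: "infdist v S \<le> norm (v - s)" if "s \<in> S" for v s
    using infdist_le[OF that, of v] by (simp add: dist_norm)
  have scale_le: "infdist (c *\<^sub>R v) S \<le> \<bar>c\<bar> * infdist v S" for c v
  proof (rule field_le_epsilon)
    fix e :: real assume "e > 0"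
    then have "e / (\<bar>c\<bar> + 1) > 0" by (intro divide_pos_pos) linarith+
    then obtain s where s: "s \<in> S" "norm (v - s) < infdist v S + e / (\<bar>c\<bar> + 1)" using attain by blast
    have "infdist (c *\<^sub>R v) S \<le> norm (c *\<^sub>R v - c *\<^sub>R s)" by (rule le) (rule subspace_scale[OF sub s(1)])
    also have "\<dots> = \<bar>c\<bar> * norm (v - s)" by (simp flip: scaleR_right_diff_distrib)
    also have "\<dots> \<le> \<bar>c\<bar> * (infdist v S + e / (\<bar>c\<bar> + 1))" using s(2) by (intro mult_left_mono) auto
    also have "\<dots> = \<bar>c\<bar> * infdist v S + (\<bar>c\<bar> / (\<bar>c\<bar> + 1)) * e" by (simp add: distrib_left)
    also have "\<dots> \<le> \<bar>c\<bar> * infdist v S + 1 * e"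
      using \<open>e > 0\<close> by (intro add_left_mono mult_right_mono) auto
    finally show "infdist (c *\<^sub>R v) S \<le> \<bar>c\<bar> * infdist v S + e" by simp
  qed
  \<comment> \<open>The distance to \<open>S\<close> serves as the norm of the quotient by
    \<open>S\<close>, which is never formed.\<close>
  have "\<exists>K. \<forall>x\<in>UNIV. infdist (T x) S \<le> K * norm x"
  proof (rule zabreiko)
    show "closed (UNIV :: 'a set)" "subspace (UNIV :: 'a set)" by simp_all
    show "0 \<le> infdist (T x) S" for x by (rule infdist_nonneg)
    show "infdist (T (c *\<^sub>R x)) S = \<bar>c\<bar> * infdist (T x) S" for c x
    proof (cases "c = 0")
      case True
      then show ?thesis using subspace_0[OF sub] by simp
    next
      case False
      then have "\<bar>c\<bar> * infdist (T x) S \<le> infdist (c *\<^sub>R T x) S"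
        using scale_le[of "1/c" "c *\<^sub>R T x"] by (simp add: field_simps)
      then show ?thesis using scale_le[of c "T x"] by (simp add: T_scaleR)
    qed
    show "infdist (T (x + y)) S \<le> infdist (T x) S + infdist (T y) S" for x y
    proof (rule field_le_epsilon)
      fix e :: real assume "e > 0"
      then obtain s t where st: "s \<in> S" "norm (T x - s) < infdist (T x) S + e/2"
        "t \<in> S" "norm (T y - t) < infdist (T y) S + e/2"
        using attain[of "e/2" "T x"] attain[of "e/2" "T y"] by auto
      have "infdist (T (x + y)) S \<le> norm (T (x + y) - (s + t))" by (rule le) (rule subspace_add[OF sub st(1,3)])
      also have "T (x + y) - (s + t) = (T x - s) + (T y - t)" by (simp add: T_add)
      also have "norm \<dots> \<le> norm (T x - s) + norm (T y - t)" by (rule norm_triangle_ineq)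
      finally show "infdist (T (x + y)) S \<le> infdist (T x) S + infdist (T y) S + e" using st by linarith
    qed
    fix a x assume sums: "a sums x" and sm: "summable (\<lambda>n. infdist (T (a n)) S)"
    show "infdist (T x) S \<le> (\<Sum>n. infdist (T (a n)) S)"
    proof (rule field_le_epsilon)
      fix e :: real assume e: "e > 0"
      have "\<forall>n. \<exists>s. s \<in> S \<and> norm (T (a n) - s) < infdist (T (a n)) S + e * (1/2) ^ Suc n"
        using attain e by (meson mult_pos_pos zero_less_power half_gt_zero_iff zero_less_one)
      then have "\<exists>s. \<forall>n. s n \<in> S \<and> norm (T (a n) - s n) < infdist (T (a n)) S + e * (1/2) ^ Suc n"
        by (rule choice)
      then obtain s where s: "\<And>n. s n \<in> S" "\<And>n. norm (T (a n) - s n) < infdist (T (a n)) S + e * (1/2) ^ Suc n"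
        by blast
      have geo: "(\<lambda>n. e * (1/2) ^ Suc n) sums e"
        using sums_mult[OF power_half_series, of e] by simp
      have sumsB: "(\<lambda>n. infdist (T (a n)) S + e * (1/2) ^ Suc n) sums ((\<Sum>n. infdist (T (a n)) S) + e)"
        by (intro sums_add geo summable_sums sm)
      have "summable (\<lambda>n. T (a n) - s n)"
        by (rule summable_comparison_test'[OF sums_summable[OF sumsB]]) (use s(2) less_imp_le in blast)
      then obtain w where w: "(\<lambda>n. T (a n) - s n) sums w" by (auto simp: summable_def)
      have normw: "norm w \<le> (\<Sum>n. infdist (T (a n)) S) + e"
        by (rule norm_sums_le[OF w sumsB]) (use s(2) less_imp_le in blast)
      \<comment> \<open>The partial sums of \<open>s\<close> need not converge, but each is nearly
        the image of a tiny vector \<open>x' n\<close>. Adding \<open>x' n\<close> to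
        \<open>x\<close> minus the partial sum of \<open>a\<close> gives vectors tending to 0 whose
        images tend to \<open>T x - w\<close>.\<close>
      have "(\<Sum>k<n. s k) \<in> S" for n by (rule subspace_sum[OF sub s(1)])
      then have "\<exists>x. norm x < inverse (real (Suc n)) \<and> norm (T x - (\<Sum>k<n. s k)) < inverse (real (Suc n))" for n
        unfolding separating_space_iff by simp
      then have "\<forall>n. \<exists>x. norm x < inverse (real (Suc n)) \<and> norm (T x - (\<Sum>k<n. s k)) < inverse (real (Suc n))" ..
      then have "\<exists>x. \<forall>n. norm (x n) < inverse (real (Suc n)) \<and> norm (T (x n) - (\<Sum>k<n. s k)) < inverse (real (Suc n))"
        by (rule choice)
      then obtain x' where x': "\<And>n. norm (x' n) < inverse (real (Suc n))"
        "\<And>n. norm (T (x' n) - (\<Sum>k<n. s k)) < inverse (real (Suc n))" by blast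
      have l1: "x' \<longlonglongrightarrow> 0"
        by (rule Lim_null_comparison[OF always_eventually LIMSEQ_inverse_real_of_nat]) (intro allI less_imp_le x')
      have l2: "(\<lambda>n. T (x' n) - (\<Sum>k<n. s k)) \<longlonglongrightarrow> 0"
        by (rule Lim_null_comparison[OF always_eventually LIMSEQ_inverse_real_of_nat]) (intro allI less_imp_le x')
      have "(\<lambda>n. x - (\<Sum>k<n. a k) + x' n) \<longlonglongrightarrow> x - x + 0"
        using sums unfolding sums_def by (intro tendsto_add tendsto_diff tendsto_const l1)
      moreover have "(\<lambda>n. T x - (\<Sum>k<n. T (a k) - s k) + (T (x' n) - (\<Sum>k<n. s k))) \<longlonglongrightarrow> T x - w + 0"
        using w unfolding sums_def by (intro tendsto_add tendsto_diff tendsto_const l2)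
      then have "(\<lambda>n. T (x - (\<Sum>k<n. a k) + x' n)) \<longlonglongrightarrow> T x - w"
        by (simp add: T_add T_diff T_sum sum_subtractf)
      ultimately have "T x - w \<in> S" by (auto simp: separating_space_def)
      from le[OF this, of "T x"] show "infdist (T x) S \<le> (\<Sum>n. infdist (T (a n)) S) + e"
        using normw by simp
    qed
  qed
  then show ?thesis by simp
qed

text \<open>\<open>R\<close> factors through the quotient by \<open>S\<close>, so its norm is
  controlled by the distance to \<open>S\<close>, which \<open>T\<close> bounds.\<close>

lemma bounded_if_annihilates:
  assumes R: "bounded_linear R" and S: "\<And>s. s \<in> S \<Longrightarrow> R s = 0"
  shows "\<exists>K. \<forall>x. norm (R (T x)) \<le> K * norm x"
proof -
  obtain K where K: "\<And>x. infdist (T x) S \<le> K * norm x" using distance_to_separating_bounded by blast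
  obtain B where B: "B > 0" "\<And>v. norm (R v) \<le> norm v * B" using bounded_linear.pos_bounded[OF R] by blast
  have ne: "S \<noteq> {}" using subspace_0[OF subspace_separating] by auto
  have "norm (R v) / B \<le> infdist v S" for v
    unfolding infdist_def using ne
  proof (simp, intro cINF_greatest)
    fix s assume s: "s \<in> S"
    have "R v = R (v - s)" by (simp add: linear_diff[OF bounded_linear.linear[OF R]] S[OF s])
    then show "norm (R v) / B \<le> dist v s" using B(1) B(2)[of "v - s"] by (simp add: dist_norm field_simps)
  qed
  then have "norm (R v) \<le> B * infdist v S" for v
    using B(1) by (simp add: divide_le_eq mult.commute)
  then have "norm (R (T x)) \<le> (B * K) * norm x" for x
    unfolding mult.assoc by (rule order_trans[OF _ mult_left_mono[OF K]]) (use B(1) in simp)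
  then show ?thesis by blast
qed

text \<open>T o Q(a) and Q(T a) o T differ by a bounded map, so Q(T a) o T is bounded too;
  evaluating it on a null sequence whose images tend to \<open>s\<close> gives Q(T a)s = 0.\<close>

lemma quadratic_bounded_imp:
  assumes "\<exists>K. \<forall>x. norm (T (tpE a x a)) \<le> K * norm x"
  shows "T a \<in> quadratic_annihilator tpF S"
  unfolding quadratic_annihilator_def
proof (intro CollectI ballI)
  fix s assume "s \<in> S"
  then obtain x where x: "x \<longlonglongrightarrow> 0" "(\<lambda>n. T (x n)) \<longlonglongrightarrow> s" by (auto simp: separating_space_def)
  obtain K where K: "\<And>x. norm (T (tpE a x a)) \<le> K * norm x" using assms by blast
  obtain C where C: "\<And>a b c. norm (T (tpE a b c) - tpF (T a) (T b) (T c)) \<le> C * norm a * norm b * norm c"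
    using T_triple by blast
  have le: "norm (tpF (T a) (T y) (T a)) \<le> (K + C * norm a * norm a) * norm y" for y
  proof -
    have "norm (tpF (T a) (T y) (T a)) \<le> norm (T (tpE a y a)) + norm (T (tpE a y a) - tpF (T a) (T y) (T a))"
      using norm_triangle_sub[of "tpF (T a) (T y) (T a)" "T (tpE a y a)"]
        norm_minus_commute[of "tpF (T a) (T y) (T a)" "T (tpE a y a)"] by simp
    also have "\<dots> \<le> K * norm y + C * norm a * norm y * norm a" by (intro add_mono K C)
    finally show ?thesis by (simp add: algebra_simps)
  qed
  have "(\<lambda>n. (K + C * norm a * norm a) * norm (x n)) \<longlonglongrightarrow> (K + C * norm a * norm a) * norm (0::'a)"
    by (intro tendsto_mult tendsto_const tendsto_norm x)
  then have l0: "(\<lambda>n. (K + C * norm a * norm a) * norm (x n)) \<longlonglongrightarrow> 0" by simp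
  have "(\<lambda>n. tpF (T a) (T (x n)) (T a)) \<longlonglongrightarrow> 0"
    by (rule Lim_null_comparison[OF always_eventually l0]) (intro allI le)
  moreover have "(\<lambda>n. tpF (T a) (T (x n)) (T a)) \<longlonglongrightarrow> tpF (T a) s (T a)"
    by (intro F.tendsto_tp tendsto_const x)
  ultimately show "tpF (T a) s (T a) = 0" using LIMSEQ_unique by blast
qed

text \<open>Each summand lies in the range of one Q(b_n), hence is killed by Q(b_m) for all other m.
  One convergent sum \<open>z\<close> would then force \<open>T\<close> to be large at all Q(b_m)z,
  while the approximate triple identity bounds these values in terms of \<open>T z\<close>.\<close>

lemma gliding_hump:
  assumes J: "closed J" "triple_ideal scaleE tpE J" "J = T -` quadratic_annihilator tpF S"
    and b: "\<And>n::nat. b n \<notin> J" and orth: "\<And>m n. m \<noteq> n \<Longrightarrow> E.triple_orth (b m) (b n)"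
  shows False
proof -
  define Q where "Q n x = tpE (b n) x (b n)" for n x
  have Q_lin: "Q n (r *\<^sub>R x) = r *\<^sub>R Q n x" for n r x by (simp add: Q_def E.tp_scaleR)
  \<comment> \<open>Were T o Q(b)^2 bounded, so would be T o Q(b)^3 = T o Q({b,b,b}), putting
    {b,b,b} and then \<open>b\<close> into \<open>J\<close>.\<close>
  have unbounded: "\<exists>x. norm (T (Q n (Q n x))) > K * norm x" for n K
  proof (rule ccontr)
    assume "\<nexists>x. norm (T (Q n (Q n x))) > K * norm x"
    then have K: "norm (T (Q n (Q n x))) \<le> K * norm x" for x by (meson not_le)
    obtain L where L: "L > 0" "\<And>x y z. norm (tpE x y z) \<le> L * norm x * norm y * norm z"
      using E.tp_bounded by blast
    have "norm (T (Q n (Q n (Q n x)))) \<le> (\<bar>K\<bar> * (L * norm (b n) * norm (b n))) * norm x" for x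
    proof -
      have "norm (T (Q n (Q n (Q n x)))) \<le> \<bar>K\<bar> * norm (Q n x)"
        by (rule order_trans[OF K]) (simp add: mult_right_mono)
      also have "\<dots> \<le> \<bar>K\<bar> * (L * norm (b n) * norm x * norm (b n))"
        unfolding Q_def by (intro mult_left_mono L) simp
      finally show ?thesis by (simp add: mult_ac)
    qed
    moreover have "tpE (tpE (b n) (b n) (b n)) x (tpE (b n) (b n) (b n)) = Q n (Q n (Q n x))" for x
      by (simp only: Q_def E.quadratic_cube)
    ultimately have "\<exists>K. \<forall>x. norm (T (tpE (tpE (b n) (b n) (b n)) x (tpE (b n) (b n) (b n)))) \<le> K * norm x"
      by (intro exI allI) (simp only:)
    then have "tpE (b n) (b n) (b n) \<in> J" unfolding J(3) by (blast intro: quadratic_bounded_imp)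
    then show False using E.cube_in_ideal[OF J(1,2)] b by blast
  qed
  \<comment> \<open>Dominates the squares of both norms that occur in the estimate of
    \<open>T (Q m z)\<close>, so that dividing by \<open>D m\<close> leaves a bound independent of
    m.\<close>
  define D where "D n = 1 + norm (T (b n)) ^ 2 + norm (b n) ^ 2" for n
  have Q0: "Q n 0 = 0" for n by (simp add: Q_def)
  have "\<exists>y. y \<in> range (Q n) \<and> norm y \<le> (1/2) ^ n \<and> norm (T (Q n y)) > real n * D n" for n
  proof -
    obtain L where L: "L > 0" "\<And>x y z. norm (tpE x y z) \<le> L * norm x * norm y * norm z"
      using E.tp_bounded by blast
    define M where "M = L * norm (b n) * norm (b n) + 1"
    have M: "M > 0" "norm (Q n x) \<le> M * norm x" for x
    proof -
      show "M > 0" unfolding M_def using L(1) by (intro add_nonneg_pos mult_nonneg_nonneg) auto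
      have "norm (Q n x) \<le> L * norm (b n) * norm (b n) * norm x" using L(2)[of "b n" x "b n"] by (simp add: Q_def mult_ac)
      also have "\<dots> \<le> M * norm x" by (intro mult_right_mono) (simp_all add: M_def)
      finally show "norm (Q n x) \<le> M * norm x" .
    qed
    define e where "e = (1/2) ^ n / M"
    have e: "e > 0" using M(1) by (simp add: e_def)
    obtain x where x: "norm (T (Q n (Q n x))) > (real n * D n / e) * norm x" using unbounded by blast
    have "x \<noteq> 0" using x by (auto simp: Q0)
    define y where "y = Q n ((e / norm x) *\<^sub>R x)"
    have "norm y \<le> M * norm ((e / norm x) *\<^sub>R x)" unfolding y_def by (rule M(2))
    also have "\<dots> = (1/2) ^ n" using \<open>x \<noteq> 0\<close> M(1) e by (simp add: e_def)
    finally have ny: "norm y \<le> (1/2) ^ n" .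
    have "norm (T (Q n y)) = e / norm x * norm (T (Q n (Q n x)))"
      unfolding y_def using e by (simp add: Q_lin T_scaleR)
    moreover have "e / norm x * (real n * D n / e * norm x) < e / norm x * norm (T (Q n (Q n x)))"
      using x \<open>x \<noteq> 0\<close> e by (intro mult_strict_left_mono) auto
    then have "real n * D n < e / norm x * norm (T (Q n (Q n x)))"
      using \<open>x \<noteq> 0\<close> e by simp
    ultimately have "norm (T (Q n y)) > real n * D n" by simp
    with ny show ?thesis unfolding y_def by blast
  qed
  then have "\<forall>n. \<exists>y. y \<in> range (Q n) \<and> norm y \<le> (1/2) ^ n \<and> norm (T (Q n y)) > real n * D n" ..
  then have "\<exists>y. \<forall>n. y n \<in> range (Q n) \<and> norm (y n) \<le> (1/2) ^ n \<and> norm (T (Q n (y n))) > real n * D n"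
    by (rule choice)
  then obtain y where y: "\<And>n. y n \<in> range (Q n)" "\<And>n. norm (y n) \<le> (1/2) ^ n"
    "\<And>n. norm (T (Q n (y n))) > real n * D n" by blast
  have "summable y"
    by (rule summable_comparison_test'[OF summable_geometric, of "1/2" 0]) (simp_all only: y, simp)
  then obtain z where z: "y sums z" by (auto simp: summable_def)
  have cross: "Q m (y n) = 0" if "m \<noteq> n" for m n
  proof -
    obtain x where "y n = tpE (b n) x (b n)" using y(1)[of n] by (auto simp: Q_def)
    moreover have "tpE (b m) (tpE (b n) x (b n)) (b m) = 0"
      by (rule E.orthogonal_inner(1)) (use orth[OF that] in \<open>simp_all add: E.triple_orth_def\<close>)
    ultimately show ?thesis by (simp add: Q_def)
  qed
  have Qz: "Q m z = Q m (y m)" for m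
  proof -
    have "(\<lambda>n. Q m (y n)) sums Q m z"
      unfolding Q_def by (rule bounded_linear.sums[OF E.bounded_linear_tp(2) z])
    moreover have "(\<lambda>n. Q m (y n)) sums (\<Sum>n\<in>{m}. Q m (y n))"
      by (rule sums_finite) (use cross in auto)
    ultimately show ?thesis by (auto dest: sums_unique2)
  qed
  obtain C where C: "C > 0" "\<And>a b c. norm (T (tpE a b c) - tpF (T a) (T b) (T c)) \<le> C * norm a * norm b * norm c"
    using T_triple by blast
  obtain L where L: "L > 0" "\<And>x y z. norm (tpF x y z) \<le> L * norm x * norm y * norm z"
    using F.tp_bounded by blast
  define W where "W = L * norm (T z) + C * norm z"
  have W: "W \<ge> 0" using L(1) C(1) by (simp add: W_def)
  have "real m \<le> W" for m
  proof -
    have "real m * D m < norm (T (Q m z))" unfolding Qz by (rule y(3))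
    also have "\<dots> \<le> norm (tpF (T (b m)) (T z) (T (b m))) + norm (T (Q m z) - tpF (T (b m)) (T z) (T (b m)))"
      by (rule norm_triangle_sub)
    also have "\<dots> \<le> L * norm (T (b m)) * norm (T z) * norm (T (b m)) + C * norm (b m) * norm z * norm (b m)"
      unfolding Q_def by (intro add_mono L C)
    also have "\<dots> = (L * norm (T z)) * norm (T (b m)) ^ 2 + (C * norm z) * norm (b m) ^ 2"
      by (simp add: power2_eq_square mult_ac)
    also have "\<dots> \<le> (L * norm (T z)) * D m + (C * norm z) * D m"
      using L(1) C(1) by (intro add_mono mult_left_mono) (auto simp: D_def)
    also have "\<dots> = W * D m" by (simp add: W_def distrib_right)
    finally have "real m * D m < W * D m" .
    moreover have "D m > 0" by (simp add: D_def add_pos_nonneg)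
    ultimately show ?thesis by simp
  qed
  moreover obtain m where "W < real m" using reals_Archimedean2 by blast
  ultimately show False by (simp add: linorder_not_le[symmetric])
qed

lemma bounded_on_ideal:
  assumes J: "closed J" "triple_ideal scaleE tpE J" "J = T -` quadratic_annihilator tpF S"
    and third: "\<And>a b z. a \<in> quadratic_annihilator tpF S \<Longrightarrow> b \<in> quadratic_annihilator tpF S \<Longrightarrow> z \<in> S \<Longrightarrow> tpF a b z = 0"
  shows "\<exists>K. \<forall>x\<in>J. norm (T x) \<le> K * norm x"
proof -
  note id = E.ideal_closed_under[OF J(2)]
  note rs = E.real_subspace[OF id(1)]
  define \<phi> where "\<phi> a b c = tpF (T a) (T b) (T c)" for a b c
  \<comment> \<open>Polarisation: the annihilator is only a quadratic condition, but
    \<open>J\<close> is closed under sums.\<close>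
  have mid: "tpF (T a) s (T c) = 0" if a: "a \<in> J" "c \<in> J" "s \<in> S" for a c s
  proof -
    have "a + c \<in> J" by (rule E.subspace_add[OF id(1) a(1,2)])
    then have "tpF (T a + T c) s (T a + T c) = 0" "tpF (T a) s (T a) = 0" "tpF (T c) s (T c) = 0"
      using a unfolding J(3) by (simp_all add: quadratic_annihilator_def T_add)
    then have "tpF (T a) s (T c) + tpF (T c) s (T a) = 0" by (simp add: F.tp_add add.commute)
    also have "tpF (T c) s (T a) = tpF (T a) s (T c)" by (rule F.tp_commute)
    finally have "2 *\<^sub>R tpF (T a) s (T c) = 0" by (simp only: scaleR_2)
    then show ?thesis by simp
  qed
  \<comment> \<open>The second condition in (a) says exactly that this operator kills
    \<open>S\<close>; \<open>mid\<close> only treats \<open>S\<close> in the middle place.\<close>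
  have right: "\<exists>K. \<forall>x. norm (\<phi> a b x) \<le> K * norm x" if "a \<in> J" "b \<in> J" for a b
    unfolding \<phi>_def
    by (rule bounded_if_annihilates[OF F.bounded_linear_tp(1)])
      (use that third in \<open>auto simp: J(3)\<close>)
  have middle: "\<exists>K. \<forall>x. norm (\<phi> a x c) \<le> K * norm x" if "a \<in> J" "c \<in> J" for a c
    unfolding \<phi>_def
    by (rule bounded_if_annihilates[OF F.bounded_linear_tp(2)]) (rule mid[OF that])
  have comm: "\<phi> a b c = \<phi> c b a" for a b c unfolding \<phi>_def by (rule F.tp_commute)
  have \<phi>_lin: "\<phi> a b (c + c') = \<phi> a b c + \<phi> a b c'" "\<phi> a b (r *\<^sub>R c) = r *\<^sub>R \<phi> a b c"
    "\<phi> (a + a') b c = \<phi> a b c + \<phi> a' b c" "\<phi> (r *\<^sub>R a) b c = r *\<^sub>R \<phi> a b c" for a a' b c c' r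
    by (simp_all add: \<phi>_def T_add T_scaleR F.tp_add F.tp_scaleR)
  \<comment> \<open>The radius only has to cover the factor \<open>y\<close> of
    \<open>cube_root\<close>, of norm at most 2, which fills both places.\<close>
  define I where "I = {b \<in> J. norm b \<le> 3}"
  \<comment> \<open>Uniform boundedness in the third variable for fixed \<open>a\<close>;
    boundedness in the middle variable supplies the pointwise bounds.\<close>
  have step1: "\<exists>K. \<forall>b\<in>I. \<forall>c\<in>J. norm (\<phi> a b c) \<le> K * norm c" if a: "a \<in> J" for a
  proof (rule uniform_boundedness_on[OF J(1) rs \<phi>_lin(1,2)])
    show "\<exists>K. \<forall>x\<in>J. norm (\<phi> a b x) \<le> K * norm x" if "b \<in> I" for b
      using right[OF a, of b] that by (auto simp: I_def)
    show "\<exists>M. \<forall>b\<in>I. norm (\<phi> a b c) \<le> M" if c: "c \<in> J" for c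
    proof -
      obtain K where K: "\<And>x. norm (\<phi> a x c) \<le> K * norm x" using middle[OF a c] by blast
      have "norm (\<phi> a b c) \<le> \<bar>K\<bar> * 3" if "b \<in> I" for b
      proof -
        have "norm (\<phi> a b c) \<le> \<bar>K\<bar> * norm b" by (rule order_trans[OF K]) (simp add: mult_right_mono)
        also have "\<dots> \<le> \<bar>K\<bar> * 3" using that by (intro mult_left_mono) (auto simp: I_def)
        finally show ?thesis .
      qed
      then show ?thesis by blast
    qed
  qed
  \<comment> \<open>Uniform boundedness in the first variable over all pairs from \<open>I\<close>;
    \<open>step1\<close> supplies the pointwise bounds.\<close>
  have "\<exists>K. \<forall>i\<in>I \<times> I. \<forall>a\<in>J. norm ((\<lambda>(b, c) a. \<phi> a b c) i a) \<le> K * norm a"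
  proof (rule uniform_boundedness_on[OF J(1) rs])
    fix i :: "'a \<times> 'a" and x y :: 'a and r :: real
    show "(\<lambda>(b, c) a. \<phi> a b c) i (x + y) = (\<lambda>(b, c) a. \<phi> a b c) i x + (\<lambda>(b, c) a. \<phi> a b c) i y"
      "(\<lambda>(b, c) a. \<phi> a b c) i (r *\<^sub>R x) = r *\<^sub>R (\<lambda>(b, c) a. \<phi> a b c) i x"
      by (simp_all add: \<phi>_lin case_prod_beta)
    assume "i \<in> I \<times> I"
    then obtain b c where bc: "i = (b, c)" "b \<in> J" "c \<in> J" by (auto simp: I_def)
    show "\<exists>K. \<forall>a\<in>J. norm ((\<lambda>(b, c) a. \<phi> a b c) i a) \<le> K * norm a"
      using right[OF bc(3,2)] comm unfolding bc(1) by auto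
  next
    fix a assume "a \<in> J"
    then obtain K where K: "\<And>b c. b \<in> I \<Longrightarrow> c \<in> J \<Longrightarrow> norm (\<phi> a b c) \<le> K * norm c" using step1 by blast
    have "norm (\<phi> a b c) \<le> \<bar>K\<bar> * 3" if "b \<in> I" "c \<in> I" for b c
    proof -
      have "c \<in> J" using that by (simp add: I_def)
      have "norm (\<phi> a b c) \<le> \<bar>K\<bar> * norm c"
        by (rule order_trans[OF K[OF that(1) \<open>c \<in> J\<close>]]) (simp add: mult_right_mono)
      also have "\<dots> \<le> \<bar>K\<bar> * 3" using that by (intro mult_left_mono) (auto simp: I_def)
      finally show ?thesis .
    qed
    then show "\<exists>M. \<forall>i\<in>I \<times> I. norm ((\<lambda>(b, c) a. \<phi> a b c) i a) \<le> M" by auto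
  qed
  then obtain K where K: "\<And>a b c. a \<in> J \<Longrightarrow> b \<in> I \<Longrightarrow> c \<in> I \<Longrightarrow> norm (\<phi> a b c) \<le> K * norm a" by fastforce
  obtain C where C: "C > 0" "\<And>a b c. norm (T (tpE a b c) - tpF (T a) (T b) (T c)) \<le> C * norm a * norm b * norm c"
    using T_triple by blast
  obtain L where L: "L > 0" "\<And>h. norm (E.mop h) \<le> L * norm h ^ 2" using E.norm_mop_le by blast
  \<comment> \<open>Vectors of \<open>J\<close> of norm at most \<open>r\<close> satisfy the bound
    1/2 required by \<open>cube_root\<close>.\<close>
  define r where "r = 1 / (2 * (L + 1))"
  have r: "r > 0" "L * r ^ 2 \<le> 1/2"
  proof -
    show "r > 0" using L(1) by (simp add: r_def)
    have "r \<le> 1" "L * r \<le> 1/2" using L(1) by (simp_all add: r_def field_simps)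
    have "L * r ^ 2 = (L * r) * r" by (simp add: power2_eq_square)
    also have "\<dots> \<le> (L * r) * 1" using \<open>r \<le> 1\<close> L(1) \<open>r > 0\<close> by (intro mult_left_mono) auto
    finally show "L * r ^ 2 \<le> 1/2" using \<open>L * r \<le> 1/2\<close> by simp
  qed
  define B where "B = \<bar>K\<bar> * 3 + C * 3 * 2 * 2"
  have small: "norm (T h) \<le> B" if h: "h \<in> J" "norm h \<le> r" for h
  proof -
    have "norm h ^ 2 \<le> r ^ 2" using h(2) by (intro power_mono) auto
    then have "L * norm h ^ 2 \<le> L * r ^ 2" using L(1) by (intro mult_left_mono) auto
    then have "norm (E.mop h) \<le> 1/2" using L(2)[of h] r(2) by linarith
    from E.cube_root[OF this] obtain x y where "tpE x y y = h \<and> norm x \<le> 3 \<and> norm y \<le> 2 \<and>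
      (\<forall>S. closed S \<longrightarrow> (\<forall>X\<in>palg (E.mop h). ap X h \<in> S) \<longrightarrow> x \<in> S \<and> y \<in> S)"
      by (elim exE)
    then have xy: "tpE x y y = h" "norm x \<le> 3" "norm y \<le> 2"
      and mem: "\<And>S. closed S \<Longrightarrow> \<forall>X\<in>palg (E.mop h). ap X h \<in> S \<Longrightarrow> x \<in> S \<and> y \<in> S" by simp_all
    have "ap X h \<in> J" if "X \<in> palg (E.mop h)" for X
    proof (rule E.palg_mop_invariant[OF that J(1) rs])
      show "ap (E.mop h ^ k) h \<in> J" for k by (induction k) (simp_all add: h id(2))
    qed
    then have J': "x \<in> J" "y \<in> J" using mem[OF J(1)] by simp_all
    have "norm (\<phi> x y y) \<le> K * norm x" by (rule K) (use J' xy in \<open>auto simp: I_def\<close>)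
    also have "\<dots> \<le> \<bar>K\<bar> * norm x" by (intro mult_right_mono) auto
    also have "\<dots> \<le> \<bar>K\<bar> * 3" using xy(2) by (intro mult_left_mono) auto
    finally have 1: "norm (\<phi> x y y) \<le> \<bar>K\<bar> * 3" .
    have "norm (T h - \<phi> x y y) \<le> C * norm x * norm y * norm y"
      unfolding \<phi>_def xy(1)[symmetric] by (rule C)
    also have "\<dots> \<le> C * 3 * 2 * 2" using xy(2,3) C(1) by (intro mult_mono) auto
    finally show ?thesis using 1 norm_triangle_sub[of "T h" "\<phi> x y y"] by (simp add: B_def)
  qed
  have "norm (T x) \<le> (B / r) * norm x" if x: "x \<in> J" for x
  proof (cases "x = 0")
    case False
    have "norm (T ((r / norm x) *\<^sub>R x)) \<le> B"
      using False r(1) by (intro small real_vector.subspace_scale[OF rs x]) auto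
    then have "r / norm x * norm (T x) \<le> B" using r(1) by (simp add: T_scaleR)
    then show ?thesis using False r(1) by (simp add: field_simps)
  qed simp
  then show ?thesis by blast
qed

lemma ideal_eq_UNIV:
  assumes J: "closed J" "triple_ideal scaleE tpE J" "J = T -` quadratic_annihilator tpF S"
    and bounded: "\<exists>K. \<forall>x\<in>J. norm (T x) \<le> K * norm x"
  shows "J = UNIV"
proof (rule ccontr)
  note id = E.ideal_closed_under[OF J(2)]
  assume "J \<noteq> UNIV"
  from E.orthogonal_sequence_or_indecomposable[OF this] show False
  proof (elim disjE exE conjE)
    fix b :: "nat \<Rightarrow> 'a"
    assume "\<forall>n. b n \<notin> J" "\<forall>m n. m \<noteq> n \<longrightarrow> E.triple_orth (b m) (b n)"
    then show False by (intro gliding_hump[OF J, of b]) auto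
  next
    fix M assume M: "E.inner_ideal M" "\<not> M \<subseteq> J"
      "\<forall>b\<in>M. \<forall>c\<in>M. E.triple_orth b c \<longrightarrow> b \<in> J \<or> c \<in> J"
    then obtain e where e: "e \<in> M" "e \<notin> J" by blast
    have line: "\<exists>c. tpE e y e - scaleE c e \<in> J" for y
      by (rule E.indecomposable_minimal[OF J(1,2) M(1) e M(3)])
    obtain d where d: "d > 0" "\<And>c j. j \<in> J \<Longrightarrow> cmod c * d \<le> norm (scaleE c e + j)"
      using E.distance_from_subspace[OF J(1) id(1) e(2)] by blast
    obtain K where K: "\<And>x. x \<in> J \<Longrightarrow> norm (T x) \<le> K * norm x" using bounded by blast
    obtain L where L: "L > 0" "\<And>x y z. norm (tpE x y z) \<le> L * norm x * norm y * norm z"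
      using E.tp_bounded by blast
    define B where "B = norm (T e) / d + \<bar>K\<bar> * (1 + norm e / d)"
    have B: "B \<ge> 0" using d(1) by (simp add: B_def)
    \<comment> \<open>Split q = {e,y,e} as c e + j with \<open>j\<close> in \<open>J\<close>. The
      coefficient is at most norm q / d, so both parts, and their images, are controlled by the norm
      of q.\<close>
    have TQ: "norm (T (tpE e y e)) \<le> B * norm (tpE e y e)" for y
    proof -
      define q where "q = tpE e y e"
      obtain c where c: "q - scaleE c e \<in> J" using line[of y] unfolding q_def by blast
      have cd: "cmod c \<le> norm q / d" using d(2)[OF c, of c] d(1) by (simp add: field_simps)
      have "norm (T q) = norm (scaleF c (T e) + T (q - scaleE c e))"
        by (simp add: T_diff T_scale)
      also have "\<dots> \<le> cmod c * norm (T e) + \<bar>K\<bar> * norm (q - scaleE c e)"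
        by (rule norm_triangle_le, rule add_mono)
          (simp add: F.norm_scale, rule order_trans[OF K[OF c]], simp add: mult_right_mono)
      also have "\<dots> \<le> norm q / d * norm (T e) + \<bar>K\<bar> * (norm q + norm q / d * norm e)"
      proof (intro add_mono mult_right_mono mult_left_mono cd)
        have "norm (q - scaleE c e) \<le> norm q + cmod c * norm e"
          using norm_triangle_ineq4[of q "scaleE c e"] by (simp add: E.norm_scale)
        also have "\<dots> \<le> norm q + norm q / d * norm e" by (intro add_left_mono mult_right_mono cd) simp
        finally show "norm (q - scaleE c e) \<le> norm q + norm q / d * norm e" .
      qed auto
      also have "\<dots> = B * norm q" by (simp add: B_def algebra_simps)
      finally show ?thesis by (simp add: q_def)
    qed
    have "norm (T (tpE e y e)) \<le> (B * (L * norm e * norm e)) * norm y" for y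
    proof -
      have "B * norm (tpE e y e) \<le> B * (L * norm e * norm y * norm e)"
        by (intro mult_left_mono L B)
      with TQ[of y] show ?thesis by (simp add: mult_ac)
    qed
    then have "T e \<in> quadratic_annihilator tpF S" by (intro quadratic_bounded_imp) blast
    then show False using e(2) by (simp add: J(3))
  qed
qed

lemma separating_space_continuous:
  assumes "continuous_on UNIV T"
  shows "S = {0}"
proof -
  have "z = 0" if "x \<longlonglongrightarrow> 0" "(\<lambda>n. T (x n)) \<longlonglongrightarrow> z" for x z
  proof -
    have "(\<lambda>n. T (x n)) \<longlonglongrightarrow> T 0"
      by (rule continuous_on_tendsto_compose[OF assms that(1)]) auto
    then show ?thesis using LIMSEQ_unique[OF that(2)] by simp
  qed
  then show ?thesis
    using subspace_0[OF subspace_separating] by (auto simp: separating_space_def)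
qed

lemma continuous_if_bounded:
  assumes "\<exists>K. \<forall>x. norm (T x) \<le> K * norm x"
  shows "continuous_on UNIV T"
proof -
  obtain K where "\<And>x. norm (T x) \<le> K * norm x" using assms by blast
  then have "bounded_linear T"
    by (intro bounded_linear_intro[of T K]) (auto simp: T_add T_scaleR mult.commute)
  then show ?thesis by (rule linear_continuous_on)
qed

end

theorem theorem14:
  fixes scaleE :: "complex \<Rightarrow> 'a::banach \<Rightarrow> 'a" and tpE :: "'a \<Rightarrow> 'a \<Rightarrow> 'a \<Rightarrow> 'a"
    and scaleF :: "complex \<Rightarrow> 'b::banach \<Rightarrow> 'b" and tpF :: "'b \<Rightarrow> 'b \<Rightarrow> 'b \<Rightarrow> 'b"
    and T :: "'a \<Rightarrow> 'b" and Ann :: "'b set" and J :: "'a set"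
  assumes "jb_star_triple scaleE tpE"
    and "jordan_banach_triple scaleF tpF"
    and "generalised_triple_hom scaleE tpE scaleF tpF T"
    and "Ann = quadratic_annihilator tpF (separating_space T)"
    and "J = T -` Ann"
  shows "(closed J \<and> triple_ideal scaleE tpE J \<and>
            (\<forall>a\<in>Ann. \<forall>b\<in>Ann. \<forall>z\<in>separating_space T. tpF a b z = 0))
         \<longleftrightarrow> continuous_on UNIV T"
proof -
  interpret triple_hom scaleE tpE scaleF tpF T
    using assms(1-3) by (simp add: triple_hom_def triple_hom_axioms_def)
  have J: "J = T -` quadratic_annihilator tpF (separating_space T)" by (simp add: assms)
  show ?thesis
  proof
    assume "closed J \<and> triple_ideal scaleE tpE J \<and>
      (\<forall>a\<in>Ann. \<forall>b\<in>Ann. \<forall>z\<in>separating_space T. tpF a b z = 0)"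
    then have cl: "closed J" and ideal: "triple_ideal scaleE tpE J"
      and third: "\<And>a b z. a \<in> Ann \<Longrightarrow> b \<in> Ann \<Longrightarrow> z \<in> separating_space T \<Longrightarrow> tpF a b z = 0" by auto
    have bounded: "\<exists>K. \<forall>x\<in>J. norm (T x) \<le> K * norm x"
      by (rule bounded_on_ideal[OF cl ideal J third[unfolded assms(4)]])
    have "J = UNIV" by (rule ideal_eq_UNIV[OF cl ideal J bounded])
    with bounded show "continuous_on UNIV T" by (intro continuous_if_bounded) simp
  next
    assume "continuous_on UNIV T"
    then have S0: "separating_space T = {0}" by (rule separating_space_continuous)
    then have "Ann = UNIV" by (simp add: assms(4) quadratic_annihilator_def)
    then have "J = UNIV" by (simp add: assms(5))
    then show "closed J \<and> triple_ideal scaleE tpE J \<and>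
      (\<forall>a\<in>Ann. \<forall>b\<in>Ann. \<forall>z\<in>separating_space T. tpF a b z = 0)"
      by (simp add: S0 triple_ideal_def)
  qed
qed

end
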